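(* Let $\mathfrak K$ be a one-component tame knot class of braid index $n$. There exist $\rho_0,c,C>0$ (which may depend on a chosen geometric braid representative of $\mathfrak K$) and smooth curves $v_\rho\in\mathscr C(\mathfrak K)$, $0<\rho\le\rho_0$, such that $v_\rho\to u_n$ smoothly as $\rho\downarrow 0$, and for all $0<\rho\le\rho_0$ $$|\overline E(v_\rho)-(2\pi n)^2|\le C\rho^2,\qquad \operatorname{Thi}(v_\rho)\ge c\rho,\qquad \operatorname{Rop}(v_\rho)\le C\rho^{-1}.$$
   Context: $\mathbb T=\mathbb R/\mathbb Z$. A knot class is an ambient isotopy class of tame knots in $\mathbb R^3$. The braid index is the minimal number of strands of a closed braid representing the class. $\mathscr C(\mathfrak K)$ is the set of all $\gamma\in H^2(\mathbb T,\mathbb R^3)$ with $\gamma(0)=0$, $|\gamma'|\equiv 1$, such that $\gamma$ is embedded and represents $\mathfrak K$. The unit-length $n$-covered circle is $u_n(t)=\frac{1}{2\pi n}\bigl(e_r(2\pi n t)-e_r(0)\bigr)$ with $e_r(\theta)=(\cos\theta,\sin\theta,0)$. For a regular curve $\gamma\in H^2(\mathbb T,\mathbb R^3)$: $\mathscr L(\gamma)=\int_{\mathbb T}|\gamma'|\,dt$, $E_{\mathrm{bend}}(\gamma)=\int_{\mathbb T}\frac{|\gamma'\times\gamma''|^2}{|\gamma'|^5}\,dt$, and $\overline E(\gamma)=\mathscr L(\gamma)E_{\mathrm{bend}}(\gamma)$. Thickness: for a regular $C^1$-curve $\gamma$ with unit tangent $T_\gamma=\gamma'/|\gamma'|$ and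 $s\neq t$, let $r_{\mathrm{tp}}[\gamma](s,t)=\dfrac{|\gamma(t)-\gamma(s)|^2}{2|P^\perp_{T_\gamma(s)}(\gamma(t)-\gamma(s))|}$, where $P^\perp_{T}=I-T\otimes T$, with value $0$ if $\gamma(t)=\gamma(s)$ and $+\infty$ if the chord is nonzero but the denominator vanishes; $\operatorname{Thi}(\gamma)=\inf_{s\ne t}r_{\mathrm{tp}}[\gamma](s,t)$. Ropelength is $\operatorname{Rop}(\gamma)=\mathscr L(\gamma)/\operatorname{Thi}(\gamma)$, with $\operatorname{Rop}(\gamma)=+\infty$ if $\operatorname{Thi}(\gamma)=0$. *)

theory Defs
  imports "HOL-Analysis.Analysis"
begin

text \<open>Functions on the circle \<open>\<real>/\<int>\<close> are represented by 1-periodic functions on \<open>real\<close>.\<close>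

definition periodic1 :: "(real \<Rightarrow> 'a) \<Rightarrow> bool" where
  "periodic1 f \<longleftrightarrow> (\<forall>t. f (t + 1) = f t)"

definition nth_vderiv :: "nat \<Rightarrow> (real \<Rightarrow> 'a::real_normed_vector) \<Rightarrow> real \<Rightarrow> 'a" where
  "nth_vderiv k f = ((\<lambda>g t. vector_derivative g (at t)) ^^ k) f"

definition smooth_fun :: "(real \<Rightarrow> 'a::real_normed_vector) \<Rightarrow> bool" where
  "smooth_fun f \<longleftrightarrow> (\<forall>k t. nth_vderiv k f differentiable (at t))"

definition in_L2 :: "(real \<Rightarrow> real ^ 3) \<Rightarrow> bool" where
  "in_L2 f \<longleftrightarrow> set_borel_measurable lborel {0..1} f \<and>
     set_integrable lborel {0..1} (\<lambda>t. (norm (f t))\<^sup>2)"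

definition weak_deriv :: "(real \<Rightarrow> real ^ 3) \<Rightarrow> (real \<Rightarrow> real ^ 3) \<Rightarrow> bool" where
  "weak_deriv f g \<longleftrightarrow>
     (\<forall>\<phi>::real \<Rightarrow> real. smooth_fun \<phi> \<and> periodic1 \<phi> \<longrightarrow>
        (LINT t:{0..1}|lborel. nth_vderiv 1 \<phi> t *\<^sub>R f t)
          = - (LINT t:{0..1}|lborel. \<phi> t *\<^sub>R g t))"

text \<open>A Sobolev class of order 2 has a unique continuous representative (which is then of
  class \<open>C\<^sup>1\<close>); continuity selects it, so pointwise conditions on \<open>\<gamma>\<close> and \<open>\<gamma>'\<close> are meaningful.\<close>

definition H2_curve :: "(real \<Rightarrow> real ^ 3) \<Rightarrow> bool" where
  "H2_curve \<gamma> \<longleftrightarrow> periodic1 \<gamma> \<and> continuous_on UNIV \<gamma> \<and>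
     (\<exists>g1 g2. in_L2 \<gamma> \<and> in_L2 g1 \<and> in_L2 g2 \<and> weak_deriv \<gamma> g1 \<and> weak_deriv g1 g2)"

definition ambient_isotopic :: "(real ^ 3) set \<Rightarrow> (real ^ 3) set \<Rightarrow> bool" where
  "ambient_isotopic A B \<longleftrightarrow>
     (\<exists>H :: real \<Rightarrow> real ^ 3 \<Rightarrow> real ^ 3.
        continuous_on ({0..1} \<times> UNIV) (\<lambda>(s, x). H s x) \<and>
        (\<forall>s\<in>{0..1}. \<exists>g. homeomorphism UNIV UNIV (H s) g) \<and>
        (\<forall>x. H 0 x = x) \<and> H 1 ` A = B)"

definition knot :: "(real ^ 3) set \<Rightarrow> bool" where
  "knot A \<longleftrightarrow> (\<exists>g. simple_path g \<and> pathfinish g = pathstart g \<and> path_image g = A)"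

definition polygonal_knot :: "(real ^ 3) set \<Rightarrow> bool" where
  "polygonal_knot A \<longleftrightarrow> knot A \<and>
     (\<exists>S. finite S \<and> A = (\<Union>(a, b)\<in>S. closed_segment a b))"

definition tame_knot :: "(real ^ 3) set \<Rightarrow> bool" where
  "tame_knot A \<longleftrightarrow> knot A \<and> (\<exists>P. polygonal_knot P \<and> ambient_isotopic A P)"

definition tame_knot_class :: "(real ^ 3) set set \<Rightarrow> bool" where
  "tame_knot_class K \<longleftrightarrow> (\<exists>A. tame_knot A \<and> K = {B. ambient_isotopic A B})"

definition e_r :: "real \<Rightarrow> real ^ 3" where
  "e_r \<theta> = vector [cos \<theta>, sin \<theta>, 0]"

text \<open>\<open>closed_braid n L\<close>: \<open>L\<close> is a closed smooth geometric braid (a link) with \<open>n\<close> strands around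
  the third coordinate axis.  Strand \<open>i\<close> is a graph over the polar angle \<open>\<theta>\<close>, with position
  \<open>(r i \<theta>, h i \<theta>)\<close> in the open half-plane at angle \<open>\<theta>\<close>.  The strands are pairwise disjoint,
  and after one turn strand \<open>i\<close> continues as strand \<open>\<sigma> i\<close>; imposing this at all \<open>\<theta>\<close> makes the
  closing smooth.\<close>

definition closed_braid :: "nat \<Rightarrow> (real ^ 3) set \<Rightarrow> bool" where
  "closed_braid n L \<longleftrightarrow> 1 \<le> n \<and>
     (\<exists>(r :: nat \<Rightarrow> real \<Rightarrow> real) (h :: nat \<Rightarrow> real \<Rightarrow> real) \<sigma>.
        bij_betw \<sigma> {..<n} {..<n} \<and>
        (\<forall>i<n. smooth_fun (r i) \<and> smooth_fun (h i) \<and>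
           (\<forall>\<theta>. 0 < r i \<theta> \<and> r i (\<theta> + 2 * pi) = r (\<sigma> i) \<theta> \<and> h i (\<theta> + 2 * pi) = h (\<sigma> i) \<theta>)) \<and>
        (\<forall>\<theta>. \<forall>i<n. \<forall>j<n. i \<noteq> j \<longrightarrow> (r i \<theta>, h i \<theta>) \<noteq> (r j \<theta>, h j \<theta>)) \<and>
        L = (\<Union>i<n. range (\<lambda>\<theta>. r i \<theta> *\<^sub>R e_r \<theta> + vector [0, 0, h i \<theta>])))"

text \<open>A relation rather than \<open>LEAST\<close>: that the minimum exists for every tame class is
  Alexander's theorem.\<close>

definition has_braid_index :: "(real ^ 3) set set \<Rightarrow> nat \<Rightarrow> bool" where
  "has_braid_index K n \<longleftrightarrow>
     (\<exists>L\<in>K. closed_braid n L) \<and> (\<forall>m. (\<exists>L\<in>K. closed_braid m L) \<longrightarrow> n \<le> m)"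

definition curves_of_class :: "(real ^ 3) set set \<Rightarrow> (real \<Rightarrow> real ^ 3) set" where
  "curves_of_class K =
     {\<gamma>. H2_curve \<gamma> \<and> \<gamma> 0 = 0 \<and> (\<forall>t. norm (nth_vderiv 1 \<gamma> t) = 1) \<and>
         inj_on \<gamma> {0..<1} \<and> range \<gamma> \<in> K}"

definition covered_circle :: "nat \<Rightarrow> real \<Rightarrow> real ^ 3" where
  "covered_circle n t = (1 / (2 * pi * real n)) *\<^sub>R (e_r (2 * pi * real n * t) - e_r 0)"

definition curve_length :: "(real \<Rightarrow> real ^ 3) \<Rightarrow> real" where
  "curve_length \<gamma> = (LINT t:{0..1}|lborel. norm (nth_vderiv 1 \<gamma> t))"

definition E_bend :: "(real \<Rightarrow> real ^ 3) \<Rightarrow> real" where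
  "E_bend \<gamma> = (LINT t:{0..1}|lborel.
     (norm (cross3 (nth_vderiv 1 \<gamma> t) (nth_vderiv 2 \<gamma> t)))\<^sup>2 / norm (nth_vderiv 1 \<gamma> t) ^ 5)"

definition E_bar :: "(real \<Rightarrow> real ^ 3) \<Rightarrow> real" where
  "E_bar \<gamma> = curve_length \<gamma> * E_bend \<gamma>"

definition unit_tangent :: "(real \<Rightarrow> real ^ 3) \<Rightarrow> real \<Rightarrow> real ^ 3" where
  "unit_tangent \<gamma> t = nth_vderiv 1 \<gamma> t /\<^sub>R norm (nth_vderiv 1 \<gamma> t)"

definition perp_proj :: "real ^ 3 \<Rightarrow> real ^ 3 \<Rightarrow> real ^ 3" where
  "perp_proj T x = x - (T \<bullet> x) *\<^sub>R T"

definition r_tp :: "(real \<Rightarrow> real ^ 3) \<Rightarrow> real \<Rightarrow> real \<Rightarrow> ereal" where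
  "r_tp \<gamma> s t =
     (if \<gamma> t = \<gamma> s then 0
      else if perp_proj (unit_tangent \<gamma> s) (\<gamma> t - \<gamma> s) = 0 then \<infinity>
      else ereal ((norm (\<gamma> t - \<gamma> s))\<^sup>2 / (2 * norm (perp_proj (unit_tangent \<gamma> s) (\<gamma> t - \<gamma> s)))))"

definition Thi :: "(real \<Rightarrow> real ^ 3) \<Rightarrow> ereal" where
  "Thi \<gamma> = (INF (s, t)\<in>{(s, t). s \<in> {0..<1} \<and> t \<in> {0..<1} \<and> s \<noteq> t}. r_tp \<gamma> s t)"

definition Rop :: "(real \<Rightarrow> real ^ 3) \<Rightarrow> ereal" where
  "Rop \<gamma> = (if Thi \<gamma> = 0 then \<infinity> else ereal (curve_length \<gamma>) / Thi \<gamma>)"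

end

(* The braid is squeezed radially towards the unit circle: a strand point at cylindrical
   coordinates (r, theta, h) is moved to (1 + rho r, theta, rho h), by a map that extends to all of
   space and is isotopic to the identity.  Since the braid closes up to a knot, its permutation is
   an n-cycle, so that the result is a single curve eta_rho winding n times around the axis.

   The curve v_rho is eta_rho, scaled to length 1 and parametrized by arc length.  With respect to
   the old parameter, d/ds acts on functions as (L / |eta'|) d/dt, so the k-th derivative of v_rho is
   obtained by iterating this operator, and smooth convergence follows without differentiating the
   inverse arc length function.  In the energy, the first-order terms of L and of the bending energy
   are rho * int a and - rho * int (a + 2 a'' / omega^2), up to the common factor omega = 2 pi n;
   they cancel in the product,
   because a'' integrates to 0.

   The tangent-point radius is at least 1 / (8 K) near the diagonal, where K bounds |v_rho''|; away
   from it, it is at least half the distance of the two points, which is of order rho because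
   distinct strands over the same angle are at distance at least d rho and the strands are
   Lipschitz graphs over the angle. *)

theory Submission
  imports Defs
begin

section \<open>Smooth families of periodic curves\<close>

text \<open>No derivative in \<rho> is taken anywhere. The inverse arc length function
  \<open>T\<close> is chosen separately for each \<rho>, so its joint regularity is unknown; two
  kinds of uniform estimates replace it. All t-derivatives stay within O(\<rho>) of their values at
  0, which gives smooth convergence, and the few functions entering the energy have expansions with
  remainder O(\<rho>^2), because an O(\<rho>) estimate would lose one order in the energy bound. The
  offset 1 in the radius 1 + \<rho> r, together with r > 0, keeps the angular component of the
  velocity at least \<omega> for every \<rho> in [0,1]. All roots and quotients therefore stay
  uniformly away from their singularities, no smallness of \<rho> is ever required, and \<rho>0 = 1
  works. Membership in the knot class is a statement about the image and comes from the ambient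
  isotopy; injectivity of the parametrization is separate and comes out of the same chord estimates
  as the thickness.\<close>

lemma nth_vderiv_0: "nth_vderiv 0 f = f"
  by (simp add: nth_vderiv_def)

lemma nth_vderiv_Suc: "nth_vderiv (Suc k) f = (\<lambda>t. vector_derivative (nth_vderiv k f) (at t))"
  by (simp add: nth_vderiv_def)

lemma nth_vderiv_Suc': "nth_vderiv (Suc k) f = nth_vderiv k (\<lambda>t. vector_derivative f (at t))"
  unfolding nth_vderiv_def by (simp only: funpow_Suc_right comp_def)

lemma smooth_fun_has_vderiv:
  assumes "smooth_fun f"
  shows "(nth_vderiv k f has_vector_derivative nth_vderiv (Suc k) f t) (at t)"
  using assms unfolding smooth_fun_def nth_vderiv_Suc by (simp add: vector_derivative_works)

lemma smooth_fun_deriv: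
  assumes "smooth_fun f"
  shows "smooth_fun (\<lambda>t. vector_derivative f (at t))"
  using assms unfolding smooth_fun_def by (metis nth_vderiv_Suc')

lemma smooth_fun_nth_vderiv:
  assumes "smooth_fun f"
  shows "smooth_fun (nth_vderiv k f)"
proof (induction k)
  case 0
  then show ?case using assms by (simp add: nth_vderiv_0)
next
  case (Suc k)
  then show ?case unfolding nth_vderiv_Suc by (rule smooth_fun_deriv)
qed

lemma smooth_fun_continuous:
  assumes "smooth_fun f"
  shows "continuous_on S f"
  using assms unfolding smooth_fun_def
  by (metis differentiable_imp_continuous_within continuous_at_imp_continuous_on nth_vderiv_0)

lemma smooth_fun_scale_arg:
  fixes f :: "real \<Rightarrow> 'a::real_normed_vector"
  assumes "smooth_fun f"
  shows "smooth_fun (\<lambda>t. f (c * t))"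
proof -
  have d: "((\<lambda>t. c ^ k *\<^sub>R nth_vderiv k f (c * t)) has_vector_derivative
      c ^ Suc k *\<^sub>R nth_vderiv (Suc k) f (c * t)) (at t)" for k t
  proof -
    have "((\<lambda>t. c * t) has_vector_derivative c) (at t)"
      by (auto intro!: derivative_eq_intros simp: has_real_derivative_iff_has_vector_derivative[symmetric])
    from vector_diff_chain_at[OF this smooth_fun_has_vderiv[OF assms]]
    have "((\<lambda>t. nth_vderiv k f (c * t)) has_vector_derivative c *\<^sub>R nth_vderiv (Suc k) f (c * t)) (at t)"
      by (simp add: comp_def)
    from bounded_linear.has_vector_derivative[OF bounded_linear_scaleR_right this, of "c ^ k"]
    show ?thesis by (simp add: mult.commute)
  qed
  have "nth_vderiv k (\<lambda>t. f (c * t)) = (\<lambda>t. c ^ k *\<^sub>R nth_vderiv k f (c * t))" for k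
  proof (induction k)
    case 0
    then show ?case by (simp add: nth_vderiv_0)
  next
    case (Suc k)
    show ?case
      unfolding nth_vderiv_Suc[of k "\<lambda>t. f (c * t)"] Suc.IH by (rule ext) (rule vector_derivative_at[OF d])
  qed
  then show ?thesis unfolding smooth_fun_def using differentiableI_vector[OF d] by simp
qed

text \<open>\<open>vector_derivative\<close> is a choice operator, so the identity is reduced to
  both sides having the same set of possible derivatives. This also covers points where no
  derivative exists, and periodicity passes to all \<open>nth_vderiv\<close>.\<close>

lemma vector_derivative_shift:
  fixes f :: "real \<Rightarrow> 'a::real_normed_vector"
  shows "vector_derivative (\<lambda>t. f (t + c)) (at t) = vector_derivative f (at (t + c))"
proof -
  have shift: "(g has_vector_derivative D) (at (x + d)) \<Longrightarrow>
      ((\<lambda>t. g (t + d)) has_vector_derivative D) (at x)" for g :: "real \<Rightarrow> 'a" and x d D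
  proof -
    assume g: "(g has_vector_derivative D) (at (x + d))"
    have "((\<lambda>t. t + d) has_vector_derivative 1) (at x)"
      by (auto intro!: derivative_eq_intros simp: has_real_derivative_iff_has_vector_derivative[symmetric])
    from vector_diff_chain_at[OF this g] show ?thesis by (simp add: comp_def)
  qed
  have "((\<lambda>t. f (t + c)) has_vector_derivative D) (at t) \<longleftrightarrow>
      (f has_vector_derivative D) (at (t + c))" for D
    using shift[of f D t c] shift[of "\<lambda>t. f (t + c)" D "t + c" "- c"] by auto
  then show ?thesis unfolding vector_derivative_def by simp
qed

lemma periodic1_nth_vderiv:
  assumes "periodic1 f"
  shows "periodic1 (nth_vderiv k f)"
proof (induction k)
  case 0
  then show ?case using assms by (simp add: nth_vderiv_0)
next
  case (Suc k)
  then have "(\<lambda>t. nth_vderiv k f (t + 1)) = nth_vderiv k f" by (auto simp: periodic1_def)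
  then show ?case unfolding nth_vderiv_Suc periodic1_def
    by (metis vector_derivative_shift)
qed

lemma periodic1_int:
  assumes "periodic1 f"
  shows "f (t + of_int k) = f t"
proof (induction k rule: int_induct[where k=0])
  case base
  then show ?case by simp
next
  case (step1 i)
  then show ?case using assms unfolding periodic1_def by (metis add.assoc of_int_1 of_int_add)
next
  case (step2 i)
  then show ?case using assms unfolding periodic1_def by (metis add.assoc diff_add_cancel of_int_1 of_int_add)
qed

lemma periodic1_frac:
  assumes "periodic1 f"
  shows "f t = f (frac t)"
  using periodic1_int[OF assms, of t "- \<lfloor>t\<rfloor>"] by (simp add: frac_def)

lemma periodic1_range:
  assumes "periodic1 f"
  shows "range f = f ` {0..<1}"
proof
  show "range f \<subseteq> f ` {0..<1}"
  proof
    fix y assume "y \<in> range f"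
    then obtain t where "y = f t" by blast
    then have "y = f (frac t)" using periodic1_frac[OF assms] by simp
    moreover have "frac t \<in> {0..<1}" using frac_lt_1[of t] by simp
    ultimately show "y \<in> f ` {0..<1}" by blast
  qed
qed auto

lemma periodic1_bounded:
  fixes f :: "real \<Rightarrow> 'a::real_normed_vector"
  assumes "periodic1 f" "continuous_on UNIV f"
  obtains B where "\<And>t. norm (f t) \<le> B"
proof -
  have "continuous_on {0..1} f" using assms(2) continuous_on_subset by blast
  then have "bounded (f ` {0..1})" by (intro compact_imp_bounded compact_continuous_image) auto
  then obtain B where B: "\<And>x. x \<in> {0..1} \<Longrightarrow> norm (f x) \<le> B" unfolding bounded_iff by blast
  have "norm (f t) \<le> B" for t
  proof -
    have "frac t \<in> {0..1}" using frac_lt_1[of t] by (simp add: less_imp_le)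
    then show ?thesis using B periodic1_frac[OF assms(1), of t] by simp
  qed
  then show ?thesis using that by blast
qed

lemma periodic_bounded_real:
  fixes f :: "real \<Rightarrow> real"
  assumes "continuous_on UNIV f" "\<And>t. f (t + 1) = f t"
  shows "\<exists>B. \<forall>t. \<bar>f t\<bar> \<le> B"
  using periodic1_bounded[of f] assms unfolding periodic1_def by (metis real_norm_def)

text \<open>The reciprocal is again continuous and periodic, hence bounded; its bound inverts to the
  lower bound.\<close>

lemma periodic1_pos_lower_bound:
  assumes "periodic1 f" "continuous_on UNIV f" "\<And>t. (0::real) < f t"
  obtains d where "0 < d" "\<And>t. d \<le> f t"
proof -
  have "periodic1 (\<lambda>t. inverse (f t))" using assms(1) by (simp add: periodic1_def)
  moreover have "continuous_on UNIV (\<lambda>t. inverse (f t))"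
    using assms(2,3) by (intro continuous_intros) (auto simp: less_imp_neq[symmetric])
  ultimately obtain B where B: "\<And>t. norm (inverse (f t)) \<le> B" by (rule periodic1_bounded) blast
  have "0 < B" using B[of 0] assms(3)[of 0] by (smt (verit) norm_le_zero_iff inverse_positive_iff_positive)
  moreover have "inverse B \<le> f t" for t
    using B[of t] assms(3)[of t] \<open>0 < B\<close> by (simp add: field_simps)
  ultimately show ?thesis using that[of "inverse B"] by auto
qed

section \<open>Families with uniform Lipschitz estimates at parameter 0\<close>

text \<open>Only parameters \<open>\<rho> \<in> {0..1}\<close> count.  Convergence as \<open>\<rho>\<close> tends to 0 is strengthened to
  the rate \<open>O(\<rho>)\<close>, so that all closure properties become plain norm estimates.\<close>

definition Lip_family :: "(real \<Rightarrow> real \<Rightarrow> 'a::real_normed_vector) \<Rightarrow> bool" where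
  "Lip_family f \<longleftrightarrow> (\<exists>B. \<forall>\<rho>\<in>{0..1}. \<forall>t. norm (f \<rho> t) \<le> B \<and> norm (f \<rho> t - f 0 t) \<le> B * \<rho>)"

text \<open>Recursion through an unspecified derivative \<open>f'\<close> instead of
  \<open>nth_vderiv\<close> turns the product, quotient and root rules into inductions on
  \<open>k\<close>. The Lipschitz estimate at every order is what later gives convergence of all
  derivatives.\<close>

primrec Ck_family :: "nat \<Rightarrow> (real \<Rightarrow> real \<Rightarrow> 'a::real_normed_vector) \<Rightarrow> bool" where
  "Ck_family 0 f \<longleftrightarrow> Lip_family f"
| "Ck_family (Suc k) f \<longleftrightarrow> Lip_family f \<and>
     (\<exists>f'. (\<forall>\<rho>\<in>{0..1}. \<forall>t. (f \<rho> has_vector_derivative f' \<rho> t) (at t)) \<and> Ck_family k f')"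

definition smooth_family :: "(real \<Rightarrow> real \<Rightarrow> 'a::real_normed_vector) \<Rightarrow> bool" where
  "smooth_family f \<longleftrightarrow> (\<forall>k. Ck_family k f)"

lemma Lip_familyE:
  assumes "Lip_family f"
  obtains B where "0 < B" "\<And>\<rho> t. \<rho> \<in> {0..1} \<Longrightarrow> norm (f \<rho> t) \<le> B"
    "\<And>\<rho> t. \<rho> \<in> {0..1} \<Longrightarrow> norm (f \<rho> t - f 0 t) \<le> B * \<rho>"
proof -
  obtain B where B: "\<And>\<rho> t. \<rho> \<in> {0..1} \<Longrightarrow> norm (f \<rho> t) \<le> B \<and> norm (f \<rho> t - f 0 t) \<le> B * \<rho>"
    using assms unfolding Lip_family_def by blast
  show ?thesis
  proof (rule that[of "\<bar>B\<bar> + 1"])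
    fix \<rho> t :: real assume r: "\<rho> \<in> {0..1}"
    then have "B * \<rho> \<le> (\<bar>B\<bar> + 1) * \<rho>" by (intro mult_right_mono) auto
    then show "norm (f \<rho> t - f 0 t) \<le> (\<bar>B\<bar> + 1) * \<rho>" using B[OF r, of t] by linarith
    show "norm (f \<rho> t) \<le> \<bar>B\<bar> + 1" using B[OF r, of t] by linarith
  qed auto
qed

lemma Lip_familyI:
  assumes "\<And>\<rho> t. \<rho> \<in> {0..1} \<Longrightarrow> norm (f \<rho> t) \<le> B"
    "\<And>\<rho> t. \<rho> \<in> {0..1} \<Longrightarrow> norm (f \<rho> t - f 0 t) \<le> B' * \<rho>"
  shows "Lip_family f"
  unfolding Lip_family_def
proof (intro exI ballI allI conjI)
  fix \<rho> t :: real assume r: "\<rho> \<in> {0..1}"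
  show "norm (f \<rho> t) \<le> max B B'" using assms(1)[OF r, of t] by linarith
  have "B' * \<rho> \<le> max B B' * \<rho>" using r by (intro mult_right_mono) auto
  then show "norm (f \<rho> t - f 0 t) \<le> max B B' * \<rho>" using assms(2)[OF r, of t] by linarith
qed

lemma Ck_family_SucI:
  assumes "Lip_family f" "\<forall>\<rho>\<in>{0..1}. \<forall>t. (f \<rho> has_vector_derivative f' \<rho> t) (at t)" "Ck_family k f'"
  shows "Ck_family (Suc k) f"
  using assms by auto

lemma Ck_family_imp_Lip: "Ck_family k f \<Longrightarrow> Lip_family f"
  by (cases k) auto

lemma Ck_family_SucD: "Ck_family (Suc k) f \<Longrightarrow> Ck_family k f"
  by (induction k arbitrary: f) auto

lemma Ck_family_cong:
  assumes "Ck_family k f" "\<And>\<rho> t. \<rho> \<in> {0..1} \<Longrightarrow> f \<rho> t = g \<rho> t"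
  shows "Ck_family k g"
proof -
  have L: "Lip_family g"
    using Ck_family_imp_Lip[OF assms(1)] assms(2) unfolding Lip_family_def by (metis atLeastAtMost_iff order_refl zero_le_one)
  have "f \<rho> = g \<rho>" if "\<rho> \<in> {0..1}" for \<rho> using assms(2) that by auto
  with L assms(1) show ?thesis by (cases k) auto
qed

lemma smooth_family_cong:
  assumes "smooth_family f" "\<And>\<rho> t. \<rho> \<in> {0..1} \<Longrightarrow> f \<rho> t = g \<rho> t"
  shows "smooth_family g"
  using assms Ck_family_cong unfolding smooth_family_def by blast

lemma smooth_family_imp_Lip: "smooth_family f \<Longrightarrow> Lip_family f"
  using Ck_family_imp_Lip unfolding smooth_family_def by blast

lemma smooth_family_has_vderiv:
  assumes "smooth_family f" "\<rho> \<in> {0..1}"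
  shows "(f \<rho> has_vector_derivative vector_derivative (f \<rho>) (at t)) (at t)"
proof -
  have "Ck_family (Suc 0) f" using assms(1) unfolding smooth_family_def by blast
  then show ?thesis using assms(2) vector_derivative_works differentiableI_vector by fastforce
qed

lemma smooth_family_continuous:
  assumes "smooth_family f" "\<rho> \<in> {0..1}"
  shows "continuous_on S (f \<rho>)"
  using smooth_family_has_vderiv[OF assms]
  by (meson continuous_at_imp_continuous_on has_vector_derivative_continuous)

lemma smooth_family_deriv:
  assumes "smooth_family f"
  shows "smooth_family (\<lambda>\<rho> t. vector_derivative (f \<rho>) (at t))"
  unfolding smooth_family_def
proof
  fix k
  have "Ck_family (Suc k) f" using assms unfolding smooth_family_def by blast
  then obtain f' where f': "\<forall>\<rho>\<in>{0..1}. \<forall>t. (f \<rho> has_vector_derivative f' \<rho> t) (at t)" "Ck_family k f'"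
    by auto
  show "Ck_family k (\<lambda>\<rho> t. vector_derivative (f \<rho>) (at t))"
  proof (rule Ck_family_cong[OF f'(2)])
    fix \<rho> t :: real assume "\<rho> \<in> {0..1}"
    then have "(f \<rho> has_vector_derivative f' \<rho> t) (at t)" using f'(1) by blast
    then show "f' \<rho> t = vector_derivative (f \<rho>) (at t)" by (rule vector_derivative_at[symmetric])
  qed
qed

text \<open>One argument serves multiplication, scaling and inner products: the difference is
  telescoped by changing one factor at a time.\<close>

lemma Lip_family_bilinear:
  assumes "bounded_bilinear pr" "Lip_family f" "Lip_family g"
  shows "Lip_family (\<lambda>\<rho> t. pr (f \<rho> t) (g \<rho> t))"
proof -
  interpret bounded_bilinear pr by fact
  obtain K where K: "0 < K" "\<And>x y. norm (pr x y) \<le> norm x * norm y * K" using pos_bounded by blast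
  obtain A where A: "0 < A" "\<And>\<rho> t. \<rho> \<in> {0..1} \<Longrightarrow> norm (f \<rho> t) \<le> A"
    "\<And>\<rho> t. \<rho> \<in> {0..1} \<Longrightarrow> norm (f \<rho> t - f 0 t) \<le> A * \<rho>"
    using assms(2) by (rule Lip_familyE) blast
  obtain B where B: "0 < B" "\<And>\<rho> t. \<rho> \<in> {0..1} \<Longrightarrow> norm (g \<rho> t) \<le> B"
    "\<And>\<rho> t. \<rho> \<in> {0..1} \<Longrightarrow> norm (g \<rho> t - g 0 t) \<le> B * \<rho>"
    using assms(3) by (rule Lip_familyE) blast
  show ?thesis
  proof (rule Lip_familyI)
    fix \<rho> t :: real assume r: "\<rho> \<in> {0..1}"
    have "norm (f \<rho> t) * norm (g \<rho> t) * K \<le> A * B * K"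
      using A(2)[OF r] B(2)[OF r] A(1) B(1) K(1) by (intro mult_mono) auto
    then show "norm (pr (f \<rho> t) (g \<rho> t)) \<le> A * B * K" using K(2) order_trans by blast
    have "pr (f \<rho> t) (g \<rho> t) - pr (f 0 t) (g 0 t)
        = pr (f \<rho> t - f 0 t) (g \<rho> t) + pr (f 0 t) (g \<rho> t - g 0 t)"
      by (simp add: diff_left diff_right)
    also have "norm \<dots> \<le> norm (f \<rho> t - f 0 t) * norm (g \<rho> t) * K + norm (f 0 t) * norm (g \<rho> t - g 0 t) * K"
      using K(2) norm_triangle_le add_mono by blast
    also have "\<dots> \<le> (A * \<rho>) * B * K + A * (B * \<rho>) * K"
      using A B[OF ] K(1) r by (intro add_mono mult_mono) auto
    finally show "norm (pr (f \<rho> t) (g \<rho> t) - pr (f 0 t) (g 0 t)) \<le> (2 * A * B * K) * \<rho>"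
      by (simp add: algebra_simps)
  qed
qed

lemma Lip_family_add:
  assumes "Lip_family f" "Lip_family g"
  shows "Lip_family (\<lambda>\<rho> t. f \<rho> t + g \<rho> t)"
proof -
  obtain A where A: "0 < A" "\<And>\<rho> t. \<rho> \<in> {0..1} \<Longrightarrow> norm (f \<rho> t) \<le> A"
    "\<And>\<rho> t. \<rho> \<in> {0..1} \<Longrightarrow> norm (f \<rho> t - f 0 t) \<le> A * \<rho>"
    using assms(1) by (rule Lip_familyE) blast
  obtain B where B: "0 < B" "\<And>\<rho> t. \<rho> \<in> {0..1} \<Longrightarrow> norm (g \<rho> t) \<le> B"
    "\<And>\<rho> t. \<rho> \<in> {0..1} \<Longrightarrow> norm (g \<rho> t - g 0 t) \<le> B * \<rho>"
    using assms(2) by (rule Lip_familyE) blast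
  show ?thesis
  proof (rule Lip_familyI)
    fix \<rho> t :: real assume r: "\<rho> \<in> {0..1}"
    show "norm (f \<rho> t + g \<rho> t) \<le> A + B" using A(2)[OF r] B(2)[OF r] by (intro norm_triangle_mono)
    show "norm (f \<rho> t + g \<rho> t - (f 0 t + g 0 t)) \<le> (A + B) * \<rho>"
      using norm_triangle_mono[OF A(3)[OF r, of t] B(3)[OF r, of t]] by (simp add: algebra_simps)
  qed
qed

lemma Ck_family_add:
  assumes "Ck_family k f" "Ck_family k g"
  shows "Ck_family k (\<lambda>\<rho> t. f \<rho> t + g \<rho> t)"
  using assms
proof (induction k arbitrary: f g)
  case 0
  then show ?case by (simp add: Lip_family_add)
next
  case (Suc k)
  then obtain f' g' where *: "\<forall>\<rho>\<in>{0..1}. \<forall>t. (f \<rho> has_vector_derivative f' \<rho> t) (at t)" "Ck_family k f'"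
    "\<forall>\<rho>\<in>{0..1}. \<forall>t. (g \<rho> has_vector_derivative g' \<rho> t) (at t)" "Ck_family k g'" by auto
  have "\<forall>\<rho>\<in>{0..1}. \<forall>t. ((\<lambda>t. f \<rho> t + g \<rho> t) has_vector_derivative f' \<rho> t + g' \<rho> t) (at t)"
    using * by (auto intro!: has_vector_derivative_add)
  moreover have "Ck_family k (\<lambda>\<rho> t. f' \<rho> t + g' \<rho> t)" using Suc.IH * by blast
  ultimately show ?case using Suc.prems by (intro Ck_family_SucI Lip_family_add) auto
qed

text \<open>Each term of the Leibniz rule keeps one factor undifferentiated. That factor is known to
  order \<open>Suc k\<close> and used only to order \<open>k\<close>, so the induction runs over
  arbitrary pairs of families.\<close>

lemma Ck_family_bilinear:
  assumes "bounded_bilinear pr" "Ck_family k f" "Ck_family k g"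
  shows "Ck_family k (\<lambda>\<rho> t. pr (f \<rho> t) (g \<rho> t))"
  using assms(2,3)
proof (induction k arbitrary: f g)
  case 0
  then show ?case using assms(1) by (simp add: Lip_family_bilinear)
next
  case (Suc k)
  then obtain f' g' where *: "\<forall>\<rho>\<in>{0..1}. \<forall>t. (f \<rho> has_vector_derivative f' \<rho> t) (at t)" "Ck_family k f'"
    "\<forall>\<rho>\<in>{0..1}. \<forall>t. (g \<rho> has_vector_derivative g' \<rho> t) (at t)" "Ck_family k g'" by auto
  have "\<forall>\<rho>\<in>{0..1}. \<forall>t. ((\<lambda>t. pr (f \<rho> t) (g \<rho> t)) has_vector_derivative
      pr (f \<rho> t) (g' \<rho> t) + pr (f' \<rho> t) (g \<rho> t)) (at t)"
    using * bounded_bilinear.has_vector_derivative[OF assms(1)] by blast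
  moreover have "Ck_family k (\<lambda>\<rho> t. pr (f \<rho> t) (g' \<rho> t) + pr (f' \<rho> t) (g \<rho> t))"
    using Ck_family_add[OF Suc.IH[OF Ck_family_SucD[OF Suc.prems(1)] *(4)]
        Suc.IH[OF *(2) Ck_family_SucD[OF Suc.prems(2)]]] .
  ultimately show ?case
    using Ck_family_imp_Lip[OF Suc.prems(1)] Ck_family_imp_Lip[OF Suc.prems(2)]
    by (intro Ck_family_SucI[OF Lip_family_bilinear[OF assms(1)]])
qed

lemma smooth_family_add:
  "smooth_family f \<Longrightarrow> smooth_family g \<Longrightarrow> smooth_family (\<lambda>\<rho> t. f \<rho> t + g \<rho> t)"
  unfolding smooth_family_def using Ck_family_add by blast

lemma smooth_family_mult:
  fixes f :: "real \<Rightarrow> real \<Rightarrow> real"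
  shows "smooth_family f \<Longrightarrow> smooth_family g \<Longrightarrow> smooth_family (\<lambda>\<rho> t. f \<rho> t * g \<rho> t)"
  unfolding smooth_family_def using Ck_family_bilinear[OF bounded_bilinear_mult] by blast

lemma smooth_family_scaleR:
  "smooth_family f \<Longrightarrow> smooth_family g \<Longrightarrow> smooth_family (\<lambda>\<rho> t. f \<rho> t *\<^sub>R g \<rho> t)"
  unfolding smooth_family_def using Ck_family_bilinear[OF bounded_bilinear_scaleR] by blast

lemma smooth_family_inner:
  fixes f :: "real \<Rightarrow> real \<Rightarrow> 'a::real_inner"
  shows "smooth_family f \<Longrightarrow> smooth_family g \<Longrightarrow> smooth_family (\<lambda>\<rho> t. f \<rho> t \<bullet> g \<rho> t)"
  unfolding smooth_family_def using Ck_family_bilinear[OF bounded_bilinear_inner] by blast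

text \<open>For data depending on \<rho> alone, such as the length or a base point, every
  t-derivative is 0, so the Lipschitz estimate is the whole condition.\<close>

lemma smooth_family_of_Lip:
  assumes "Lip_family (\<lambda>\<rho> t. c \<rho>)"
  shows "smooth_family (\<lambda>\<rho> t. c \<rho>)"
proof -
  have "Lip_family (\<lambda>\<rho> t. 0 :: 'a)" by (auto simp: Lip_family_def intro!: exI[of _ 0])
  then have z: "Ck_family k (\<lambda>\<rho> t. 0 :: 'a)" for k
    by (induction k) (auto intro!: exI[of _ "\<lambda>_ _. 0"])
  show ?thesis
    unfolding smooth_family_def
  proof
    fix k show "Ck_family k (\<lambda>\<rho> t. c \<rho>)"
      using assms z by (cases k) (auto intro!: exI[of _ "\<lambda>_ _. 0"])
  qed
qed

lemma smooth_family_const: "smooth_family (\<lambda>\<rho> t. c)"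
  by (rule smooth_family_of_Lip) (auto intro!: exI[of _ "norm c"] simp: Lip_family_def)

lemma smooth_family_param: "smooth_family (\<lambda>\<rho> t. \<rho>)"
  by (rule smooth_family_of_Lip) (auto intro!: exI[of _ 1] simp: Lip_family_def)

lemma smooth_family_diff:
  assumes "smooth_family f" "smooth_family g"
  shows "smooth_family (\<lambda>\<rho> t. f \<rho> t - g \<rho> t)"
proof -
  have "smooth_family (\<lambda>\<rho> t. f \<rho> t + (- 1) *\<^sub>R g \<rho> t)"
    using assms by (intro smooth_family_add smooth_family_scaleR smooth_family_const)
  then show ?thesis by simp
qed

lemma smooth_family_fixed:
  assumes "smooth_fun f" "periodic1 f"
  shows "smooth_family (\<lambda>\<rho>. f)"
proof -
  have L: "Lip_family (\<lambda>\<rho>. nth_vderiv j f)" for j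
  proof -
    obtain B where "\<And>t. norm (nth_vderiv j f t) \<le> B"
      using periodic1_bounded[OF periodic1_nth_vderiv smooth_fun_continuous[OF smooth_fun_nth_vderiv]] assms
      by blast
    then show ?thesis by (intro Lip_familyI[of _ B 0]) auto
  qed
  have "Ck_family k (\<lambda>\<rho>. nth_vderiv j f)" for k j
  proof (induction k arbitrary: j)
    case 0
    then show ?case using L by simp
  next
    case (Suc k)
    then show ?case using L smooth_fun_has_vderiv[OF assms(1)] by fastforce
  qed
  from this[of _ 0] show ?thesis unfolding smooth_family_def nth_vderiv_0 by blast
qed

lemma Lip_family_inverse:
  fixes f :: "real \<Rightarrow> real \<Rightarrow> real"
  assumes "Lip_family f" "0 < m" "\<And>\<rho> t. \<rho> \<in> {0..1} \<Longrightarrow> m \<le> f \<rho> t"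
  shows "Lip_family (\<lambda>\<rho> t. inverse (f \<rho> t))"
proof -
  obtain A where A: "0 < A" "\<And>\<rho> t. \<rho> \<in> {0..1} \<Longrightarrow> norm (f \<rho> t) \<le> A"
    "\<And>\<rho> t. \<rho> \<in> {0..1} \<Longrightarrow> norm (f \<rho> t - f 0 t) \<le> A * \<rho>"
    using assms(1) by (rule Lip_familyE) blast
  show ?thesis
  proof (rule Lip_familyI)
    fix \<rho> t :: real assume r: "\<rho> \<in> {0..1}"
    have m: "m \<le> f \<rho> t" "m \<le> f 0 t" using assms(3) r by auto
    show "norm (inverse (f \<rho> t)) \<le> inverse m"
      using m assms(2) by (simp add: le_imp_inverse_le)
    have "inverse (f \<rho> t) - inverse (f 0 t) = - (inverse (f \<rho> t) * (f \<rho> t - f 0 t) * inverse (f 0 t))"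
      using m assms(2) by (intro inverse_diff_inverse) auto
    also have "norm \<dots> = inverse (f \<rho> t) * norm (f \<rho> t - f 0 t) * inverse (f 0 t)"
      using m assms(2) by (simp add: abs_mult)
    also have "\<dots> \<le> inverse m * (A * \<rho>) * inverse m"
      using m assms(2) A(1) A(3)[OF r] r by (intro mult_mono le_imp_inverse_le) auto
    finally show "norm (inverse (f \<rho> t) - inverse (f 0 t)) \<le> (inverse m * A * inverse m) * \<rho>"
      by (simp add: algebra_simps)
  qed
qed

text \<open>The derivative - f' / f^2 contains the reciprocal itself, but only to order
  \<open>k\<close>, where the induction hypothesis provides it.\<close>

lemma Ck_family_inverse:
  fixes f :: "real \<Rightarrow> real \<Rightarrow> real"
  assumes "Ck_family k f" "0 < m" "\<And>\<rho> t. \<rho> \<in> {0..1} \<Longrightarrow> m \<le> f \<rho> t"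
  shows "Ck_family k (\<lambda>\<rho> t. inverse (f \<rho> t))"
  using assms(1)
proof (induction k)
  case 0
  then show ?case unfolding Ck_family.simps(1) by (rule Lip_family_inverse[OF _ assms(2,3)])
next
  case (Suc k)
  then obtain f' where *: "\<forall>\<rho>\<in>{0..1}. \<forall>t. (f \<rho> has_vector_derivative f' \<rho> t) (at t)" "Ck_family k f'"
    by auto
  define g where "g = (\<lambda>\<rho> t. (- 1) * ((inverse (f \<rho> t) * f' \<rho> t) * inverse (f \<rho> t)))"
  have "\<forall>\<rho>\<in>{0..1}. \<forall>t. ((\<lambda>t. inverse (f \<rho> t)) has_vector_derivative g \<rho> t) (at t)"
  proof (intro ballI allI)
    fix \<rho> t :: real assume "\<rho> \<in> {0..1}"
    then have "((f \<rho>) has_field_derivative f' \<rho> t) (at t)" "f \<rho> t \<noteq> 0"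
      using * assms(2) assms(3)[of \<rho> t] by (auto simp: has_real_derivative_iff_has_vector_derivative)
    from DERIV_inverse'[OF this]
    show "((\<lambda>t. inverse (f \<rho> t)) has_vector_derivative g \<rho> t) (at t)"
      by (simp add: has_real_derivative_iff_has_vector_derivative g_def)
  qed
  moreover have "Ck_family k (\<lambda>\<rho> t. inverse (f \<rho> t))" using Suc Ck_family_SucD by blast
  then have "Ck_family k g" unfolding g_def
    using *(2) smooth_family_const[unfolded smooth_family_def]
    by (intro Ck_family_bilinear[OF bounded_bilinear_mult]) auto
  ultimately show ?case 
    by (intro Ck_family_SucI[OF Lip_family_inverse[OF Ck_family_imp_Lip[OF Suc.prems] assms(2,3)]])
qed

text \<open>Multiplying by the sum of the two roots turns their difference into f \<rho> - f 0, and
  the sum is at least \<open>sqrt m\<close>.\<close>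

lemma Lip_family_sqrt:
  assumes "Lip_family f" "0 < m" "\<And>\<rho> t. \<rho> \<in> {0..1} \<Longrightarrow> m \<le> f \<rho> t"
  shows "Lip_family (\<lambda>\<rho> t. sqrt (f \<rho> t))"
proof -
  obtain A where A: "0 < A" "\<And>\<rho> t. \<rho> \<in> {0..1} \<Longrightarrow> norm (f \<rho> t) \<le> A"
    "\<And>\<rho> t. \<rho> \<in> {0..1} \<Longrightarrow> norm (f \<rho> t - f 0 t) \<le> A * \<rho>"
    using assms(1) by (rule Lip_familyE) blast
  show ?thesis
  proof (rule Lip_familyI)
    fix \<rho> t :: real assume r: "\<rho> \<in> {0..1}"
    have m: "m \<le> f \<rho> t" "m \<le> f 0 t" using assms(3) r by auto
    show "norm (sqrt (f \<rho> t)) \<le> sqrt A"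
      using m assms(2) A(2)[OF r, of t] by simp
    have s: "sqrt m \<le> sqrt (f \<rho> t)" "sqrt m \<le> sqrt (f 0 t)" "0 < sqrt m" using m assms(2) by auto
    have "sqrt m * \<bar>sqrt (f \<rho> t) - sqrt (f 0 t)\<bar>
        \<le> \<bar>sqrt (f \<rho> t) + sqrt (f 0 t)\<bar> * \<bar>sqrt (f \<rho> t) - sqrt (f 0 t)\<bar>"
      using s by (intro mult_right_mono) linarith+
    also have "\<dots> = \<bar>f \<rho> t - f 0 t\<bar>"
    proof -
      have "f \<rho> t - f 0 t = (sqrt (f \<rho> t) + sqrt (f 0 t)) * (sqrt (f \<rho> t) - sqrt (f 0 t))"
        using m assms(2) by (simp add: algebra_simps)
      then show ?thesis by (simp only: abs_mult)
    qed
    also have "\<dots> \<le> A * \<rho>" using A(3)[OF r, of t] by simp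
    finally show "norm (sqrt (f \<rho> t) - sqrt (f 0 t)) \<le> (A / sqrt m) * \<rho>"
      using s(3) by (simp add: field_simps)
  qed
qed

lemma Ck_family_sqrt:
  assumes "Ck_family k f" "0 < m" "\<And>\<rho> t. \<rho> \<in> {0..1} \<Longrightarrow> m \<le> f \<rho> t"
  shows "Ck_family k (\<lambda>\<rho> t. sqrt (f \<rho> t))"
  using assms(1)
proof (induction k)
  case 0
  then show ?case unfolding Ck_family.simps(1) by (rule Lip_family_sqrt[OF _ assms(2,3)])
next
  case (Suc k)
  then obtain f' where *: "\<forall>\<rho>\<in>{0..1}. \<forall>t. (f \<rho> has_vector_derivative f' \<rho> t) (at t)" "Ck_family k f'"
    by auto
  define g where "g = (\<lambda>\<rho> t. (1/2) * (inverse (sqrt (f \<rho> t)) * f' \<rho> t))"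
  have "\<forall>\<rho>\<in>{0..1}. \<forall>t. ((\<lambda>t. sqrt (f \<rho> t)) has_vector_derivative g \<rho> t) (at t)"
  proof (intro ballI allI)
    fix \<rho> t :: real assume "\<rho> \<in> {0..1}"
    then have d: "((f \<rho>) has_field_derivative f' \<rho> t) (at t)" and p: "f \<rho> t > 0"
      using * assms(2) assms(3)[of \<rho> t] by (auto simp: has_real_derivative_iff_has_vector_derivative)
    from DERIV_chain2[OF DERIV_real_sqrt[OF p] d]
    show "((\<lambda>t. sqrt (f \<rho> t)) has_vector_derivative g \<rho> t) (at t)"
      by (simp add: has_real_derivative_iff_has_vector_derivative g_def field_simps)
  qed
  moreover have "Ck_family k (\<lambda>\<rho> t. sqrt (f \<rho> t))" using Suc Ck_family_SucD by blast
  then have "Ck_family k (\<lambda>\<rho> t. inverse (sqrt (f \<rho> t)))"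
    using assms(2,3) by (intro Ck_family_inverse[where m = "sqrt m"]) auto
  then have "Ck_family k g" unfolding g_def
    using *(2) smooth_family_const[unfolded smooth_family_def]
    by (intro Ck_family_bilinear[OF bounded_bilinear_mult]) auto
  ultimately show ?case 
    by (intro Ck_family_SucI[OF Lip_family_sqrt[OF Ck_family_imp_Lip[OF Suc.prems] assms(2,3)]])
qed

lemma smooth_family_inverse:
  fixes f :: "real \<Rightarrow> real \<Rightarrow> real"
  assumes "smooth_family f" "0 < m" "\<And>\<rho> t. \<rho> \<in> {0..1} \<Longrightarrow> m \<le> f \<rho> t"
  shows "smooth_family (\<lambda>\<rho> t. inverse (f \<rho> t))"
  using assms Ck_family_inverse unfolding smooth_family_def by blast

lemma smooth_family_sqrt:
  assumes "smooth_family f" "0 < m" "\<And>\<rho> t. \<rho> \<in> {0..1} \<Longrightarrow> m \<le> f \<rho> t"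
  shows "smooth_family (\<lambda>\<rho> t. sqrt (f \<rho> t))"
  using assms Ck_family_sqrt unfolding smooth_family_def by blast

section \<open>Integration over one period, weak derivatives, uniform limits\<close>

lemma integral_vderiv_Icc:
  fixes F :: "real \<Rightarrow> 'a::euclidean_space"
  assumes "a \<le> b" "\<And>x. (F has_vector_derivative f x) (at x)" "continuous_on UNIV f"
  shows "(LINT t:{a..b}|lborel. f t) = F b - F a"
  unfolding set_lebesgue_integral_def
  using assms by (intro integral_FTC_atLeastAtMost)
    (auto intro: has_vector_derivative_at_within continuous_on_subset)

lemma set_integrable_Icc:
  fixes f :: "real \<Rightarrow> 'a::euclidean_space"
  assumes "continuous_on UNIV f"
  shows "set_integrable lborel {a..b} f"
  using assms by (intro borel_integrable_atLeastAtMost') (auto intro: continuous_on_subset)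

lemma LINT_const: "(LINT t:{0..1::real}|lborel. c) = (c::real)"
  by (simp add: set_lebesgue_integral_def)

lemma in_L2_continuous:
  assumes "continuous_on UNIV f"
  shows "in_L2 f"
  unfolding in_L2_def
proof
  show "set_borel_measurable lborel {0..1} f"
    using set_integrable_Icc[OF assms] unfolding set_integrable_def set_borel_measurable_def
    by (rule borel_measurable_integrable)
  show "set_integrable lborel {0..1} (\<lambda>t. (norm (f t))\<^sup>2)"
    using assms by (intro set_integrable_Icc continuous_intros)
qed

lemma weak_deriv_smooth:
  fixes f :: "real \<Rightarrow> real ^ 3"
  assumes "smooth_fun f" "periodic1 f"
  shows "weak_deriv f (nth_vderiv 1 f)"
  unfolding weak_deriv_def
proof (intro allI impI)
  fix \<phi> :: "real \<Rightarrow> real"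
  assume \<phi>: "smooth_fun \<phi> \<and> periodic1 \<phi>"
  let ?A = "\<lambda>t. \<phi> t *\<^sub>R nth_vderiv 1 f t" and ?B = "\<lambda>t. nth_vderiv 1 \<phi> t *\<^sub>R f t"
  have cont: "continuous_on UNIV \<phi>" "continuous_on UNIV (nth_vderiv 1 \<phi>)"
    "continuous_on UNIV f" "continuous_on UNIV (nth_vderiv 1 f)"
    using assms(1) \<phi> by (auto intro!: smooth_fun_continuous smooth_fun_nth_vderiv)
  have d: "((\<lambda>t. \<phi> t *\<^sub>R f t) has_vector_derivative ?A t + ?B t) (at t)" for t
    using smooth_fun_has_vderiv[of \<phi> 0 t] smooth_fun_has_vderiv[of f 0 t] assms \<phi>
    by (intro bounded_bilinear.has_vector_derivative[OF bounded_bilinear_scaleR])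
       (auto simp: nth_vderiv_0)
  have "(LINT t:{0..1}|lborel. ?A t + ?B t) = \<phi> 1 *\<^sub>R f 1 - \<phi> 0 *\<^sub>R f 0"
    using d cont by (intro integral_vderiv_Icc[where F = "\<lambda>t. \<phi> t *\<^sub>R f t"] continuous_intros) auto
  \<comment> \<open>The boundary terms cancel because both the curve and the test function are
    periodic.\<close>
  also have "\<dots> = 0"
    using assms(2) \<phi> unfolding periodic1_def by (metis add_0 right_minus_eq)
  finally have "(LINT t:{0..1}|lborel. ?A t) + (LINT t:{0..1}|lborel. ?B t) = 0"
    using cont by (subst (asm) set_integral_add) (auto intro!: set_integrable_Icc continuous_intros)
  then show "(LINT t:{0..1}|lborel. ?B t) = - (LINT t:{0..1}|lborel. ?A t)"
    by (simp add: eq_neg_iff_add_eq_0 add.commute)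
qed

lemma H2_curve_smooth:
  assumes "smooth_fun \<gamma>" "periodic1 \<gamma>"
  shows "H2_curve \<gamma>"
proof -
  have s: "smooth_fun (nth_vderiv 1 \<gamma>)" "periodic1 (nth_vderiv 1 \<gamma>)"
    using smooth_fun_nth_vderiv[OF assms(1)] periodic1_nth_vderiv[OF assms(2)] by auto
  have "in_L2 \<gamma>" "in_L2 (nth_vderiv 1 \<gamma>)" "in_L2 (nth_vderiv 1 (nth_vderiv 1 \<gamma>))"
    using assms(1) s(1) by (auto intro!: in_L2_continuous smooth_fun_continuous smooth_fun_nth_vderiv)
  moreover have "weak_deriv \<gamma> (nth_vderiv 1 \<gamma>)" "weak_deriv (nth_vderiv 1 \<gamma>) (nth_vderiv 1 (nth_vderiv 1 \<gamma>))"
    using assms s weak_deriv_smooth by auto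
  ultimately show ?thesis
    unfolding H2_curve_def using assms(2) smooth_fun_continuous[OF assms(1)] by blast
qed

lemma antiderivative_real:
  fixes f :: "real \<Rightarrow> 'a::euclidean_space"
  assumes "continuous_on UNIV f"
  obtains F where "\<And>t. (F has_vector_derivative f t) (at t)"
proof -
  have "\<exists>F. \<forall>x::real. -\<infinity> < ereal x \<longrightarrow> ereal x < \<infinity> \<longrightarrow> (F has_vector_derivative f x) (at x)"
    using assms by (intro einterval_antiderivative) (auto simp: continuous_on_eq_continuous_at)
  then show ?thesis using that by auto
qed

text \<open>Both integrals are F 1 - F 0 for an antiderivative F of \<open>f\<close>: on the right
  the integrand is the derivative of F composed with \<open>S\<close>.\<close>

lemma integral_substitution_unit:
  fixes f S S' :: "real \<Rightarrow> real"
  assumes "continuous_on UNIV f" "continuous_on UNIV S'" "\<And>t. (S has_vector_derivative S' t) (at t)"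
    and "S 0 = 0" "S 1 = 1"
  shows "(LINT t:{0..1}|lborel. f t) = (LINT t:{0..1}|lborel. S' t * f (S t))"
proof -
  obtain F where F: "\<And>t. (F has_vector_derivative f t) (at t)"
    using antiderivative_real[OF assms(1)] by blast
  have cS: "continuous_on UNIV S"
    using has_vector_derivative_continuous[OF assms(3)] by (simp add: continuous_at_imp_continuous_on)
  have d: "((\<lambda>t. F (S t)) has_vector_derivative S' t * f (S t)) (at t)" for t
    using vector_diff_chain_at[OF assms(3) F] by (simp add: comp_def)
  have "continuous_on UNIV (\<lambda>t. S' t * f (S t))"
    using assms(2) continuous_on_compose2[OF assms(1) cS] by (intro continuous_intros) auto
  from integral_vderiv_Icc[OF zero_le_one d this]
  show ?thesis using integral_vderiv_Icc[OF zero_le_one F assms(1)] assms(4,5) by simp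
qed

lemma family_uniform_limit:
  assumes "\<And>\<rho> t. \<rho> \<in> {0<..1} \<Longrightarrow> dist (f \<rho> t) (g t) \<le> B * \<rho>"
  shows "uniform_limit UNIV f g (at_right (0::real))"
proof (rule uniform_limitI)
  fix e :: real assume e: "0 < e"
  have "((\<lambda>\<rho>. B * \<rho>) \<longlongrightarrow> B * 0) (at_right (0::real))" by (intro tendsto_intros)
  then have "\<forall>\<^sub>F \<rho> in at_right (0::real). B * \<rho> < e" using e by (intro order_tendstoD(2)) auto
  moreover have "\<forall>\<^sub>F \<rho> in at_right (0::real). \<rho> \<in> {0<..1}"
    using eventually_at_right_less by (auto simp: eventually_at_right_field intro!: exI[of _ 1])
  ultimately show "\<forall>\<^sub>F \<rho> in at_right 0. \<forall>t\<in>UNIV. dist (f \<rho> t) (g t) < e"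
    by eventually_elim (use assms order_le_less_trans in blast)
qed

section \<open>Ambient isotopies\<close>

definition isotopy :: "(real \<Rightarrow> real^3 \<Rightarrow> real^3) \<Rightarrow> bool" where
  "isotopy H \<longleftrightarrow> continuous_on ({0..1} \<times> UNIV) (\<lambda>(s, x). H s x) \<and>
     (\<forall>s\<in>{0..1}. \<exists>g. homeomorphism UNIV UNIV (H s) g) \<and> (\<forall>x. H 0 x = x)"

lemma ambient_isotopic_iff: "ambient_isotopic A B \<longleftrightarrow> (\<exists>H. isotopy H \<and> H 1 ` A = B)"
  by (simp add: ambient_isotopic_def isotopy_def)

text \<open>Invariance of domain makes every continuous bijection of space a homeomorphism, so no
  continuous inverse has to be exhibited along the isotopy.\<close>

lemma ambient_isotopicI:
  fixes H :: "real \<Rightarrow> real^3 \<Rightarrow> real^3"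
  assumes "continuous_on ({0..1} \<times> UNIV) (\<lambda>(s, x). H s x)"
    and "\<And>s. s \<in> {0..1} \<Longrightarrow> inj (H s)" "\<And>s. s \<in> {0..1} \<Longrightarrow> surj (H s)"
    and "\<And>x. H 0 x = x" "H 1 ` A = B"
  shows "ambient_isotopic A B"
  unfolding ambient_isotopic_def
proof (intro exI[of _ H] conjI ballI)
  fix s :: real assume s: "s \<in> {0..1}"
  have "continuous_on UNIV (\<lambda>x. (\<lambda>(s, x). H s x) (s, x))"
    using s by (intro continuous_on_compose2[OF assms(1)] continuous_intros) auto
  then have c: "continuous_on UNIV (H s)" by simp
  obtain g where "homeomorphism UNIV (H s ` UNIV) (H s) g"
    by (rule invariance_of_domain_homeomorphism[OF open_UNIV c order_refl assms(2)[OF s]])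
  then show "\<exists>g. homeomorphism UNIV UNIV (H s) g" using assms(3)[OF s] by auto
qed (use assms in auto)

lemma ambient_isotopic_trans:
  assumes "ambient_isotopic A B" "ambient_isotopic B C"
  shows "ambient_isotopic A C"
proof -
  obtain H where "isotopy H" and H4: "H 1 ` A = B"
    using assms(1) unfolding ambient_isotopic_iff by blast
  then have H: "continuous_on ({0..1} \<times> UNIV) (\<lambda>(s, x). H s x)"
    "\<forall>s\<in>{0..1}. \<exists>g. homeomorphism UNIV UNIV (H s) g" "\<forall>x. H 0 x = x"
    by (simp_all add: isotopy_def)
  obtain G where "isotopy G" and G4: "G 1 ` B = C"
    using assms(2) unfolding ambient_isotopic_iff by blast
  then have G: "continuous_on ({0..1} \<times> UNIV) (\<lambda>(s, x). G s x)"
    "\<forall>s\<in>{0..1}. \<exists>g. homeomorphism UNIV UNIV (G s) g" "\<forall>x. G 0 x = x"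
    by (simp_all add: isotopy_def)
  define F where "F = (\<lambda>s x. if s \<le> 1/2 then H (2 * s) x else G (2 * s - 1) (H 1 x))"
  have H': "continuous_on S (\<lambda>z. H (f z) (g z))"
    if "continuous_on S f" "continuous_on S g" "f ` S \<subseteq> {0..1}"
    for S :: "(real \<times> (real^3)) set" and f g
    using continuous_on_compose2[OF H(1) continuous_on_Pair[OF that(1,2)]] that(3) by auto
  have G': "continuous_on S (\<lambda>z. G (f z) (g z))"
    if "continuous_on S f" "continuous_on S g" "f ` S \<subseteq> {0..1}"
    for S :: "(real \<times> (real^3)) set" and f g
    using continuous_on_compose2[OF G(1) continuous_on_Pair[OF that(1,2)]] that(3) by auto
  have un: "{0..1::real} \<times> UNIV = ({0..1/2} \<times> UNIV) \<union> ({1/2..1} \<times> (UNIV::(real^3) set))" by auto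
  have c1: "continuous_on ({0..1/2} \<times> UNIV) (\<lambda>z. H (2 * fst z) (snd z))"
    by (intro H' continuous_intros) auto
  have c2: "continuous_on ({1/2..1::real} \<times> UNIV) (\<lambda>z. H 1 (snd z))"
    by (intro H' continuous_intros) auto
  have c3: "continuous_on ({1/2..1} \<times> UNIV) (\<lambda>z. G (2 * fst z - 1) (H 1 (snd z)))"
    by (intro G' c2 continuous_intros) auto
  have "continuous_on ({0..1} \<times> UNIV) (\<lambda>z. if fst z \<le> 1/2 then H (2 * fst z) (snd z) else G (2 * fst z - 1) (H 1 (snd z)))"
    unfolding un
  proof (rule continuous_on_If[OF _ _ c1 c3])
    show "H (2 * fst z) (snd z) = G (2 * fst z - 1) (H 1 (snd z))"
      if "z \<in> {0..1/2} \<times> UNIV" "\<not> fst z \<le> 1/2" for z using that by auto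
    show "H (2 * fst z) (snd z) = G (2 * fst z - 1) (H 1 (snd z))"
      if "z \<in> {1/2..1} \<times> UNIV" "fst z \<le> 1/2" for z
    proof -
      \<comment> \<open>Both formulas apply at time 1/2, and they agree there because
        \<open>G\<close> starts at the identity.\<close>
      have "2 * fst z = 1" using that by auto
      then show ?thesis using G(3) by (simp only:) simp
    qed
  qed (auto intro!: closed_subset closed_Times)
  then have "continuous_on ({0..1} \<times> UNIV) (\<lambda>(s, x). F s x)"
    by (simp add: F_def case_prod_unfold)
  moreover have "\<exists>g. homeomorphism UNIV UNIV (F s) g" if "s \<in> {0..1}" for s
  proof (cases "s \<le> 1/2")
    case True
    then show ?thesis using that H(2) unfolding F_def by auto
  next
    case False
    have "2 * s - 1 \<in> {0..1}" using False that by auto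
    then obtain g where g: "homeomorphism UNIV UNIV (G (2 * s - 1)) g" using G(2) by blast
    have "(1::real) \<in> {0..1}" by simp
    then obtain h where h: "homeomorphism UNIV UNIV (H 1) h" using H(2) by blast
    from homeomorphism_compose[OF h g] show ?thesis using False unfolding F_def comp_def by auto
  qed
  moreover have "F 1 ` A = C" unfolding F_def using H4 G4 by auto
  moreover have "\<forall>x. F 0 x = x" unfolding F_def using H(3) by auto
  ultimately show ?thesis unfolding ambient_isotopic_iff isotopy_def by blast
qed

text \<open>Linear interpolation with the identity works because the factor 1 - s + s c stays
  positive; for negative \<open>c\<close> it would pass through 0.\<close>

lemma ambient_isotopic_scale_translate:
  fixes A :: "(real^3) set"
  assumes "0 < c"
  shows "ambient_isotopic A ((\<lambda>x. c *\<^sub>R x + b) ` A)"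
proof -
  define H where "H = (\<lambda>s x. (1 - s + s * c) *\<^sub>R x + s *\<^sub>R b)"
  have pos: "0 < 1 - s + s * c" if "s \<in> {0..1}" for s
  proof (cases "s = 1")
    case False
    then have "0 < 1 - s" "0 \<le> s * c" using that assms by auto
    then show ?thesis by linarith
  qed (use assms in auto)
  show ?thesis
  proof (rule ambient_isotopicI[of H])
    show "continuous_on ({0..1} \<times> UNIV) (\<lambda>(s, x). H s x)"
      unfolding H_def case_prod_unfold by (intro continuous_intros)
    show "inj (H s)" if "s \<in> {0..1}" for s
      using pos[OF that] unfolding H_def by (auto simp: inj_on_def)
    show "surj (H s)" if "s \<in> {0..1}" for s
      using pos[OF that] unfolding H_def surj_def
      by (intro allI exI[of _ "(1 / (1 - s + s * c)) *\<^sub>R (_ - s *\<^sub>R b)"]) simp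
  qed (auto simp: H_def)
qed

section \<open>Homeomorphisms of space that squeeze a braid towards the unit circle\<close>

definition rad :: "real^3 \<Rightarrow> real" where
  "rad x = sqrt ((x$1)\<^sup>2 + (x$2)\<^sup>2)"

lemma rad_nonneg: "0 \<le> rad x"
  by (simp add: rad_def)

lemma rad_scale:
  assumes "y$1 = c * x$1" "y$2 = c * x$2" "0 \<le> c"
  shows "rad y = c * rad x"
proof -
  have "(y$1)\<^sup>2 + (y$2)\<^sup>2 = c\<^sup>2 * ((x$1)\<^sup>2 + (x$2)\<^sup>2)" using assms by (simp add: algebra_simps)
  then show ?thesis using assms(3) by (simp add: rad_def real_sqrt_mult)
qed

text \<open>The radial profile is affine, \<open>r \<mapsto> s + \<mu> r\<close>, for \<open>r \<ge> m\<close>, where the braid lives, and linear for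
  \<open>r \<le> m\<close>, which makes the map a homeomorphism of all of space; \<open>s = 0\<close>, \<open>\<mu> = 1\<close> gives the identity.\<close>

definition squeeze :: "real \<Rightarrow> real \<Rightarrow> real \<Rightarrow> real^3 \<Rightarrow> real^3" where
  "squeeze m s \<mu> x =
     vector [(\<mu> + s / max (rad x) m) * x$1, (\<mu> + s / max (rad x) m) * x$2, \<mu> * x$3]"

lemma squeeze_nth:
  "squeeze m s \<mu> x $ 1 = (\<mu> + s / max (rad x) m) * x$1"
  "squeeze m s \<mu> x $ 2 = (\<mu> + s / max (rad x) m) * x$2"
  "squeeze m s \<mu> x $ 3 = \<mu> * x$3"
  by (simp_all add: squeeze_def vector_3)

text \<open>In the form \<mu> r + s min(1, r/m) the profile is a strictly increasing term plus a
  nondecreasing one.\<close>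

lemma squeeze_profile_less:
  fixes m s \<mu> :: real
  assumes "0 < m" "0 \<le> s" "0 < \<mu>" "0 \<le> a" "a < b"
  shows "(\<mu> + s / max a m) * a < (\<mu> + s / max b m) * b"
proof -
  have eq: "(\<mu> + s / max r m) * r = \<mu> * r + s * min 1 (r / m)" if "0 \<le> r" for r
    using assms(1) that by (auto simp: max_def min_def field_simps)
  have "min 1 (a / m) \<le> min 1 (b / m)"
    using assms(1,5) by (intro min.mono) (auto simp: divide_right_mono)
  then have "s * min 1 (a / m) \<le> s * min 1 (b / m)" using assms(2) by (rule mult_left_mono)
  moreover have "\<mu> * a < \<mu> * b" using assms by simp
  ultimately show ?thesis using eq[of a] eq[of b] assms by linarith
qed

text \<open>The radius of the image depends on the radius alone. Points with the same image thus
  have the same radius by monotonicity of the profile, and then the same positive scaling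
  factors.\<close>

lemma squeeze_inj:
  assumes "0 < m" "0 \<le> s" "0 < \<mu>"
  shows "inj (squeeze m s \<mu>)"
proof (rule injI)
  fix x y assume eq: "squeeze m s \<mu> x = squeeze m s \<mu> y"
  have pos: "0 < \<mu> + s / max (rad z) m" for z
    using assms by (intro add_pos_nonneg divide_nonneg_nonneg) auto
  have r: "rad (squeeze m s \<mu> z) = (\<mu> + s / max (rad z) m) * rad z" for z
    using pos[of z] by (intro rad_scale) (auto simp: squeeze_nth)
  have "rad x = rad y"
    using eq r[of x] r[of y] squeeze_profile_less[OF assms rad_nonneg, of x "rad y"]
      squeeze_profile_less[OF assms rad_nonneg, of y "rad x"] by (cases "rad x" "rad y" rule: linorder_cases) auto
  then show "x = y"
    using eq pos[of y] assms(3) squeeze_nth[of m s \<mu> x] squeeze_nth[of m s \<mu> y]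
    by (auto simp: vec_eq_iff forall_3)
qed

lemma squeeze_surj:
  assumes "0 < m" "0 \<le> s" "0 < \<mu>"
  shows "surj (squeeze m s \<mu>)"
  unfolding surj_def
proof
  fix y
  have pos: "0 < \<mu> + s / max r m" for r
    using assms by (intro add_pos_nonneg divide_nonneg_nonneg) auto
  \<comment> \<open>The search interval ends at rad y / \<mu>, where the linear term alone already
    reaches \<open>rad y\<close>.\<close>
  have "\<exists>r. 0 \<le> r \<and> r \<le> rad y / \<mu> \<and> (\<mu> + s / max r m) * r = rad y"
  proof (rule IVT')
    have "0 \<le> s / max (rad y / \<mu>) m * (rad y / \<mu>)"
      using assms rad_nonneg[of y] by (intro mult_nonneg_nonneg divide_nonneg_nonneg) auto
    then show "rad y \<le> (\<mu> + s / max (rad y / \<mu>) m) * (rad y / \<mu>)"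
      using assms(3) by (simp add: algebra_simps)
    show "continuous_on {0..rad y / \<mu>} (\<lambda>r. (\<mu> + s / max r m) * r)"
      using assms(1) by (intro continuous_intros) auto
  qed (use assms rad_nonneg[of y] in auto)
  then obtain r where r: "0 \<le> r" "(\<mu> + s / max r m) * r = rad y" by blast
  define G where "G = \<mu> + s / max r m"
  define x :: "real^3" where "x = vector [y$1 / G, y$2 / G, y$3 / \<mu>]"
  have G: "0 < G" using pos by (simp add: G_def)
  have "rad x = (1 / G) * rad y"
    using G by (intro rad_scale) (auto simp: x_def vector_3)
  then have "G * rad x = G * r" using r(2) G unfolding G_def[symmetric] by (simp add: field_simps)
  then have "rad x = r" using G by simp
  then have "y = squeeze m s \<mu> x"
    using G assms(3) by (simp add: vec_eq_iff forall_3 squeeze_nth G_def[symmetric]) (simp add: x_def vector_3)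
  then show "\<exists>x. y = squeeze m s \<mu> x" by blast
qed

text \<open>The path moves both parameters at once, s from 0 to 1 and \<mu> from 1 to \<rho>, and
  stays where s \<ge> 0 and \<mu> > 0, so that every stage is bijective.\<close>

lemma ambient_isotopic_squeeze:
  assumes "0 < m" "0 < \<rho>"
  shows "ambient_isotopic A (squeeze m 1 \<rho> ` A)"
proof (rule ambient_isotopicI[of "\<lambda>s. squeeze m s (1 - s + s * \<rho>)"])
  have pos: "0 < 1 - s + s * \<rho>" if "s \<in> {0..1}" for s
  proof (cases "s = 1")
    case False
    then have "0 < 1 - s" "0 \<le> s * \<rho>" using that assms by auto
    then show ?thesis by linarith
  qed (use assms in auto)
  have comp: "continuous_on ({0..1} \<times> UNIV) (\<lambda>z. squeeze m (fst z) (1 - fst z + fst z * \<rho>) (snd z) $ i)" for i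
    using exhaust_3[of i] assms(1)
    by (elim disjE; simp only: squeeze_nth rad_def; intro continuous_intros) auto
  have "continuous_on ({0..1} \<times> UNIV) (\<lambda>z. \<chi> i. squeeze m (fst z) (1 - fst z + fst z * \<rho>) (snd z) $ i)"
    by (intro continuous_on_vec_lambda comp)
  then show "continuous_on ({0..1} \<times> UNIV) (\<lambda>(s, x). squeeze m s (1 - s + s * \<rho>) x)"
    by (simp add: case_prod_unfold vec_nth_inverse)
  show "inj (squeeze m s (1 - s + s * \<rho>))" "surj (squeeze m s (1 - s + s * \<rho>))" if "s \<in> {0..1}" for s
    using squeeze_inj squeeze_surj assms(1) pos[OF that] that by auto
  show "squeeze m 0 (1 - 0 + 0 * \<rho>) x = x" for x
    by (simp add: vec_eq_iff forall_3 squeeze_nth)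
qed auto

text \<open>From radius \<open>m\<close> on the scaling factor is \<rho> + 1/r, so that radius r
  becomes exactly 1 + \<rho> r.\<close>

lemma squeeze_cylindrical:
  assumes "0 < m" "m \<le> r"
  shows "squeeze m 1 \<rho> (r *\<^sub>R e_r \<theta> + vector [0, 0, h])
    = (1 + \<rho> * r) *\<^sub>R e_r \<theta> + vector [0, 0, \<rho> * h]"
proof -
  have "rad (r *\<^sub>R e_r \<theta> + vector [0, 0, h]) = r * rad (e_r \<theta>)"
    using assms by (intro rad_scale) (auto simp: vector_3)
  then have "rad (r *\<^sub>R e_r \<theta> + vector [0, 0, h]) = r"
    by (simp add: rad_def e_r_def vector_3)
  then show ?thesis
    using assms by (simp add: vec_eq_iff forall_3 squeeze_nth) (simp add: e_r_def vector_3 field_simps max_absorb1)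
qed

section \<open>Braids closing up to a knot\<close>

lemma funpow_mult_fixed:
  assumes "(f ^^ N) x = x"
  shows "(f ^^ (N * k)) x = x"
  using assms by (induction k) (auto simp: funpow_add)

text \<open>Two iterates coincide by the pigeonhole principle; cancelling \<sigma>, which is
  injective on \<open>S\<close>, moves the coincidence back to \<open>i\<close> itself.\<close>

lemma permutation_orbit_returns:
  fixes \<sigma> :: "'a \<Rightarrow> 'a"
  assumes "finite S" "bij_betw \<sigma> S S" "i \<in> S"
  obtains N where "0 < N" "(\<sigma> ^^ N) i = i"
proof -
  have mem: "(\<sigma> ^^ k) i \<in> S" for k
    using assms(2,3) by (induction k) (auto simp: bij_betw_def)
  have "\<not> inj (\<lambda>k. (\<sigma> ^^ k) i)"
  proof
    assume "inj (\<lambda>k. (\<sigma> ^^ k) i)"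
    moreover have "finite (range (\<lambda>k. (\<sigma> ^^ k) i))"
      using mem by (intro finite_subset[OF _ assms(1)]) auto
    ultimately show False using finite_imageD infinite_UNIV_nat by blast
  qed
  then obtain a b where "a < b" "(\<sigma> ^^ a) i = (\<sigma> ^^ b) i"
    unfolding inj_def by (metis linorder_neqE_nat)
  moreover have "\<exists>N>0. (\<sigma> ^^ N) i = i" if "a < b" "(\<sigma> ^^ a) i = (\<sigma> ^^ b) i" for a b
    using that
  proof (induction a arbitrary: b)
    case 0
    then show ?case by auto
  next
    case (Suc a)
    then obtain c where c: "b = Suc c" "a < c" by (metis Suc_lessE)
    then have "\<sigma> ((\<sigma> ^^ a) i) = \<sigma> ((\<sigma> ^^ c) i)" using Suc.prems(2) by simp
    then have "(\<sigma> ^^ a) i = (\<sigma> ^^ c) i"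
      using assms(2) mem unfolding bij_betw_def inj_on_def by blast
    then show ?case using Suc.IH c(2) by blast
  qed
  ultimately show ?thesis using that by blast
qed

text \<open>The least period of 0 is the number of points in its orbit, and by transitivity the
  orbit is everything; counting identifies the period with n.\<close>

lemma transitive_permutation_is_cycle:
  fixes \<sigma> :: "nat \<Rightarrow> nat"
  assumes "bij_betw \<sigma> {..<n} {..<n}" "1 \<le> n" "\<And>i. i < n \<Longrightarrow> \<exists>k. i = (\<sigma> ^^ k) 0"
  shows "(\<sigma> ^^ n) 0 = 0" "\<And>k. 0 < k \<Longrightarrow> k < n \<Longrightarrow> (\<sigma> ^^ k) 0 \<noteq> 0"
proof -
  have mem: "(\<sigma> ^^ k) 0 < n" for k
    using assms(1,2) by (induction k) (auto simp: bij_betw_def)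
  obtain N where N: "0 < N" "(\<sigma> ^^ N) 0 = 0"
    using permutation_orbit_returns[OF _ assms(1), of 0] assms(2) by auto
  define p where "p = (LEAST p. 0 < p \<and> (\<sigma> ^^ p) 0 = 0)"
  have p: "0 < p" "(\<sigma> ^^ p) 0 = 0"
    using LeastI[of "\<lambda>p. 0 < p \<and> (\<sigma> ^^ p) 0 = 0" N] N unfolding p_def by auto
  have least: "(\<sigma> ^^ k) 0 \<noteq> 0" if "0 < k" "k < p" for k
    using not_less_Least[of k "\<lambda>p. 0 < p \<and> (\<sigma> ^^ p) 0 = 0"] that unfolding p_def by auto
  have "{..<n} = (\<lambda>k. (\<sigma> ^^ k) 0) ` {..<p}"
  proof (intro subset_antisym subsetI)
    fix i assume "i \<in> {..<n}"
    then obtain k where k: "i = (\<sigma> ^^ k) 0" using assms(3) by blast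
    have "(\<sigma> ^^ k) 0 = (\<sigma> ^^ (k mod p + p * (k div p))) 0" by simp
    also have "\<dots> = (\<sigma> ^^ (k mod p)) 0"
      unfolding funpow_add using funpow_mult_fixed[OF p(2)] by simp
    finally show "i \<in> (\<lambda>k. (\<sigma> ^^ k) 0) ` {..<p}" using k p(1) by auto
  qed (use mem in auto)
  moreover have "inj_on (\<lambda>k. (\<sigma> ^^ k) 0) {..<p}"
  proof -
    have "(\<sigma> ^^ a) 0 \<noteq> (\<sigma> ^^ b) 0" if "a < b" "b < p" for a b
    proof
      assume eq: "(\<sigma> ^^ a) 0 = (\<sigma> ^^ b) 0"
      \<comment> \<open>A coincidence at a < b would bring 0 back to itself after p - b + a < p
        steps.\<close>
      have "(\<sigma> ^^ (p - b + a)) 0 = (\<sigma> ^^ (p - b)) ((\<sigma> ^^ b) 0)" by (simp add: funpow_add eq)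
      moreover have "(\<sigma> ^^ (p - b + b)) 0 = 0" using that p(2) by simp
      ultimately have z: "(\<sigma> ^^ (p - b + a)) 0 = 0" by (simp only: funpow_add comp_apply)
      have "0 < p - b + a" "p - b + a < p" using that by arith+
      from least[OF this] z show False by contradiction
    qed
    then show ?thesis by (intro linorder_inj_onI) auto
  qed
  ultimately have "n = p" by (metis card_image card_lessThan)
  then show "(\<sigma> ^^ n) 0 = 0" "\<And>k. 0 < k \<Longrightarrow> k < n \<Longrightarrow> (\<sigma> ^^ k) 0 \<noteq> 0"
    using p(2) least by simp_all
qed

section \<open>Cylindrical coordinates and connected closed braids\<close>

definition cyl :: "real \<Rightarrow> real \<Rightarrow> real \<Rightarrow> real ^ 3" where
  "cyl r \<theta> h = r *\<^sub>R e_r \<theta> + vector [0, 0, h]"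

lemma cyl_nth: "cyl r \<theta> h $ 1 = r * cos \<theta>" "cyl r \<theta> h $ 2 = r * sin \<theta>" "cyl r \<theta> h $ 3 = h"
  by (simp_all add: cyl_def e_r_def vector_3)

lemma e_r_add_2pi: "e_r (\<theta> + 2 * pi * real k) = e_r \<theta>"
  using sin_cos_eq_iff[of "\<theta> + 2 * pi * real k" \<theta>] unfolding e_r_def by (metis of_int_of_nat_eq)

lemma cyl_eqD:
  assumes "cyl r \<theta> h = cyl r' \<theta>' h'" "0 < r" "0 < r'"
  shows "r = r'" "h = h'" "\<exists>k::int. \<theta> = \<theta>' + 2 * pi * of_int k"
proof -
  have e: "r * cos \<theta> = r' * cos \<theta>'" "r * sin \<theta> = r' * sin \<theta>'"
    using cyl_nth[of r \<theta> h] cyl_nth[of r' \<theta>' h'] assms(1) by auto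
  have "r\<^sup>2 = (r * cos \<theta>)\<^sup>2 + (r * sin \<theta>)\<^sup>2" for r \<theta> :: real
    by (simp add: power_mult_distrib flip: distrib_left)
  then have "r\<^sup>2 = r'\<^sup>2" using e by metis
  then show r: "r = r'" using assms(2,3) by (simp add: power2_eq_iff)
  show "h = h'" using cyl_nth(3)[of r \<theta> h] cyl_nth(3)[of r' \<theta>' h'] assms(1) by simp
  show "\<exists>k::int. \<theta> = \<theta>' + 2 * pi * of_int k"
    using e r assms(2) sin_cos_eq_iff[of \<theta> \<theta>'] by auto
qed

lemma continuous_on_cyl:
  assumes "continuous_on S r" "continuous_on S h"
  shows "continuous_on S (\<lambda>\<theta>. cyl (r \<theta>) (c * \<theta>) (h \<theta>))"
proof -
  have "continuous_on S (\<lambda>\<theta>. cyl (r \<theta>) (c * \<theta>) (h \<theta>) $ i)" for i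
    using exhaust_3[of i] assms
    by (elim disjE; simp only: cyl_nth; intro continuous_intros) auto
  then have "continuous_on S (\<lambda>\<theta>. \<chi> i. cyl (r \<theta>) (c * \<theta>) (h \<theta>) $ i)"
    by (intro continuous_on_vec_lambda)
  then show ?thesis by (simp add: vec_nth_inverse)
qed

text \<open>The strands in the orbit of strand 0 and the remaining ones form two disjoint closed
  sets covering \<open>L\<close>, so connectedness leaves no remaining strand and \<sigma> is a
  cycle of length n. Strand 0 followed through n turns is then all of \<open>L\<close>, and its
  values k turns apart belong to two different strands.\<close>

lemma connected_braid_single_strand:
  assumes "closed_braid n L" "connected L"
  obtains r h where "1 \<le> n" "smooth_fun r" "smooth_fun h" "\<And>\<theta>. 0 < r \<theta>"
    "\<And>\<theta>. r (\<theta> + 2 * pi * real n) = r \<theta>" "\<And>\<theta>. h (\<theta> + 2 * pi * real n) = h \<theta>"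
    "\<And>\<theta> k. 0 < k \<Longrightarrow> k < n \<Longrightarrow> (r (\<theta> + 2 * pi * real k), h (\<theta> + 2 * pi * real k)) \<noteq> (r \<theta>, h \<theta>)"
    "L = range (\<lambda>\<theta>. cyl (r \<theta>) \<theta> (h \<theta>))"
proof -
  obtain r h \<sigma> where n: "1 \<le> n" and bij: "bij_betw \<sigma> {..<n} {..<n}"
    and rh: "\<forall>i<n. smooth_fun (r i) \<and> smooth_fun (h i) \<and>
           (\<forall>\<theta>. 0 < r i \<theta> \<and> r i (\<theta> + 2 * pi) = r (\<sigma> i) \<theta> \<and> h i (\<theta> + 2 * pi) = h (\<sigma> i) \<theta>)"
    and disj: "\<forall>\<theta>. \<forall>i<n. \<forall>j<n. i \<noteq> j \<longrightarrow> (r i \<theta>, h i \<theta>) \<noteq> (r j \<theta>, h j \<theta>)"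
    and L: "L = (\<Union>i<n. range (\<lambda>\<theta>. r i \<theta> *\<^sub>R e_r \<theta> + vector [0, 0, h i \<theta>]))"
    using assms(1) unfolding closed_braid_def by (elim conjE exE) (rule that; assumption)
  define st where "st = (\<lambda>i \<theta>. cyl (r i \<theta>) \<theta> (h i \<theta>))"
  have mem: "(\<sigma> ^^ k) i < n" if "i < n" for i k
    using bij that by (induction k) (auto simp: bij_betw_def)
  have shift_both: "r i (\<theta> + 2 * pi * real k) = r ((\<sigma> ^^ k) i) \<theta> \<and>
      h i (\<theta> + 2 * pi * real k) = h ((\<sigma> ^^ k) i) \<theta>" if "i < n" for i \<theta> k
  proof (induction k arbitrary: \<theta>)
    case (Suc k)
    have eq: "\<theta> + 2 * pi * real (Suc k) = (\<theta> + 2 * pi) + 2 * pi * real k" by (simp add: algebra_simps)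
    show ?case
      unfolding eq using Suc.IH[of "\<theta> + 2 * pi"] rh mem[OF that, of k] by simp
  qed simp
  then have shift: "r i (\<theta> + 2 * pi * real k) = r ((\<sigma> ^^ k) i) \<theta>"
    "h i (\<theta> + 2 * pi * real k) = h ((\<sigma> ^^ k) i) \<theta>" if "i < n" for i \<theta> k
    using that by simp_all
  have st_shift: "st i (\<theta> + 2 * pi * real k) = st ((\<sigma> ^^ k) i) \<theta>" if "i < n" for i \<theta> k
    unfolding st_def shift[OF that] by (simp add: cyl_def e_r_add_2pi)
  \<comment> \<open>The order of the angles makes the number of turns between them a natural number,
    as iterates of \<sigma> require; \<open>sym\<close> takes care of the opposite order.\<close>
  have meet: "\<exists>k. j = (\<sigma> ^^ k) i" if ij: "i < n" "j < n" and eq: "st i \<theta> = st j \<phi>" and "\<phi> \<le> \<theta>" for i j \<theta> \<phi>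
  proof -
    have e: "r i \<theta> = r j \<phi>" "h i \<theta> = h j \<phi>" and ex: "\<exists>k::int. \<theta> = \<phi> + 2 * pi * of_int k"
      using cyl_eqD[OF eq[unfolded st_def]] rh ij by auto
    obtain k :: int where k: "\<theta> = \<phi> + 2 * pi * of_int k" using ex by blast
    have "0 \<le> 2 * pi * of_int k" using k \<open>\<phi> \<le> \<theta>\<close> by linarith
    then have "0 \<le> k" using pi_gt_zero by (simp add: zero_le_mult_iff)
    then have "\<theta> = \<phi> + 2 * pi * real (nat k)" using k by simp
    then have "(r ((\<sigma> ^^ nat k) i) \<phi>, h ((\<sigma> ^^ nat k) i) \<phi>) = (r j \<phi>, h j \<phi>)"
      using e shift[OF ij(1)] by simp
    then show ?thesis using disj mem[OF ij(1)] ij(2) by metis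
  qed
  have sym: "\<exists>m. i = (\<sigma> ^^ m) j" if i: "i < n" "j = (\<sigma> ^^ k) i" for i j k
  proof -
    obtain N where N: "0 < N" "(\<sigma> ^^ N) i = i"
      using permutation_orbit_returns[OF _ bij, of i] i by auto
    \<comment> \<open>As N \<ge> 1, another N k - k steps complete the k steps to a multiple of the
      return time.\<close>
    have "i = (\<sigma> ^^ (N * k - k + k)) i" using N funpow_mult_fixed[OF N(2), of k] by simp
    then show ?thesis using i(2) by (metis funpow_add comp_apply)
  qed
  have cmp: "compact (range (st i))" if i: "i < n" for i
  proof -
    obtain N where N: "0 < N" "(\<sigma> ^^ N) i = i"
      using permutation_orbit_returns[OF _ bij, of i] i by auto
    \<comment> \<open>After N turns the strand closes up, so in this scaling it is periodic and its
      range is the image of a compact interval.\<close>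
    let ?f = "\<lambda>t. st i (2 * pi * real N * t)"
    have "periodic1 ?f"
      using st_shift[OF i, of "2 * pi * real N * _" N] N(2) by (simp add: periodic1_def distrib_left)
    then have "range ?f = ?f ` {0..1}" using periodic1_range[of ?f] by auto
    moreover have "range ?f = range (st i)"
    proof -
      have "st i \<theta> \<in> range ?f" for \<theta>
        by (rule image_eqI[of _ _ "\<theta> / (2 * pi * real N)"]) (use N(1) in simp_all)
      then show ?thesis by auto
    qed
    moreover have "continuous_on UNIV (\<lambda>\<theta>. cyl (r i \<theta>) (1 * \<theta>) (h i \<theta>))"
      using rh i by (intro continuous_on_cyl smooth_fun_continuous) auto
    then have "continuous_on {0..1} ?f"
      unfolding st_def by (auto intro!: continuous_on_compose2[where f = "\<lambda>t. 2 * pi * real N * t"] continuous_intros)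
    then have "compact (?f ` {0..1})" by (intro compact_continuous_image) auto
    ultimately show ?thesis by simp
  qed
  define J where "J = {i. i < n \<and> \<not> (\<exists>k. i = (\<sigma> ^^ k) 0)}"
  have L': "L = (\<Union>i<n. range (st i))" unfolding L st_def cyl_def ..
  have same: "range (st ((\<sigma> ^^ k) 0)) \<subseteq> range (st 0)" for k
    using st_shift[of 0 _ k] n by (metis image_subsetI less_le_trans rangeI zero_less_one)
  have LJ: "L = range (st 0) \<union> (\<Union>i\<in>J. range (st i))"
    unfolding L'
  proof (intro subset_antisym subsetI)
    fix x assume "x \<in> (\<Union>i<n. range (st i))"
    then obtain i where i: "i < n" "x \<in> range (st i)" by auto
    then show "x \<in> range (st 0) \<union> (\<Union>i\<in>J. range (st i))"
      using same unfolding J_def by (cases "\<exists>k. i = (\<sigma> ^^ k) 0") auto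
  qed (use n in \<open>auto simp: J_def\<close>)
  have disjoint: "range (st 0) \<inter> (\<Union>i\<in>J. range (st i)) = {}"
  proof (rule ccontr)
    assume "range (st 0) \<inter> (\<Union>i\<in>J. range (st i)) \<noteq> {}"
    then obtain i \<theta> \<phi> where i: "i < n" "\<not> (\<exists>k. i = (\<sigma> ^^ k) 0)" and eq: "st 0 \<theta> = st i \<phi>"
      unfolding J_def by auto
    have 0: "0 < n" using n by simp
    show False
    proof (cases "\<phi> \<le> \<theta>")
      case True
      then show False using meet[OF 0 i(1) eq] i(2) by blast
    next
      case False
      then obtain k where "0 = (\<sigma> ^^ k) i" using meet[OF i(1) 0 eq[symmetric]] by auto
      then show False using sym[OF i(1)] i(2) by blast
    qed
  qed
  have closed: "closed (range (st 0))" "closed (\<Union>i\<in>J. range (st i))"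
    using cmp n by (auto intro!: compact_imp_closed closed_UN simp: J_def)
  have "range (st 0) \<inter> L = {} \<or> (\<Union>i\<in>J. range (st i)) \<inter> L = {}"
    using disjoint LJ by (intro connected_closedD[OF assms(2) _ _ closed]) simp_all
  then have "(\<Union>i\<in>J. range (st i)) = {}" unfolding LJ by auto
  then have "J = {}" by auto
  then have trans: "\<exists>k. i = (\<sigma> ^^ k) 0" if "i < n" for i using that unfolding J_def by blast
  have cyc: "(\<sigma> ^^ k) 0 \<noteq> 0" if "0 < k" "k < n" for k
    by (rule transitive_permutation_is_cycle(2)[OF bij n _ that]) (rule trans)
  have cyc0: "(\<sigma> ^^ n) 0 = 0"
    by (rule transitive_permutation_is_cycle(1)[OF bij n]) (rule trans)
  show ?thesis
  proof (rule that[of "r 0" "h 0"])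
    have 0: "0 < n" using n by simp
    show "r 0 (\<theta> + 2 * pi * real n) = r 0 \<theta>" "h 0 (\<theta> + 2 * pi * real n) = h 0 \<theta>" for \<theta>
      using shift[OF 0] cyc0 by simp_all
    show "(r 0 (\<theta> + 2 * pi * real k), h 0 (\<theta> + 2 * pi * real k)) \<noteq> (r 0 \<theta>, h 0 \<theta>)"
      if "0 < k" "k < n" for \<theta> k
      unfolding shift[OF 0] using disj mem[OF 0] 0 cyc[OF that] by blast
    show "L = range (\<lambda>\<theta>. cyl (r 0 \<theta>) \<theta> (h 0 \<theta>))"
      using LJ \<open>J = {}\<close> unfolding st_def by simp
  qed (use rh n in auto)
qed

lemma connected_ambient_isotopic:
  assumes "ambient_isotopic A B" "connected A"
  shows "connected B"
proof -
  obtain H where H: "isotopy H" "H 1 ` A = B" using assms(1) unfolding ambient_isotopic_iff by blast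
  have "(1::real) \<in> {0..1}" by simp
  then obtain g where "homeomorphism UNIV UNIV (H 1) g" using H(1) unfolding isotopy_def by blast
  then have "continuous_on A (H 1)" using continuous_on_subset unfolding homeomorphism_def by blast
  then show ?thesis using H(2) assms(2) connected_continuous_image by blast
qed

text \<open>A knot is a path image, and the final map of an isotopy is continuous. This is what
  rules out braids closing up to several components.\<close>

lemma tame_knot_class_connected:
  assumes "tame_knot_class K" "L \<in> K"
  shows "connected L"
proof -
  obtain A where A: "knot A" "ambient_isotopic A L"
    using assms unfolding tame_knot_class_def tame_knot_def by blast
  then obtain g where "path g" "path_image g = A" unfolding knot_def simple_path_def by blast
  then have "connected A" using connected_path_image by blast
  then show ?thesis using A(2) connected_ambient_isotopic by blast
qed

section \<open>First-order expansions and elementary estimates\<close>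

text \<open>A Taylor expansion in \<rho>, uniform in t and stated through its remainder, so that
  nothing is differentiated in \<rho>. The coefficient bounds are included because products and
  quotients need them.\<close>

definition expand1 :: "(real \<Rightarrow> real \<Rightarrow> real) \<Rightarrow> (real \<Rightarrow> real) \<Rightarrow> (real \<Rightarrow> real) \<Rightarrow> bool" where
  "expand1 f f0 f1 \<longleftrightarrow> (\<exists>B>0. \<forall>\<rho>\<in>{0..1}. \<forall>t.
     \<bar>f0 t\<bar> \<le> B \<and> \<bar>f1 t\<bar> \<le> B \<and> \<bar>f \<rho> t - f0 t - \<rho> * f1 t\<bar> \<le> B * \<rho>\<^sup>2)"

lemma expand1E:
  assumes "expand1 f f0 f1"
  obtains B where "0 < B" "\<And>t. \<bar>f0 t\<bar> \<le> B" "\<And>t. \<bar>f1 t\<bar> \<le> B"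
    "\<And>\<rho> t. \<rho> \<in> {0..1} \<Longrightarrow> \<bar>f \<rho> t - f0 t - \<rho> * f1 t\<bar> \<le> B * \<rho>\<^sup>2"
proof -
  obtain B where B: "0 < B" "\<And>\<rho> t. \<rho> \<in> {0..1} \<Longrightarrow>
     \<bar>f0 t\<bar> \<le> B \<and> \<bar>f1 t\<bar> \<le> B \<and> \<bar>f \<rho> t - f0 t - \<rho> * f1 t\<bar> \<le> B * \<rho>\<^sup>2"
    using assms unfolding expand1_def by blast
  have "(0::real) \<in> {0..1}" by simp
  then show ?thesis using that[OF B(1)] B(2) by meson
qed

lemma expand1I:
  assumes "\<And>t. \<bar>f0 t\<bar> \<le> A" "\<And>t. \<bar>f1 t\<bar> \<le> B"
    "\<And>\<rho> t. \<rho> \<in> {0..1} \<Longrightarrow> \<bar>f \<rho> t - f0 t - \<rho> * f1 t\<bar> \<le> C * \<rho>\<^sup>2"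
  shows "expand1 f f0 f1"
  unfolding expand1_def
proof (intro exI[of _ "max 1 (max A (max B C))"] conjI ballI allI)
  fix \<rho> t :: real assume r: "\<rho> \<in> {0..1}"
  show "\<bar>f0 t\<bar> \<le> max 1 (max A (max B C))" using assms(1)[of t] by linarith
  show "\<bar>f1 t\<bar> \<le> max 1 (max A (max B C))" using assms(2)[of t] by linarith
  have "C * \<rho>\<^sup>2 \<le> max 1 (max A (max B C)) * \<rho>\<^sup>2" by (intro mult_right_mono) auto
  then show "\<bar>f \<rho> t - f0 t - \<rho> * f1 t\<bar> \<le> max 1 (max A (max B C)) * \<rho>\<^sup>2"
    using assms(3)[OF r, of t] by linarith
qed simp

lemma expand1_at_0:
  assumes "expand1 f f0 f1"
  shows "f 0 t = f0 t"
proof -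
  obtain B where "\<And>\<rho> t. \<rho> \<in> {0..1} \<Longrightarrow> \<bar>f \<rho> t - f0 t - \<rho> * f1 t\<bar> \<le> B * \<rho>\<^sup>2"
    using assms by (rule expand1E) blast
  from this[of 0 t] show ?thesis by simp
qed

lemma expand1_cong:
  assumes "expand1 f f0 f1" "\<And>\<rho> t. f \<rho> t = g \<rho> t" "\<And>t. f0 t = g0 t" "\<And>t. f1 t = g1 t"
  shows "expand1 g g0 g1"
  using assms by (simp add: expand1_def)

lemma expand1_imp_Lip:
  assumes "expand1 f f0 f1"
  shows "Lip_family f"
proof -
  obtain B where B: "0 < B" "\<And>t. \<bar>f0 t\<bar> \<le> B" "\<And>t. \<bar>f1 t\<bar> \<le> B"
    "\<And>\<rho> t. \<rho> \<in> {0..1} \<Longrightarrow> \<bar>f \<rho> t - f0 t - \<rho> * f1 t\<bar> \<le> B * \<rho>\<^sup>2"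
    using assms by (rule expand1E) blast
  show ?thesis
  proof (rule Lip_familyI)
    fix \<rho> t :: real assume r: "\<rho> \<in> {0..1}"
    then have "B * \<rho>\<^sup>2 \<le> B * \<rho>" "\<rho> * B \<le> B" "\<bar>\<rho> * f1 t\<bar> \<le> \<rho> * B"
      using B(1) B(3)[of t] by (auto simp: power2_eq_square mult_left_le abs_mult mult_left_mono mult_left_le_one_le)
    then show "norm (f \<rho> t) \<le> 3 * B" "norm (f \<rho> t - f 0 t) \<le> (2 * B) * \<rho>"
      using B(4)[OF r, of t] B(2)[of t] expand1_at_0[OF assms, of t] by (auto simp: algebra_simps)
  qed
qed

text \<open>Inner products of the first two derivatives of the squeezed braid are exact quadratic
  polynomials in \<rho>; all expansions start from these.\<close>

lemma expand1_quadratic: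
  assumes "\<And>\<rho> t. \<rho> \<in> {0..1} \<Longrightarrow> f \<rho> t = u t + \<rho> * v t + \<rho>\<^sup>2 * w t"
    and "\<And>t. \<bar>u t\<bar> \<le> A" "\<And>t. \<bar>v t\<bar> \<le> B" "\<And>t. \<bar>w t\<bar> \<le> C"
  shows "expand1 f u v"
proof (rule expand1I[OF assms(2,3)])
  fix \<rho> t :: real assume "\<rho> \<in> {0..1}"
  then have "f \<rho> t - u t - \<rho> * v t = \<rho>\<^sup>2 * w t" using assms(1) by simp
  moreover have "\<rho>\<^sup>2 * \<bar>w t\<bar> \<le> \<rho>\<^sup>2 * C" using assms(4) by (intro mult_left_mono) auto
  ultimately show "\<bar>f \<rho> t - u t - \<rho> * v t\<bar> \<le> C * \<rho>\<^sup>2" by (simp add: abs_mult mult.commute)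
qed

lemma expand1_mult:
  assumes "expand1 f f0 f1" "expand1 g g0 g1"
  shows "expand1 (\<lambda>\<rho> t. f \<rho> t * g \<rho> t) (\<lambda>t. f0 t * g0 t) (\<lambda>t. f0 t * g1 t + f1 t * g0 t)"
proof -
  obtain A where A: "0 < A" "\<And>t. \<bar>f0 t\<bar> \<le> A" "\<And>t. \<bar>f1 t\<bar> \<le> A"
    "\<And>\<rho> t. \<rho> \<in> {0..1} \<Longrightarrow> \<bar>f \<rho> t - f0 t - \<rho> * f1 t\<bar> \<le> A * \<rho>\<^sup>2"
    using assms(1) by (rule expand1E) blast
  obtain B where B: "0 < B" "\<And>t. \<bar>g0 t\<bar> \<le> B" "\<And>t. \<bar>g1 t\<bar> \<le> B"
    "\<And>\<rho> t. \<rho> \<in> {0..1} \<Longrightarrow> \<bar>g \<rho> t - g0 t - \<rho> * g1 t\<bar> \<le> B * \<rho>\<^sup>2"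
    using assms(2) by (rule expand1E) blast
  have m: "\<bar>x * y\<bar> \<le> X * Y" if "\<bar>x\<bar> \<le> X" "\<bar>y\<bar> \<le> Y" for x y X Y :: real
    unfolding abs_mult using that by (intro mult_mono) auto
  show ?thesis
  proof (rule expand1I)
    show "\<bar>f0 t * g0 t\<bar> \<le> A * B" for t using m A B by blast
    show "\<bar>f0 t * g1 t + f1 t * g0 t\<bar> \<le> A * B + A * B" for t
      using m[OF A(2) B(3), of t t] m[OF A(3) B(2), of t t] by linarith
    fix \<rho> t :: real assume r: "\<rho> \<in> {0..1}"
    have r1: "\<rho>\<^sup>2 \<le> 1" "\<bar>\<rho>\<bar> \<le> 1" "\<bar>\<rho>\<^sup>2\<bar> \<le> \<rho>\<^sup>2" using r by (auto simp: power_le_one)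
    have "B * \<rho>\<^sup>2 \<le> B" using B(1) r1 by simp
    moreover have "\<bar>\<rho> * g1 t\<bar> \<le> 1 * B" using m[OF r1(2) B(3)] .
    ultimately have g: "\<bar>g \<rho> t\<bar> \<le> 3 * B" using B(2)[of t] B(4)[OF r, of t] by linarith
    have "\<bar>\<rho> * f1 t\<bar> \<le> 1 * A" using m[OF r1(2) A(3)] .
    then have f: "\<bar>f0 t + \<rho> * f1 t\<bar> \<le> 2 * A" using A(2)[of t] by linarith
    \<comment> \<open>Splitting off one remainder at a time leaves \<rho>^2 f1 g1 as the only
      product of first-order terms.\<close>
    have "f \<rho> t * g \<rho> t - f0 t * g0 t - \<rho> * (f0 t * g1 t + f1 t * g0 t)
        = (f \<rho> t - f0 t - \<rho> * f1 t) * g \<rho> t + (f0 t + \<rho> * f1 t) * (g \<rho> t - g0 t - \<rho> * g1 t)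
          + \<rho>\<^sup>2 * (f1 t * g1 t)"
      by (simp add: algebra_simps power2_eq_square)
    moreover have "\<bar>(f \<rho> t - f0 t - \<rho> * f1 t) * g \<rho> t\<bar> \<le> (A * \<rho>\<^sup>2) * (3 * B)"
      using m[OF A(4)[OF r] g] .
    moreover have "\<bar>(f0 t + \<rho> * f1 t) * (g \<rho> t - g0 t - \<rho> * g1 t)\<bar> \<le> (2 * A) * (B * \<rho>\<^sup>2)"
      using m[OF f B(4)[OF r]] .
    moreover have "\<bar>\<rho>\<^sup>2 * (f1 t * g1 t)\<bar> \<le> \<rho>\<^sup>2 * (A * B)"
      using m[OF r1(3) m[OF A(3) B(3)]] .
    ultimately have "\<bar>f \<rho> t * g \<rho> t - f0 t * g0 t - \<rho> * (f0 t * g1 t + f1 t * g0 t)\<bar>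
        \<le> (A * \<rho>\<^sup>2) * (3 * B) + (2 * A) * (B * \<rho>\<^sup>2) + \<rho>\<^sup>2 * (A * B)" by linarith
    also have "\<dots> = (6 * A * B) * \<rho>\<^sup>2" by (simp add: algebra_simps)
    finally show "\<bar>f \<rho> t * g \<rho> t - f0 t * g0 t - \<rho> * (f0 t * g1 t + f1 t * g0 t)\<bar> \<le> (6 * A * B) * \<rho>\<^sup>2" .
  qed
qed

lemma expand1_diff:
  assumes "expand1 f f0 f1" "expand1 g g0 g1"
  shows "expand1 (\<lambda>\<rho> t. f \<rho> t - g \<rho> t) (\<lambda>t. f0 t - g0 t) (\<lambda>t. f1 t - g1 t)"
proof -
  obtain A where A: "0 < A" "\<And>t. \<bar>f0 t\<bar> \<le> A" "\<And>t. \<bar>f1 t\<bar> \<le> A"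
    "\<And>\<rho> t. \<rho> \<in> {0..1} \<Longrightarrow> \<bar>f \<rho> t - f0 t - \<rho> * f1 t\<bar> \<le> A * \<rho>\<^sup>2"
    using assms(1) by (rule expand1E) blast
  obtain B where B: "0 < B" "\<And>t. \<bar>g0 t\<bar> \<le> B" "\<And>t. \<bar>g1 t\<bar> \<le> B"
    "\<And>\<rho> t. \<rho> \<in> {0..1} \<Longrightarrow> \<bar>g \<rho> t - g0 t - \<rho> * g1 t\<bar> \<le> B * \<rho>\<^sup>2"
    using assms(2) by (rule expand1E) blast
  show ?thesis
  proof (rule expand1I)
    show "\<bar>f0 t - g0 t\<bar> \<le> A + B" for t using A(2)[of t] B(2)[of t] by linarith
    show "\<bar>f1 t - g1 t\<bar> \<le> A + B" for t using A(3)[of t] B(3)[of t] by linarith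
    show "\<bar>f \<rho> t - g \<rho> t - (f0 t - g0 t) - \<rho> * (f1 t - g1 t)\<bar> \<le> (A + B) * \<rho>\<^sup>2"
      if r: "\<rho> \<in> {0..1}" for \<rho> t
      using A(4)[OF r, of t] B(4)[OF r, of t] unfolding distrib_right right_diff_distrib by linarith
  qed
qed

lemma expand1_inverse:
  assumes "expand1 f f0 f1" "0 < m" "\<And>\<rho> t. \<rho> \<in> {0..1} \<Longrightarrow> m \<le> f \<rho> t"
  shows "expand1 (\<lambda>\<rho> t. inverse (f \<rho> t)) (\<lambda>t. inverse (f0 t)) (\<lambda>t. - f1 t / (f0 t)\<^sup>2)"
proof -
  obtain A where A: "0 < A" "\<And>t. \<bar>f0 t\<bar> \<le> A" "\<And>t. \<bar>f1 t\<bar> \<le> A"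
    "\<And>\<rho> t. \<rho> \<in> {0..1} \<Longrightarrow> \<bar>f \<rho> t - f0 t - \<rho> * f1 t\<bar> \<le> A * \<rho>\<^sup>2"
    using assms(1) by (rule expand1E) blast
  have f0: "m \<le> f0 t" for t using assms(3)[of 0 t] expand1_at_0[OF assms(1), of t] by simp
  have m: "\<bar>x * y\<bar> \<le> X * Y" if "\<bar>x\<bar> \<le> X" "\<bar>y\<bar> \<le> Y" for x y X Y :: real
    unfolding abs_mult using that by (intro mult_mono) auto
  show ?thesis
  proof (rule expand1I)
    show "\<bar>inverse (f0 t)\<bar> \<le> inverse m" for t
      using f0[of t] assms(2) by (simp add: le_imp_inverse_le)
    show "\<bar>- f1 t / (f0 t)\<^sup>2\<bar> \<le> A / m\<^sup>2" for t
    proof -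
      have "m\<^sup>2 \<le> (f0 t)\<^sup>2" using f0[of t] assms(2) by (intro power_mono) auto
      then show ?thesis using A(3)[of t] A(1) assms(2) unfolding abs_divide by (intro frac_le) auto
    qed
    fix \<rho> t :: real assume r: "\<rho> \<in> {0..1}"
    define e where "e = f \<rho> t - f0 t - \<rho> * f1 t"
    have pos: "0 < f \<rho> t" "0 < f0 t" using assms(2) assms(3)[OF r, of t] f0[of t] by linarith+
    have e: "\<bar>e\<bar> \<le> A * \<rho>\<^sup>2" using A(4)[OF r] unfolding e_def .
    have r1: "0 \<le> \<rho>" "\<rho> \<le> 1" "\<rho>\<^sup>2 \<le> 1" "\<bar>\<rho>\<bar> \<le> 1" using r by (auto simp: power_le_one)
    \<comment> \<open>Inserting f = f0 + \<rho> f1 + e over the common denominator cancels the terms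
      of order 0 and 1; the rest is quadratic because e is.\<close>
    have eq: "inverse (f \<rho> t) - inverse (f0 t) - \<rho> * (- f1 t / (f0 t)\<^sup>2)
        = (\<rho>\<^sup>2 * (f1 t * f1 t) + (\<rho> * f1 t) * e - f0 t * e) / (f \<rho> t * (f0 t)\<^sup>2)"
      using pos unfolding e_def by (simp add: field_simps power2_eq_square)
    have "\<bar>\<rho>\<^sup>2 * (f1 t * f1 t)\<bar> \<le> \<rho>\<^sup>2 * (A * A)" by (rule m[OF _ m[OF A(3) A(3)]]) simp
    moreover have "\<bar>\<rho> * f1 t\<bar> \<le> 1 * A" using m[OF r1(4) A(3)] .
    then have "\<bar>(\<rho> * f1 t) * e\<bar> \<le> A * (A * \<rho>\<^sup>2)" using m[OF _ e, of "\<rho> * f1 t" A] by simp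
    moreover have "\<bar>f0 t * e\<bar> \<le> A * (A * \<rho>\<^sup>2)" using m[OF A(2) e] .
    ultimately have num: "\<bar>\<rho>\<^sup>2 * (f1 t * f1 t) + (\<rho> * f1 t) * e - f0 t * e\<bar> \<le> 3 * A\<^sup>2 * \<rho>\<^sup>2"
      by (simp add: power2_eq_square algebra_simps)
    have den: "m * m\<^sup>2 \<le> f \<rho> t * (f0 t)\<^sup>2"
      using assms(2) assms(3)[OF r, of t] f0[of t] by (intro mult_mono power_mono) auto
    have "\<bar>inverse (f \<rho> t) - inverse (f0 t) - \<rho> * (- f1 t / (f0 t)\<^sup>2)\<bar> \<le> (3 * A\<^sup>2 * \<rho>\<^sup>2) / (m * m\<^sup>2)"
      unfolding eq abs_divide using num den assms(2) pos by (intro frac_le) auto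
    then show "\<bar>inverse (f \<rho> t) - inverse (f0 t) - \<rho> * (- f1 t / (f0 t)\<^sup>2)\<bar> \<le> (3 * A\<^sup>2 / (m * m\<^sup>2)) * \<rho>\<^sup>2"
      by simp
  qed
qed

text \<open>By s^2 - s0^2 = 2 s0 (s - s0) + (s - s0)^2 the error of the linear approximation
  consists of e and the square of s - s0. Hence s - s0 = O(\<rho>) is proved first.\<close>

lemma expand1_sqrt:
  assumes "expand1 f f0 f1" "0 < m" "\<And>\<rho> t. \<rho> \<in> {0..1} \<Longrightarrow> m \<le> f \<rho> t"
  shows "expand1 (\<lambda>\<rho> t. sqrt (f \<rho> t)) (\<lambda>t. sqrt (f0 t)) (\<lambda>t. f1 t / (2 * sqrt (f0 t)))"
proof -
  obtain A where A: "0 < A" "\<And>t. \<bar>f0 t\<bar> \<le> A" "\<And>t. \<bar>f1 t\<bar> \<le> A"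
    "\<And>\<rho> t. \<rho> \<in> {0..1} \<Longrightarrow> \<bar>f \<rho> t - f0 t - \<rho> * f1 t\<bar> \<le> A * \<rho>\<^sup>2"
    using assms(1) by (rule expand1E) blast
  have f0: "m \<le> f0 t" for t using assms(3)[of 0 t] expand1_at_0[OF assms(1), of t] by simp
  show ?thesis
  proof (rule expand1I)
    show "\<bar>sqrt (f0 t)\<bar> \<le> sqrt A" for t
      using f0[of t] A(2)[of t] assms(2) by simp
    show "\<bar>f1 t / (2 * sqrt (f0 t))\<bar> \<le> A / (2 * sqrt m)" for t
      unfolding abs_divide using A(1) A(3)[of t] f0[of t] assms(2) by (intro frac_le) auto
    fix \<rho> t :: real assume r: "\<rho> \<in> {0..1}"
    define e where "e = f \<rho> t - f0 t - \<rho> * f1 t"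
    define s where "s = sqrt (f \<rho> t)"
    define s0 where "s0 = sqrt (f0 t)"
    have r1: "0 \<le> \<rho>" "\<rho> \<le> 1" "\<rho>\<^sup>2 \<le> \<rho>" using r by (auto simp: power2_eq_square mult_left_le)
    have pos: "0 < f \<rho> t" "0 < f0 t" using assms(2) assms(3)[OF r, of t] f0[of t] by linarith+
    have s: "sqrt m \<le> s" "sqrt m \<le> s0" "0 < sqrt m" "s\<^sup>2 = f \<rho> t" "s0\<^sup>2 = f0 t"
      unfolding s_def s0_def using assms(2) assms(3)[OF r, of t] f0[of t] pos by auto
    have e: "\<bar>e\<bar> \<le> A * \<rho>\<^sup>2" using A(4)[OF r] unfolding e_def .
    have "\<bar>\<rho> * f1 t\<bar> \<le> \<rho> * A" unfolding abs_mult using r1 A(3) by (intro mult_mono) auto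
    moreover have "A * \<rho>\<^sup>2 \<le> A * \<rho>" using r1 A(1) by simp
    ultimately have d: "\<bar>f \<rho> t - f0 t\<bar> \<le> 2 * A * \<rho>"
      using e unfolding e_def by (simp add: algebra_simps)
    have "(s - s0) * (s + s0) = f \<rho> t - f0 t" unfolding s(4,5)[symmetric] by (simp add: power2_eq_square algebra_simps)
    then have "\<bar>s - s0\<bar> * (s + s0) \<le> 2 * A * \<rho>" using d s by (metis abs_mult abs_of_nonneg add_nonneg_nonneg less_imp_le order_trans)
    moreover have "\<bar>s - s0\<bar> * sqrt m \<le> \<bar>s - s0\<bar> * (s + s0)" using s by (intro mult_left_mono) linarith+
    ultimately have "\<bar>s - s0\<bar> \<le> 2 * A * \<rho> / sqrt m" using s(3) by (simp add: pos_le_divide_eq)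
    then have "\<bar>s - s0\<bar>\<^sup>2 \<le> (2 * A * \<rho> / sqrt m)\<^sup>2" by (intro power_mono) auto
    then have sq: "(s - s0)\<^sup>2 \<le> (4 * A\<^sup>2 / m) * \<rho>\<^sup>2"
      using assms(2) by (simp add: power_mult_distrib power_divide)
    have "s - s0 - \<rho> * (f1 t / (2 * s0)) = (e - (s - s0)\<^sup>2) / (2 * s0)"
    proof -
      have "0 < s0" using s by linarith
      then show ?thesis unfolding e_def s(4,5)[symmetric] by (simp add: field_simps power2_eq_square)
    qed
    moreover have "\<bar>e - (s - s0)\<^sup>2\<bar> \<le> A * \<rho>\<^sup>2 + (4 * A\<^sup>2 / m) * \<rho>\<^sup>2"
      using e sq zero_le_power2[of "s - s0"] by linarith
    moreover have "2 * sqrt m \<le> \<bar>2 * s0\<bar>" "0 < 2 * sqrt m" using s by auto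
    ultimately have "\<bar>s - s0 - \<rho> * (f1 t / (2 * s0))\<bar> \<le> (A * \<rho>\<^sup>2 + (4 * A\<^sup>2 / m) * \<rho>\<^sup>2) / (2 * sqrt m)"
      by (simp only: abs_divide) (intro frac_le; linarith)
    then show "\<bar>sqrt (f \<rho> t) - sqrt (f0 t) - \<rho> * (f1 t / (2 * sqrt (f0 t)))\<bar>
        \<le> ((A + 4 * A\<^sup>2 / m) / (2 * sqrt m)) * \<rho>\<^sup>2"
      unfolding s_def s0_def by (simp add: algebra_simps)
  qed
qed

text \<open>The integrals are treated as functions constant in t, so that length and bending energy
  can be multiplied with \<open>expand1_mult\<close>.\<close>

lemma expand1_integral:
  assumes "expand1 f f0 f1" "\<And>\<rho>. \<rho> \<in> {0..1} \<Longrightarrow> continuous_on UNIV (f \<rho>)"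
    "continuous_on UNIV f0" "continuous_on UNIV f1"
  shows "expand1 (\<lambda>\<rho> _. LINT t:{0..1}|lborel. f \<rho> t)
    (\<lambda>_. LINT t:{0..1}|lborel. f0 t) (\<lambda>_. LINT t:{0..1}|lborel. f1 t)"
proof -
  obtain A where A: "0 < A" "\<And>\<rho> t. \<rho> \<in> {0..1} \<Longrightarrow> \<bar>f \<rho> t - f0 t - \<rho> * f1 t\<bar> \<le> A * \<rho>\<^sup>2"
    using assms(1) by (rule expand1E) blast
  show ?thesis
  proof (rule expand1I[OF order_refl order_refl])
    fix \<rho> :: real assume r: "\<rho> \<in> {0..1}"
    let ?g = "\<lambda>t. f \<rho> t - f0 t - \<rho> * f1 t"
    have cg: "continuous_on UNIV ?g" using assms r by (intro continuous_intros) auto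
    have "(LINT t:{0..1}|lborel. ?g t) = (LINT t:{0..1}|lborel. f \<rho> t)
        - (LINT t:{0..1}|lborel. f0 t) - \<rho> * (LINT t:{0..1}|lborel. f1 t)"
      using assms r by (simp add: set_integrable_Icc set_integral_diff set_integral_mult_right set_integrable_mult_right)
    moreover have "\<bar>LINT t:{0..1}|lborel. ?g t\<bar> \<le> (LINT t:{0..1}|lborel. \<bar>?g t\<bar>)"
      using set_integral_norm_bound[OF set_integrable_Icc[OF cg]] by simp
    moreover have "(LINT t:{0..1}|lborel. \<bar>?g t\<bar>) \<le> (LINT t:{0..1::real}|lborel. A * \<rho>\<^sup>2)"
      using A(2)[OF r] set_integrable_Icc[OF continuous_on_rabs[OF cg]]
      by (intro set_integral_mono set_integrable_Icc[OF continuous_on_const]) auto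
    moreover have "(LINT t:{0..1::real}|lborel. A * \<rho>\<^sup>2) = A * \<rho>\<^sup>2"
      by (simp add: set_lebesgue_integral_def)
    ultimately show "\<bar>(LINT t:{0..1}|lborel. f \<rho> t) - (LINT t:{0..1}|lborel. f0 t)
        - \<rho> * (LINT t:{0..1}|lborel. f1 t)\<bar> \<le> A * \<rho>\<^sup>2" by linarith
  qed
qed

section \<open>Elementary inequalities and Taylor estimates\<close>

lemma dist_int_ge_min:
  fixes \<delta> :: real and i :: int
  assumes "\<bar>\<delta>\<bar> \<le> 1"
  shows "min \<bar>\<delta>\<bar> (1 - \<bar>\<delta>\<bar>) \<le> \<bar>\<delta> - of_int i\<bar>"
proof -
  consider "i = 0" | "1 \<le> i" | "i \<le> -1" by linarith
  then show ?thesis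
  proof cases
    case 2
    then have "(1::real) \<le> of_int i" by simp
    then show ?thesis by linarith
  next
    case 3
    then have "of_int i \<le> (-1::real)" by simp
    then show ?thesis by linarith
  qed simp
qed

text \<open>Trades the minimum for a bound linear in \<rho>, the form needed for the
  thickness.\<close>

lemma le_min_scale:
  fixes \<rho> c d x :: real
  assumes "c * min \<rho> d \<le> x" "0 \<le> \<rho>" "\<rho> \<le> 1" "0 \<le> d" "0 \<le> c"
  shows "c * min 1 d * \<rho> \<le> x"
proof -
  have "min 1 d * \<rho> \<le> min \<rho> d"
  proof (rule min.boundedI)
    show "min 1 d * \<rho> \<le> \<rho>" using assms(2,4) by (intro mult_left_le_one_le) auto
    have "min 1 d * \<rho> \<le> d * 1" using assms(2-4) by (intro mult_mono) auto
    then show "min 1 d * \<rho> \<le> d" by simp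
  qed
  then have "c * (min 1 d * \<rho>) \<le> c * min \<rho> d" using assms(5) by (rule mult_left_mono)
  then show ?thesis using assms(1) by (simp add: mult.assoc)
qed

text \<open>1 - cos \<alpha> is twice the square of sin(\<alpha>/2), and |sin x| \<ge> |x|/3 for |x|
  \<le> 2, since there the Taylor error |x|^3/6 is at most 2|x|/3. With x = \<alpha>/2 this gives
  the constant 18.\<close>

lemma one_minus_cos_ge:
  fixes \<alpha> :: real
  assumes "\<bar>\<alpha>\<bar> \<le> pi"
  shows "\<alpha>\<^sup>2 / 18 \<le> 1 - cos \<alpha>"
proof -
  define x where "x = \<alpha> / 2"
  have "\<bar>sin x - (\<Sum>m<3. sin_coeff m * x ^ m)\<bar> \<le> inverse (fact 3) * \<bar>x\<bar> ^ 3"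
    by (rule Maclaurin_sin_bound)
  then have "\<bar>sin x - x\<bar> \<le> \<bar>x\<bar> ^ 3 / 6"
    by (simp add: numeral_3_eq_3 sin_coeff_def fact_numeral)
  moreover have "\<bar>x\<bar> ^ 3 \<le> \<bar>x\<bar> * 4"
  proof -
    have "\<bar>x\<bar> \<le> 2" using assms pi_less_4 unfolding x_def by simp
    then have "\<bar>x\<bar>\<^sup>2 \<le> 2\<^sup>2" by (intro power_mono) auto
    then show ?thesis using mult_left_mono[of "\<bar>x\<bar>\<^sup>2" 4 "\<bar>x\<bar>"] by (simp add: power3_eq_cube power2_eq_square)
  qed
  ultimately have "\<bar>x\<bar> / 3 \<le> \<bar>sin x\<bar>" by linarith
  then have "(\<bar>x\<bar> / 3)\<^sup>2 \<le> \<bar>sin x\<bar>\<^sup>2" by (intro power_mono) auto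
  moreover have "1 - cos \<alpha> = 2 * (sin x)\<^sup>2" using cos_double_sin[of x] unfolding x_def by simp
  ultimately show ?thesis unfolding x_def by (simp add: power_divide)
qed

lemma vderiv_bound:
  fixes f :: "real \<Rightarrow> 'a::real_normed_vector"
  assumes "\<And>x. (f has_vector_derivative f' x) (at x)"
    and "\<And>x. x \<in> closed_segment s t \<Longrightarrow> norm (f' x) \<le> B"
  shows "norm (f t - f s) \<le> B * \<bar>t - s\<bar>"
proof -
  have "norm (f t - f s) \<le> B * norm (t - s)"
  proof (rule differentiable_bound[of "closed_segment s t" f "\<lambda>x h. h *\<^sub>R f' x"])
    show "(f has_derivative (\<lambda>h. h *\<^sub>R f' x)) (at x within closed_segment s t)" for x
      using assms(1) has_derivative_at_withinI unfolding has_vector_derivative_def by blast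
    show "onorm (\<lambda>h. h *\<^sub>R f' x) \<le> B" if "x \<in> closed_segment s t" for x
      using assms(2)[OF that] by (simp add: onorm_scaleR_left onorm_id)
  qed auto
  then show ?thesis by simp
qed

text \<open>The mean value inequality is applied to \<open>v1\<close> and then to \<open>v\<close>
  minus its linear part; the factor 1/2 of Taylor's formula is given up.\<close>

lemma taylor2_bound:
  fixes v :: "real \<Rightarrow> 'a::real_normed_vector"
  assumes "\<And>x. (v has_vector_derivative v1 x) (at x)" "\<And>x. (v1 has_vector_derivative v2 x) (at x)"
    and "\<And>x. norm (v2 x) \<le> K"
  shows "norm (v t - v s - (t - s) *\<^sub>R v1 s) \<le> K * (t - s)\<^sup>2"
proof -
  have K: "0 \<le> K" using assms(3)[of 0] norm_ge_zero order_trans by blast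
  have d: "((\<lambda>x. v x - x *\<^sub>R v1 s) has_vector_derivative v1 x - v1 s) (at x)" for x
    using assms(1) by (auto intro!: derivative_eq_intros)
  have *: "norm (v1 x - v1 s) \<le> K * \<bar>t - s\<bar>" if "x \<in> closed_segment s t" for x
  proof -
    have "norm (v1 x - v1 s) \<le> K * \<bar>x - s\<bar>" using vderiv_bound[OF assms(2,3)] .
    also have "\<dots> \<le> K * \<bar>t - s\<bar>"
      using that K by (intro mult_left_mono) (auto simp: closed_segment_eq_real_ivl split: if_splits)
    finally show ?thesis .
  qed
  have "norm ((v t - t *\<^sub>R v1 s) - (v s - s *\<^sub>R v1 s)) \<le> (K * \<bar>t - s\<bar>) * \<bar>t - s\<bar>"
    by (rule vderiv_bound[OF d]) (rule *)
  moreover have "(K * \<bar>t - s\<bar>) * \<bar>t - s\<bar> = K * (t - s)\<^sup>2"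
    by (simp add: power2_eq_square mult.assoc flip: abs_mult)
  ultimately show ?thesis by (simp add: algebra_simps)
qed

section \<open>Arc length, thickness and ropelength of periodic curves\<close>

text \<open>\<open>S\<close> is the antiderivative of \<open>g\<close> vanishing at 0. Slope at
  least \<open>m\<close> makes it a bijection of the line; total mass 1 and periodicity of
  \<open>g\<close> make S (t + 1) - S t constantly 1.\<close>

lemma periodic_unit_reparametrization:
  fixes g :: "real \<Rightarrow> real"
  assumes "continuous_on UNIV g" "0 < m" "\<And>t. m \<le> g t" "periodic1 g"
    and "(LINT t:{0..1}|lborel. g t) = 1"
  obtains S T where "\<And>t. (S has_vector_derivative g t) (at t)" "S 0 = 0" "S 1 = 1"
    "\<And>t. S (t + 1) = S t + 1" "\<And>t. S (T t) = t" "\<And>t. T (S t) = t"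
    "\<And>t. (T has_vector_derivative inverse (g (T t))) (at t)"
proof -
  obtain F where F: "\<And>t. (F has_vector_derivative g t) (at t)"
    using antiderivative_real[OF assms(1)] by blast
  define S where "S = (\<lambda>t. F t - F 0)"
  have S: "(S has_real_derivative g t) (at t)" for t
    using F[of t] unfolding S_def has_real_derivative_iff_has_vector_derivative[symmetric]
    by (auto intro!: derivative_eq_intros)
  have S0: "S 0 = 0" by (simp add: S_def)
  have S1: "S 1 = 1" using integral_vderiv_Icc[OF zero_le_one F assms(1)] assms(5) by (simp add: S_def)
  have "((\<lambda>t. S (t + 1) - S t) has_real_derivative 0) (at t)" for t
  proof -
    have "((\<lambda>t. S (t + 1) - S t) has_real_derivative g (t + 1) * 1 - g t) (at t)"
      by (intro DERIV_diff DERIV_chain2[OF S] S) (auto intro!: derivative_eq_intros)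
    then show ?thesis using assms(4) by (simp add: periodic1_def)
  qed
  then have "S (t + 1) - S t = S (0 + 1) - S 0" for t
    using DERIV_isconst_all[of "\<lambda>t. S (t + 1) - S t" t 0] by blast
  then have S_per: "S (t + 1) = S t + 1" for t
    unfolding add_0 S0 S1 by (metis diff_eq_eq add.commute diff_zero)
  have grow: "m * (b - a) \<le> S b - S a" if "a \<le> b" for a b
  proof -
    have "S a - m * a \<le> S b - m * b"
    proof (rule DERIV_nonneg_imp_nondecreasing[OF that])
      fix x
      show "\<exists>y. ((\<lambda>x. S x - m * x) has_real_derivative y) (at x) \<and> 0 \<le> y"
        using assms(3)[of x] by (intro exI[of _ "g x - m"]) (auto intro!: derivative_eq_intros S)
    qed
    then show ?thesis by (simp add: algebra_simps)
  qed
  have mono: "S a < S b" if "a < b" for a b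
    using grow[of a b] that assms(2) mult_pos_pos[of m "b - a"] by linarith
  then have inj: "inj S" by (intro linorder_injI) (use less_irrefl in metis)
  have contS: "continuous_on A S" for A
    using S by (meson DERIV_isCont continuous_at_imp_continuous_on)
  have "surj S"
    unfolding surj_def
  proof
    fix y
    \<comment> \<open>By the growth bound, \<open>S\<close> is at most -|y| at -|y|/m and at least
      |y| at |y|/m.\<close>
    have "\<exists>x\<ge>-(\<bar>y\<bar> / m). x \<le> \<bar>y\<bar> / m \<and> S x = y"
    proof (rule IVT')
      show "S (-(\<bar>y\<bar> / m)) \<le> y" "y \<le> S (\<bar>y\<bar> / m)"
        using grow[of "-(\<bar>y\<bar> / m)" 0] grow[of 0 "\<bar>y\<bar> / m"] S0 assms(2) by auto
    qed (use assms(2) contS in auto)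
    then show "\<exists>x. y = S x" by blast
  qed
  define T where "T = inv S"
  have ST: "S (T t) = t" and TS: "T (S t) = t" for t
    using inj \<open>surj S\<close> by (simp_all add: T_def surj_f_inv_f)
  have T: "(T has_real_derivative inverse (g (T t))) (at t)" for t
  proof (rule DERIV_inverse_function[where f = S and a = "t - 1" and b = "t + 1"])
    show "(S has_real_derivative g (T t)) (at (T t))" using S .
    show "g (T t) \<noteq> 0" using assms(2) assms(3)[of "T t"] by linarith
    have "isCont T (S (T t))"
      by (rule isCont_inverse_function[where f = S and d = 1]) (use TS DERIV_isCont[OF S] in auto)
    then show "isCont T t" by (simp add: ST)
  qed (use ST in auto)
  show ?thesis
    using that[of S T] S T S0 S1 S_per ST TS
    unfolding has_real_derivative_iff_has_vector_derivative by blast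
qed

lemma norm_perp_proj_le:
  assumes "norm T = 1"
  shows "norm (perp_proj T x) \<le> norm x"
proof (rule power2_le_imp_le)
  have T: "T \<bullet> T = 1" using assms by (simp add: dot_square_norm)
  have "(norm (perp_proj T x))\<^sup>2 = x \<bullet> x - (T \<bullet> x)\<^sup>2"
    unfolding perp_proj_def power2_norm_eq_inner
    by (simp add: inner_diff_left inner_diff_right T inner_commute[of x T] power2_eq_square)
  then show "(norm (perp_proj T x))\<^sup>2 \<le> (norm x)\<^sup>2"
    unfolding power2_norm_eq_inner[of x] by simp
qed simp

lemma perp_proj_minus_tangent:
  assumes "norm T = 1"
  shows "perp_proj T (x - c *\<^sub>R T) = perp_proj T x"
proof -
  have T: "T \<bullet> T = 1" using assms by (simp add: dot_square_norm)
  show ?thesis by (simp add: perp_proj_def inner_diff_right T algebra_simps)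
qed

text \<open>For x = |t - s| below 1/(2K), Taylor's formula gives a chord of length at least x - K
  x^2 \<ge> x/2 whose part normal to the tangent is at most K x^2; the ratio of (x/2)^2 to 2 K x^2
  is the constant 1/(8K). Otherwise the normal part is at most the chord, and the ratio is at least
  \<kappa>/2.\<close>

lemma thickness_unit_speed:
  fixes v :: "real \<Rightarrow> real ^ 3"
  assumes per: "periodic1 v"
    and d1: "\<And>t. (v has_vector_derivative v1 t) (at t)" and d2: "\<And>t. (v1 has_vector_derivative v2 t) (at t)"
    and unit: "\<And>t. norm (v1 t) = 1" and K: "\<And>t. norm (v2 t) \<le> K" "0 < K"
    and \<kappa>: "0 < \<kappa>" "\<And>s t. 1 / (2 * K) \<le> \<bar>t - s\<bar> \<Longrightarrow> \<bar>t - s\<bar> \<le> 1/2 \<Longrightarrow> \<kappa> \<le> norm (v t - v s)"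
  shows "inj_on v {0..<1}" "ereal (min (1 / (8 * K)) (\<kappa> / 2)) \<le> Thi v"
proof -
  define c where "c = min (1 / (8 * K)) (\<kappa> / 2)"
  \<comment> \<open>Multiplied out, the estimate makes sense also when the normal part vanishes.
    Distinctness of the two points is carried along and yields injectivity.\<close>
  have core: "v t \<noteq> v s \<and> c * (2 * norm (perp_proj (v1 s) (v t - v s))) \<le> (norm (v t - v s))\<^sup>2"
    if st: "s \<noteq> t" "\<bar>t - s\<bar> \<le> 1/2" for s t
  proof (cases "1 / (2 * K) \<le> \<bar>t - s\<bar>")
    case True
    then have k: "\<kappa> \<le> norm (v t - v s)" using \<kappa>(2) st(2) by blast
    have "c * (2 * norm (perp_proj (v1 s) (v t - v s))) \<le> (\<kappa> / 2) * (2 * norm (v t - v s))"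
      using \<kappa>(1) norm_perp_proj_le[OF unit] by (intro mult_mono) (auto simp: c_def)
    also have "\<dots> \<le> (norm (v t - v s))\<^sup>2"
      using k mult_right_mono[OF k norm_ge_zero[of "v t - v s"]] by (simp add: power2_eq_square)
    finally show ?thesis using k \<kappa>(1) by auto
  next
    case False
    define x where "x = \<bar>t - s\<bar>"
    have x: "0 < x" "K * x \<le> 1/2" using False st(1) K(2) by (auto simp: x_def field_simps)
    have ty: "norm (v t - v s - (t - s) *\<^sub>R v1 s) \<le> K * x\<^sup>2"
      using taylor2_bound[OF d1 d2 K(1), of t s] by (simp add: x_def)
    have "norm ((t - s) *\<^sub>R v1 s) = x" using unit by (simp add: x_def)
    then have "x - K * x\<^sup>2 \<le> norm (v t - v s)"
      using ty norm_triangle_ineq2[of "(t - s) *\<^sub>R v1 s" "v t - v s"]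
      by (simp add: norm_minus_commute)
    moreover have "K * x\<^sup>2 \<le> x / 2" using x mult_right_mono[of "K * x" "1/2" x] by (simp add: power2_eq_square)
    ultimately have lo: "x / 2 \<le> norm (v t - v s)" by linarith
    \<comment> \<open>The projection annihilates the linear term, so only the quadratic Taylor
      remainder contributes.\<close>
    have "norm (perp_proj (v1 s) (v t - v s)) \<le> K * x\<^sup>2"
      using norm_perp_proj_le[OF unit] ty perp_proj_minus_tangent[OF unit] order_trans by metis
    then have "c * (2 * norm (perp_proj (v1 s) (v t - v s))) \<le> (1 / (8 * K)) * (2 * (K * x\<^sup>2))"
      using K(2) by (intro mult_mono) (auto simp: c_def)
    also have "\<dots> = (x / 2)\<^sup>2" using K(2) by (simp add: field_simps)
    also have "\<dots> \<le> (norm (v t - v s))\<^sup>2" using lo x(1) by (intro power_mono) auto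
    finally show ?thesis using lo x(1) by auto
  qed
  have core': "v t \<noteq> v s \<and> c * (2 * norm (perp_proj (v1 s) (v t - v s))) \<le> (norm (v t - v s))\<^sup>2"
    if st: "s \<in> {0..<1}" "t \<in> {0..<1}" "s \<noteq> t" for s t
  proof -
    \<comment> \<open>A shift by one period brings t within 1/2 of s, the range in which \<kappa> is
      available.\<close>
    obtain t' where t': "\<bar>t' - s\<bar> \<le> 1/2" "s \<noteq> t'" "v t' = v t"
    proof -
      consider "\<bar>t - s\<bar> \<le> 1/2" | "1/2 < t - s" | "1/2 < s - t" by linarith
      then show ?thesis
      proof cases
        case 1
        then show ?thesis using that st by blast
      next
        case 2
        have "v (t - 1) = v t" using per unfolding periodic1_def by (metis diff_add_cancel)
        moreover have "\<bar>(t - 1) - s\<bar> \<le> 1/2" "s \<noteq> t - 1" using 2 st by auto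
        ultimately show ?thesis using that by blast
      next
        case 3
        have "v (t + 1) = v t" using per unfolding periodic1_def by blast
        moreover have "\<bar>(t + 1) - s\<bar> \<le> 1/2" "s \<noteq> t + 1" using 3 st by auto
        ultimately show ?thesis using that by blast
      qed
    qed
    show ?thesis using core[OF t'(2,1)] t'(3) by simp
  qed
  show "inj_on v {0..<1}" unfolding inj_on_def using core' by metis
  have ut: "unit_tangent v s = v1 s" for s
    using vector_derivative_at[OF d1] unit by (simp add: unit_tangent_def nth_vderiv_def)
  show "ereal (min (1 / (8 * K)) (\<kappa> / 2)) \<le> Thi v"
    unfolding Thi_def c_def[symmetric]
  proof (rule INF_greatest, clarify)
    fix s t :: real assume st: "s \<in> {0..<1}" "t \<in> {0..<1}" "s \<noteq> t"
    show "ereal c \<le> r_tp v s t"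
    proof (cases "perp_proj (v1 s) (v t - v s) = 0")
      case True
      then show ?thesis using core'[OF st] by (simp add: r_tp_def ut)
    next
      case False
      then have "c \<le> (norm (v t - v s))\<^sup>2 / (2 * norm (perp_proj (v1 s) (v t - v s)))"
        using core'[OF st] by (simp add: pos_le_divide_eq)
      then show ?thesis using core'[OF st] False by (simp add: r_tp_def ut)
    qed
  qed
qed

text \<open>\<open>Thi\<close> is an extended real and may be infinite, so the quotients are
  compared by monotonicity of division.\<close>

lemma Rop_le:
  assumes "0 < c" "ereal c \<le> Thi \<gamma>" "curve_length \<gamma> = 1"
  shows "Rop \<gamma> \<le> ereal (inverse c)"
proof -
  have "Thi \<gamma> \<noteq> 0" using assms(1,2) by auto
  then have "Rop \<gamma> = 1 / Thi \<gamma>" using assms(3) by (simp add: Rop_def one_ereal_def)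
  also have "\<dots> \<le> 1 / ereal c"
  proof (rule ereal_divide_left_mono[OF assms(2)])
    have "0 < Thi \<gamma>" using assms(1,2) less_le_trans[of 0 "ereal c"] by simp
    then show "0 < Thi \<gamma> * ereal c" using assms(1) by (simp add: ereal_zero_less_0_iff)
  qed simp
  also have "\<dots> = ereal (inverse c)" using assms(1) by (simp add: one_ereal_def inverse_eq_divide)
  finally show ?thesis .
qed

section \<open>The rotating orthonormal frame\<close>

text \<open>Components with respect to the rotating frame of radial, angular and axial unit vectors.\<close>

definition frame :: "real \<Rightarrow> real \<Rightarrow> real \<Rightarrow> real \<Rightarrow> real ^ 3" where
  "frame \<theta> x y z = vector [x * cos \<theta> - y * sin \<theta>, x * sin \<theta> + y * cos \<theta>, z]"

text \<open>The frame is orthonormal, so the angle drops out of all speeds and curvatures.\<close>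

lemma frame_inner: "frame \<theta> x y z \<bullet> frame \<theta> x' y' z' = x * x' + y * y' + z * z'"
proof -
  have c: "cos \<theta> * cos \<theta> = 1 - sin \<theta> * sin \<theta>"
    using cos_squared_eq[of \<theta>] by (simp add: power2_eq_square)
  show ?thesis
    by (simp add: frame_def inner_vec_def sum_3 vector_3 algebra_simps c)
qed

lemma vector_3_eq_sum_axis:
  "(vector [x, y, z] :: real ^ 3) = x *\<^sub>R axis 1 1 + y *\<^sub>R axis 2 1 + z *\<^sub>R axis 3 1"
  by (simp add: vec_eq_iff forall_3 vector_3 axis_def)

text \<open>The extra terms come from the rotation of the frame: the derivative of the radial vector
  is c times the angular one, that of the angular vector is -c times the radial one.\<close>

lemma has_vector_derivative_frame:
  assumes "(x has_real_derivative x') (at t)" "(y has_real_derivative y') (at t)" "(z has_real_derivative z') (at t)"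
  shows "((\<lambda>t. frame (c * t) (x t) (y t) (z t)) has_vector_derivative
    frame (c * t) (x' - c * y t) (y' + c * x t) z') (at t)"
proof -
  have "((\<lambda>t. x t * cos (c * t) - y t * sin (c * t)) has_real_derivative
      (x' - c * y t) * cos (c * t) - (y' + c * x t) * sin (c * t)) (at t)"
    "((\<lambda>t. x t * sin (c * t) + y t * cos (c * t)) has_real_derivative
      (x' - c * y t) * sin (c * t) + (y' + c * x t) * cos (c * t)) (at t)"
    using assms by (auto intro!: derivative_eq_intros simp: algebra_simps)
  then show ?thesis
    unfolding frame_def vector_3_eq_sum_axis using assms(3)
    by (intro has_vector_derivative_add has_vector_derivative_scaleR[where g' = 0, simplified])
       (auto simp: has_real_derivative_iff_has_vector_derivative)
qed

lemma cyl_eq_frame: "cyl r \<theta> h = frame \<theta> r 0 h"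
  by (simp add: vec_eq_iff forall_3 cyl_nth) (simp add: frame_def vector_3)

text \<open>The law of cosines with a height difference, written so that the angular contribution is
  separate and nonnegative for positive radii.\<close>

lemma norm_cyl_diff:
  "(norm (cyl r \<theta> h - cyl r' \<theta>' h'))\<^sup>2 = (r - r')\<^sup>2 + (h - h')\<^sup>2 + 2 * r * r' * (1 - cos (\<theta> - \<theta>'))"
proof -
  have c: "cos x * cos x = 1 - sin x * sin x" for x :: real
    using cos_squared_eq[of x] by (simp add: power2_eq_square)
  show ?thesis
    unfolding power2_norm_eq_inner inner_vec_def sum_3 vector_minus_component cyl_nth cos_diff
    by (simp add: power2_eq_square algebra_simps c)
qed

text \<open>With constant components, differentiation rotates and rescales the first two and kills
  the third, so all derivatives have the same form.\<close>

lemma smooth_fun_vec_frame: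
  assumes "\<And>t. frame (c * t) x y z = f t"
  shows "smooth_fun f"
proof -
  have "\<exists>x' y' z'. nth_vderiv k (\<lambda>t. frame (c * t) x y z) = (\<lambda>t. frame (c * t) x' y' z')" for k
  proof (induction k)
    case 0
    then show ?case by (auto simp: nth_vderiv_0)
  next
    case (Suc k)
    then obtain x' y' z' where *: "nth_vderiv k (\<lambda>t. frame (c * t) x y z) = (\<lambda>t. frame (c * t) x' y' z')"
      by blast
    have "((\<lambda>t. frame (c * t) x' y' z') has_vector_derivative frame (c * t) (0 - c * y') (0 + c * x') 0) (at t)" for t
      by (intro has_vector_derivative_frame) auto
    then show ?case unfolding nth_vderiv_Suc * using vector_derivative_at by blast
  qed
  moreover have "(\<lambda>t. frame (c * t) x' y' z') differentiable (at t)" for x' y' z' t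
    using has_vector_derivative_frame[of "\<lambda>_. x'" 0 t "\<lambda>_. y'" 0 "\<lambda>_. z'" 0 c] differentiableI_vector by auto
  ultimately have "smooth_fun (\<lambda>t. frame (c * t) x y z)"
    unfolding smooth_fun_def by metis
  then show ?thesis using assms by simp
qed

section \<open>The thin braid around the circle\<close>

text \<open>\<open>a\<close> and \<open>b\<close> are the radius and the height along the knotted braid, with the \<open>n\<close> turns
  rescaled to the unit interval.\<close>

locale thin_braid =
  fixes n :: nat and a b :: "real \<Rightarrow> real"
  assumes n: "1 \<le> n"
    and smooth: "smooth_fun a" "smooth_fun b"
    and per: "periodic1 a" "periodic1 b"
    and pos: "\<And>t. 0 < a t"
    and sep: "\<And>t k. 0 < k \<Longrightarrow> k < n \<Longrightarrow>
      (a (t + real k / real n), b (t + real k / real n)) \<noteq> (a t, b t)"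
begin

definition \<omega> :: real where "\<omega> = 2 * pi * real n"

definition \<eta> :: "real \<Rightarrow> real \<Rightarrow> real ^ 3" where
  "\<eta> \<rho> t = cyl (1 + \<rho> * a t) (\<omega> * t) (\<rho> * b t)"

definition "a1 = nth_vderiv 1 a"
definition "a2 = nth_vderiv 2 a"
definition "b1 = nth_vderiv 1 b"
definition "b2 = nth_vderiv 2 b"

definition \<eta>1 :: "real \<Rightarrow> real \<Rightarrow> real ^ 3" where
  "\<eta>1 \<rho> t = frame (\<omega> * t) (\<rho> * a1 t) (\<omega> * (1 + \<rho> * a t)) (\<rho> * b1 t)"

text \<open>The radial component contains the centripetal acceleration, the angular one the Coriolis
  term with its factor 2.\<close>

definition \<eta>2 :: "real \<Rightarrow> real \<Rightarrow> real ^ 3" where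
  "\<eta>2 \<rho> t = frame (\<omega> * t) (\<rho> * a2 t - \<omega> * (\<omega> * (1 + \<rho> * a t))) (2 * \<omega> * \<rho> * a1 t) (\<rho> * b2 t)"

text \<open>As the root of an inner product, the speed is accessible to the rules for square roots
  of families and of expansions.\<close>

definition sp :: "real \<Rightarrow> real \<Rightarrow> real" where
  "sp \<rho> t = sqrt (\<eta>1 \<rho> t \<bullet> \<eta>1 \<rho> t)"

definition len :: "real \<Rightarrow> real" where
  "len \<rho> = (LINT t:{0..1}|lborel. sp \<rho> t)"

section \<open>Speed, length and acceleration of the squeezed braid\<close>

lemma omega_ge: "6 \<le> \<omega>"
proof -
  have "2 * 3 * 1 \<le> 2 * pi * real n" using n pi_gt3 by (intro mult_mono) auto
  then show ?thesis by (simp add: \<omega>_def)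
qed

lemma derivs:
  "(a has_real_derivative a1 t) (at t)" "(a1 has_real_derivative a2 t) (at t)"
  "(b has_real_derivative b1 t) (at t)" "(b1 has_real_derivative b2 t) (at t)"
  using smooth_fun_has_vderiv[OF smooth(1), of 0] smooth_fun_has_vderiv[OF smooth(1), of 1]
    smooth_fun_has_vderiv[OF smooth(2), of 0] smooth_fun_has_vderiv[OF smooth(2), of 1]
  by (simp_all add: has_real_derivative_iff_has_vector_derivative nth_vderiv_0 numeral_2_eq_2 a1_def a2_def b1_def b2_def)

lemma conts: "continuous_on A a" "continuous_on A a1" "continuous_on A a2"
  "continuous_on A b" "continuous_on A b1" "continuous_on A b2"
  unfolding a1_def a2_def b1_def b2_def
  using smooth by (auto intro: smooth_fun_continuous smooth_fun_nth_vderiv)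

lemma pers: "a (t + 1) = a t" "a1 (t + 1) = a1 t" "a2 (t + 1) = a2 t"
  "b (t + 1) = b t" "b1 (t + 1) = b1 t" "b2 (t + 1) = b2 t"
  using per periodic1_nth_vderiv[OF per(1)] periodic1_nth_vderiv[OF per(2)]
  by (simp_all add: periodic1_def a1_def a2_def b1_def b2_def)

lemma eta_deriv: "(\<eta> \<rho> has_vector_derivative \<eta>1 \<rho> t) (at t)"
proof -
  have "((\<lambda>t. frame (\<omega> * t) (1 + \<rho> * a t) 0 (\<rho> * b t)) has_vector_derivative
    frame (\<omega> * t) (\<rho> * a1 t - \<omega> * 0) (0 + \<omega> * (1 + \<rho> * a t)) (\<rho> * b1 t)) (at t)"
    by (intro has_vector_derivative_frame) (auto intro!: derivative_eq_intros derivs)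
  then show ?thesis by (simp add: \<eta>_def[abs_def] \<eta>1_def cyl_eq_frame)
qed

lemma eta1_deriv: "(\<eta>1 \<rho> has_vector_derivative \<eta>2 \<rho> t) (at t)"
proof -
  have "((\<lambda>t. frame (\<omega> * t) (\<rho> * a1 t) (\<omega> * (1 + \<rho> * a t)) (\<rho> * b1 t)) has_vector_derivative
    frame (\<omega> * t) (\<rho> * a2 t - \<omega> * (\<omega> * (1 + \<rho> * a t))) (\<omega> * (\<rho> * a1 t) + \<omega> * (\<rho> * a1 t)) (\<rho> * b2 t)) (at t)"
    by (intro has_vector_derivative_frame) (auto intro!: derivative_eq_intros derivs)
  then show ?thesis by (simp add: \<eta>1_def[abs_def] \<eta>2_def mult.commute mult.left_commute)
qed

lemma frame_periodic: "frame (\<omega> * (t + 1)) x y z = frame (\<omega> * t) x y z"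
proof -
  have "\<omega> * (t + 1) = \<omega> * t + 2 * pi * of_int (int n)" by (simp add: \<omega>_def algebra_simps)
  then have "cos (\<omega> * (t + 1)) = cos (\<omega> * t)" "sin (\<omega> * (t + 1)) = sin (\<omega> * t)"
    using sin_cos_eq_iff[of "\<omega> * (t + 1)" "\<omega> * t"] by blast+
  then show ?thesis by (simp add: frame_def)
qed

lemma eta_periodic: "\<eta> \<rho> (t + 1) = \<eta> \<rho> t"
  unfolding \<eta>_def cyl_eq_frame frame_periodic pers ..

lemma smooth_family_eta: "smooth_family \<eta>"
proof -
  have fr: "smooth_family (\<lambda>\<rho> t. frame (\<omega> * t) x y z)" for x y z
    by (intro smooth_family_fixed smooth_fun_vec_frame[OF refl]) (simp add: periodic1_def frame_periodic)
  have "smooth_family (\<lambda>\<rho> t. (1 + \<rho> * a t) *\<^sub>R frame (\<omega> * t) 1 0 0 + (\<rho> * b t) *\<^sub>R frame (\<omega> * t) 0 0 1)"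
    using smooth per
    by (intro smooth_family_add smooth_family_scaleR smooth_family_mult fr smooth_family_const
        smooth_family_param smooth_family_fixed) auto
  then show ?thesis
    by (rule smooth_family_cong)
      (simp add: \<eta>_def cyl_eq_frame vec_eq_iff forall_3 frame_def vector_3)
qed

lemma smooth_family_eta1: "smooth_family \<eta>1"
  using smooth_family_deriv[OF smooth_family_eta] vector_derivative_at[OF eta_deriv] by simp

lemma speed_sq: "\<eta>1 \<rho> t \<bullet> \<eta>1 \<rho> t = (\<rho> * a1 t)\<^sup>2 + (\<omega> * (1 + \<rho> * a t))\<^sup>2 + (\<rho> * b1 t)\<^sup>2"
  unfolding \<eta>1_def frame_inner by (simp add: power2_eq_square)

text \<open>Since \<open>a\<close> is positive, the angular component alone is at least
  \<omega>.\<close>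

lemma speed_sq_ge:
  assumes "\<rho> \<in> {0..1}"
  shows "\<omega>\<^sup>2 \<le> \<eta>1 \<rho> t \<bullet> \<eta>1 \<rho> t"
proof -
  have "0 \<le> \<rho> * a t" using assms pos[of t] by simp
  then have "\<omega> * 1 \<le> \<omega> * (1 + \<rho> * a t)" using omega_ge by (intro mult_left_mono) auto
  then have "(\<omega> * 1)\<^sup>2 \<le> (\<omega> * (1 + \<rho> * a t))\<^sup>2" using omega_ge by (intro power_mono) auto
  then show ?thesis unfolding speed_sq by (simp add: add_increasing add_increasing2)
qed

lemma sp_ge: "\<rho> \<in> {0..1} \<Longrightarrow> \<omega> \<le> sp \<rho> t"
  unfolding sp_def using speed_sq_ge omega_ge by (intro real_le_rsqrt) auto

lemma omega_sq_pos: "0 < \<omega>\<^sup>2" and omega_pos: "0 < \<omega>"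
  using omega_ge by (auto intro: zero_less_power)

lemma smooth_family_sp: "smooth_family sp"
  unfolding sp_def[abs_def]
  using smooth_family_eta1 speed_sq_ge omega_sq_pos
  by (intro smooth_family_sqrt[where m = "\<omega>\<^sup>2"] smooth_family_inner)

lemma sp_continuous: "\<rho> \<in> {0..1} \<Longrightarrow> continuous_on A (sp \<rho>)"
  by (rule smooth_family_continuous[OF smooth_family_sp])

lemma norm_eta1: "norm (\<eta>1 \<rho> t) = sp \<rho> t"
  by (simp add: sp_def norm_eq_sqrt_inner)

lemma sp_periodic: "sp \<rho> (t + 1) = sp \<rho> t"
  unfolding norm_eta1[symmetric] \<eta>1_def frame_periodic pers ..

lemma expand1_speed_sq: "expand1 (\<lambda>\<rho> t. \<eta>1 \<rho> t \<bullet> \<eta>1 \<rho> t) (\<lambda>t. \<omega>\<^sup>2) (\<lambda>t. 2 * \<omega>\<^sup>2 * a t)"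
proof -
  have "\<exists>B. \<forall>t. \<bar>2 * \<omega>\<^sup>2 * a t\<bar> \<le> B" "\<exists>B. \<forall>t. \<bar>(a1 t)\<^sup>2 + \<omega>\<^sup>2 * (a t)\<^sup>2 + (b1 t)\<^sup>2\<bar> \<le> B"
    by (intro periodic_bounded_real continuous_intros conts; simp add: pers)+
  then obtain B C where "\<forall>t. \<bar>2 * \<omega>\<^sup>2 * a t\<bar> \<le> B" "\<forall>t. \<bar>(a1 t)\<^sup>2 + \<omega>\<^sup>2 * (a t)\<^sup>2 + (b1 t)\<^sup>2\<bar> \<le> C" by blast
  then show ?thesis
    by (intro expand1_quadratic[where w = "\<lambda>t. (a1 t)\<^sup>2 + \<omega>\<^sup>2 * (a t)\<^sup>2 + (b1 t)\<^sup>2" and A = "\<omega>\<^sup>2" and B = B and C = C])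
       (auto simp: speed_sq power2_eq_square algebra_simps)
qed

lemma expand1_accel_sq:
  "expand1 (\<lambda>\<rho> t. \<eta>2 \<rho> t \<bullet> \<eta>2 \<rho> t) (\<lambda>t. \<omega> ^ 4) (\<lambda>t. 2 * \<omega>\<^sup>2 * (\<omega>\<^sup>2 * a t - a2 t))"
proof -
  let ?c2 = "\<lambda>t. (\<omega>\<^sup>2 * a t - a2 t)\<^sup>2 + 4 * \<omega>\<^sup>2 * (a1 t)\<^sup>2 + (b2 t)\<^sup>2"
  have "\<exists>B. \<forall>t. \<bar>2 * \<omega>\<^sup>2 * (\<omega>\<^sup>2 * a t - a2 t)\<bar> \<le> B" "\<exists>B. \<forall>t. \<bar>?c2 t\<bar> \<le> B"
    by (intro periodic_bounded_real continuous_intros conts; simp add: pers)+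
  then obtain B C where "\<forall>t. \<bar>2 * \<omega>\<^sup>2 * (\<omega>\<^sup>2 * a t - a2 t)\<bar> \<le> B" "\<forall>t. \<bar>?c2 t\<bar> \<le> C" by blast
  then show ?thesis
    by (intro expand1_quadratic[where w = ?c2 and A = "\<bar>\<omega> ^ 4\<bar>" and B = B and C = C])
       (auto simp: \<eta>2_def frame_inner power2_eq_square power4_eq_xxxx algebra_simps)
qed

lemma expand1_speed_accel:
  "expand1 (\<lambda>\<rho> t. \<eta>1 \<rho> t \<bullet> \<eta>2 \<rho> t) (\<lambda>t. 0) (\<lambda>t. \<omega>\<^sup>2 * a1 t)"
proof -
  let ?c2 = "\<lambda>t. a1 t * (a2 t - \<omega>\<^sup>2 * a t) + 2 * \<omega>\<^sup>2 * a t * a1 t + b1 t * b2 t"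
  have "\<exists>B. \<forall>t. \<bar>\<omega>\<^sup>2 * a1 t\<bar> \<le> B" "\<exists>B. \<forall>t. \<bar>?c2 t\<bar> \<le> B"
    by (intro periodic_bounded_real continuous_intros conts; simp add: pers)+
  then obtain B C where "\<forall>t. \<bar>\<omega>\<^sup>2 * a1 t\<bar> \<le> B" "\<forall>t. \<bar>?c2 t\<bar> \<le> C" by blast
  then show ?thesis
    by (intro expand1_quadratic[where w = ?c2 and A = 0 and B = B and C = C])
       (auto simp: \<eta>1_def \<eta>2_def frame_inner power2_eq_square algebra_simps)
qed

lemma expand1_sp: "expand1 sp (\<lambda>t. \<omega>) (\<lambda>t. \<omega> * a t)"
proof -
  have "expand1 sp (\<lambda>t. sqrt (\<omega>\<^sup>2)) (\<lambda>t. 2 * \<omega>\<^sup>2 * a t / (2 * sqrt (\<omega>\<^sup>2)))"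
    unfolding sp_def[abs_def] by (rule expand1_sqrt[OF expand1_speed_sq omega_sq_pos speed_sq_ge])
  then show ?thesis using omega_pos by (simp add: power2_eq_square)
qed

lemma expand1_len: "expand1 (\<lambda>\<rho> _. len \<rho>) (\<lambda>_. \<omega>) (\<lambda>_. \<omega> * (LINT t:{0..1}|lborel. a t))"
  using expand1_integral[OF expand1_sp sp_continuous] conts
  by (simp add: len_def[abs_def] LINT_const continuous_on_mult)

lemma len_ge: "\<rho> \<in> {0..1} \<Longrightarrow> \<omega> \<le> len \<rho>"
proof -
  assume r: "\<rho> \<in> {0..1}"
  have "(LINT t:{0..1::real}|lborel. \<omega>) \<le> len \<rho>"
    unfolding len_def using r sp_ge sp_continuous
    by (intro set_integral_mono set_integrable_Icc) auto
  then show ?thesis by (simp add: LINT_const)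
qed

lemma len_0: "len 0 = \<omega>"
  using expand1_at_0[OF expand1_len] .

lemma sp_0: "sp 0 t = \<omega>"
  using expand1_at_0[OF expand1_sp, of t] .

lemma smooth_family_len: "smooth_family (\<lambda>\<rho> t. len \<rho>)"
  by (rule smooth_family_of_Lip[OF expand1_imp_Lip[OF expand1_len]])

end

context thin_braid
begin

section \<open>Lower bounds for chords of the squeezed braid\<close>

text \<open>For each of the finitely many shifts the distance between strands is a positive,
  continuous, periodic function, hence bounded below.\<close>

lemma strand_separation:
  obtains d where "0 < d" "\<And>t k. 0 < k \<Longrightarrow> k < n \<Longrightarrow>
    d \<le> \<bar>a (t + real k / real n) - a t\<bar> + \<bar>b (t + real k / real n) - b t\<bar>"
proof -
  let ?f = "\<lambda>k t. \<bar>a (t + real k / real n) - a t\<bar> + \<bar>b (t + real k / real n) - b t\<bar>"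
  have "\<forall>k\<in>{0<..<n}. \<exists>d>0. \<forall>t. d \<le> ?f k t"
  proof
    fix k assume k: "k \<in> {0<..<n}"
    have "a (t + 1 + x) = a (t + x)" "b (t + 1 + x) = b (t + x)" for t x
      using pers(1)[of "t + x"] pers(4)[of "t + x"] by (simp_all add: add_ac)
    then have "periodic1 (?f k)" by (simp add: periodic1_def pers)
    moreover have "continuous_on UNIV (?f k)"
      by (intro continuous_intros conts continuous_on_compose2[OF conts(1)[of UNIV]]
          continuous_on_compose2[OF conts(4)[of UNIV]]) auto
    moreover have "0 < ?f k t" for t
      using sep[of k t] k by auto
    ultimately show "\<exists>d>0. \<forall>t. d \<le> ?f k t" by (rule periodic1_pos_lower_bound) blast
  qed
  then obtain d where d: "\<And>k. k \<in> {0<..<n} \<Longrightarrow> 0 < d k \<and> (\<forall>t. d k \<le> ?f k t)" by metis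
  show ?thesis
  \<comment> \<open>Inserting 1 keeps the minimum defined for n = 1, when there are no
    shifts.\<close>
  proof (rule that[of "Min (insert 1 (d ` {0<..<n}))"])
    show "0 < Min (insert 1 (d ` {0<..<n}))" using d by (subst Min_gr_iff) auto
    fix t k assume k: "0 < k" "k < n"
    have "Min (insert 1 (d ` {0<..<n})) \<le> d k" using k by (intro Min_le) auto
    also have "\<dots> \<le> ?f k t" using d k by auto
    finally show "Min (insert 1 (d ` {0<..<n})) \<le> ?f k t" .
  qed
qed

text \<open>Distinct strands over the same angle are at distance at least \<open>\<rho> d\<close> up to a constant, and they
  are Lipschitz in the angle with a constant of order \<open>\<rho>\<close>; an angle difference \<open>\<alpha>\<close> in turn forces the
  distance \<open>\<bar>\<alpha>\<bar> / 3\<close>.  Adding the two estimates eliminates \<open>\<alpha>\<close>.\<close>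

lemma chord_bound:
  obtains c where "0 < c" "\<And>\<rho> s t. \<rho> \<in> {0..1} \<Longrightarrow> \<bar>t - s\<bar> \<le> 1 \<Longrightarrow>
    c * min \<rho> (min \<bar>t - s\<bar> (1 - \<bar>t - s\<bar>)) \<le> norm (\<eta> \<rho> t - \<eta> \<rho> s)"
proof -
  obtain d where d: "0 < d" "\<And>t k. 0 < k \<Longrightarrow> k < n \<Longrightarrow>
    d \<le> \<bar>a (t + real k / real n) - a t\<bar> + \<bar>b (t + real k / real n) - b t\<bar>"
    using strand_separation by blast
  obtain A where A: "\<And>t. \<bar>a1 t\<bar> \<le> A" using periodic_bounded_real[OF conts(2) pers(2)] by blast
  obtain B where B: "\<And>t. \<bar>b1 t\<bar> \<le> B" using periodic_bounded_real[OF conts(5) pers(5)] by blast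
  have n0: "0 < real n" using n by simp
  have AB: "0 \<le> A + B" using A[of 0] B[of 0] by linarith
  have lip: "\<bar>a t - a s\<bar> + \<bar>b t - b s\<bar> \<le> (A + B) * \<bar>t - s\<bar>" for s t
    using vderiv_bound[of a a1 s t A] vderiv_bound[of b b1 s t B] derivs A B
    by (simp add: has_real_derivative_iff_has_vector_derivative distrib_right)
  define M where "M = A + B"
  \<comment> \<open>Different strands require (2 + 3 M) c \<le> d, the same strand requires c \<le>
    1.\<close>
  define c where "c = min 1 (d / (2 + 3 * M))"
  have c: "0 < c" "c \<le> 1" "c * (2 + 3 * M) \<le> d"
    using d(1) AB unfolding c_def M_def by (auto simp: min_mult_distrib_right min_le_iff_disj)
  show ?thesis
  proof (rule that[OF c(1)])
    fix \<rho> s t :: real assume r: "\<rho> \<in> {0..1}" and st: "\<bar>t - s\<bar> \<le> 1"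
    let ?N = "norm (\<eta> \<rho> t - \<eta> \<rho> s)"
    define \<delta> where "\<delta> = t - s"
    \<comment> \<open>\<open>j\<close> is the number of turns from s to t, rounded to the nearest
      integer, and \<alpha> the angle left over, at most pi in absolute value.\<close>
    define j where "j = round (real n * \<delta>)"
    define \<alpha> where "\<alpha> = 2 * pi * (real n * \<delta> - of_int j)"
    have rj: "\<bar>real n * \<delta> - of_int j\<bar> \<le> 1 / 2"
      using of_int_round_abs_le[of "real n * \<delta>"] by (simp add: j_def abs_minus_commute)
    have \<alpha>abs: "\<bar>\<alpha>\<bar> = 2 * pi * \<bar>real n * \<delta> - of_int j\<bar>" by (simp add: \<alpha>_def abs_mult)
    then have \<alpha>pi: "\<bar>\<alpha>\<bar> \<le> pi" using rj by simp
    have "\<omega> * t - \<omega> * s = \<alpha> + 2 * pi * of_int j" by (simp add: \<omega>_def \<alpha>_def \<delta>_def algebra_simps)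
    then have cos: "cos (\<omega> * t - \<omega> * s) = cos \<alpha>"
      using sin_cos_eq_iff[of "\<omega> * t - \<omega> * s" \<alpha>] by blast
    have N2: "?N\<^sup>2 = (\<rho> * (a t - a s))\<^sup>2 + (\<rho> * (b t - b s))\<^sup>2
        + 2 * (1 + \<rho> * a t) * (1 + \<rho> * a s) * (1 - cos \<alpha>)"
      unfolding \<eta>_def norm_cyl_diff cos by (simp add: algebra_simps)
    have ge1: "1 \<le> 1 + \<rho> * a x" for x using r pos[of x] by simp
    have "1 * 1 \<le> (1 + \<rho> * a t) * (1 + \<rho> * a s)" using ge1 by (intro mult_mono) (auto intro: order_trans[OF zero_le_one])
    then have "1 * (1 - cos \<alpha>) \<le> (1 + \<rho> * a t) * (1 + \<rho> * a s) * (1 - cos \<alpha>)"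
      by (intro mult_right_mono) auto
    then have "2 * (1 * (1 - cos \<alpha>)) \<le> 2 * ((1 + \<rho> * a t) * (1 + \<rho> * a s) * (1 - cos \<alpha>))"
      by (intro mult_left_mono) auto
    moreover have "\<alpha>\<^sup>2 / 9 \<le> 2 * (1 * (1 - cos \<alpha>))" using one_minus_cos_ge[OF \<alpha>pi] by simp
    ultimately have lo: "\<alpha>\<^sup>2 / 9 \<le> 2 * (1 + \<rho> * a t) * (1 + \<rho> * a s) * (1 - cos \<alpha>)"
      unfolding mult.assoc by (rule order_trans[rotated])
    \<comment> \<open>Both radii are at least 1, so the angular term is at least 2 (1 - cos
      \<alpha>) \<ge> \<alpha>^2 / 9.\<close>
    have "\<bar>\<alpha>\<bar> / 3 \<le> ?N"
    proof (rule power2_le_imp_le)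
      show "(\<bar>\<alpha>\<bar> / 3)\<^sup>2 \<le> ?N\<^sup>2" unfolding N2 using lo by (simp add: power_divide add_increasing)
    qed simp
    have rN: "\<bar>\<rho> * (a t - a s)\<bar> \<le> ?N" "\<bar>\<rho> * (b t - b s)\<bar> \<le> ?N"
    proof -
      have "0 \<le> \<alpha>\<^sup>2 / 9" by simp
      then have "(\<rho> * (a t - a s))\<^sup>2 \<le> ?N\<^sup>2" "(\<rho> * (b t - b s))\<^sup>2 \<le> ?N\<^sup>2"
        using lo zero_le_power2[of "\<rho> * (a t - a s)"] zero_le_power2[of "\<rho> * (b t - b s)"]
        unfolding N2 by linarith+
      then show "\<bar>\<rho> * (a t - a s)\<bar> \<le> ?N" "\<bar>\<rho> * (b t - b s)\<bar> \<le> ?N"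
        by (auto intro: abs_le_square_iff[THEN iffD2] simp: abs_le_square_iff[symmetric])
    qed
    show "c * min \<rho> (min \<bar>t - s\<bar> (1 - \<bar>t - s\<bar>)) \<le> ?N"
    \<comment> \<open>A multiple of n turns leads back to the same strand, and the chord is
      controlled by the distance of t - s to an integer. Otherwise two different strands are
      compared, k = j mod n turns apart.\<close>
    proof (cases "int n dvd j")
      case True
      then obtain i where i: "j = int n * i" by blast
      have "min \<bar>\<delta>\<bar> (1 - \<bar>\<delta>\<bar>) \<le> \<bar>\<delta> - of_int i\<bar>" using st by (intro dist_int_ge_min) (simp add: \<delta>_def)
      also have "\<dots> \<le> \<bar>\<alpha>\<bar> / 3"
      proof -
        have "real n * \<delta> - of_int j = real n * (\<delta> - of_int i)" by (simp add: i algebra_simps)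
        then have "\<bar>\<alpha>\<bar> = \<omega> * \<bar>\<delta> - of_int i\<bar>" unfolding \<alpha>abs by (simp add: abs_mult \<omega>_def)
        moreover have "3 * \<bar>\<delta> - of_int i\<bar> \<le> \<omega> * \<bar>\<delta> - of_int i\<bar>"
          using omega_ge by (intro mult_right_mono) auto
        ultimately show ?thesis by simp
      qed
      also note \<open>\<bar>\<alpha>\<bar> / 3 \<le> ?N\<close>
      finally have m: "min \<bar>\<delta>\<bar> (1 - \<bar>\<delta>\<bar>) \<le> ?N" .
      have "c * min \<rho> (min \<bar>\<delta>\<bar> (1 - \<bar>\<delta>\<bar>)) \<le> 1 * min \<bar>\<delta>\<bar> (1 - \<bar>\<delta>\<bar>)"
        using c r st by (intro mult_mono) (auto simp: \<delta>_def)
      then show ?thesis using m unfolding \<delta>_def mult_1 by (rule order_trans)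
    next
      case False
      define k where "k = nat (j mod int n)"
      have k: "int k = j mod int n" using n by (simp add: k_def)
      have "int k < int n" unfolding k using n by (intro pos_mod_bound) simp
      moreover have "k \<noteq> 0" using False k by (auto simp: dvd_eq_mod_eq_0)
      ultimately have kn: "0 < k" "k < n" by auto
      have "of_int j = real k + real n * of_int (j div int n)"
      proof -
        have "j = int k + int n * (j div int n)" unfolding k by simp
        then show ?thesis by (metis of_int_add of_int_mult of_int_of_nat_eq)
      qed
      then have sj: "s + of_int j / real n = (s + real k / real n) + of_int (j div int n)"
        using n0 by (simp add: field_simps)
      have aj: "a (s + of_int j / real n) = a (s + real k / real n)"
        "b (s + of_int j / real n) = b (s + real k / real n)"
        unfolding sj using periodic1_int[OF per(1)] periodic1_int[OF per(2)] by auto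
      \<comment> \<open>The parameter s + j/n lies over the same angle as s, and its distance to t
        is |\<alpha>| / \<omega>; the weaker bound |\<alpha>| is enough.\<close>
      have "\<bar>t - (s + of_int j / real n)\<bar> \<le> \<bar>\<alpha>\<bar>"
      proof -
        have e: "t - (s + of_int j / real n) = (real n * \<delta> - of_int j) / real n"
          using n0 by (simp add: \<delta>_def field_simps)
        have "\<bar>t - (s + of_int j / real n)\<bar> \<le> \<bar>real n * \<delta> - of_int j\<bar> / 1"
          unfolding e abs_divide using n by (intro frac_le) auto
        also have "\<dots> \<le> 2 * pi * \<bar>real n * \<delta> - of_int j\<bar>"
          using pi_gt3 mult_right_mono[of 1 "2 * pi" "\<bar>real n * \<delta> - of_int j\<bar>"] by simp
        finally show ?thesis unfolding \<alpha>abs .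
      qed
      then have "(A + B) * \<bar>t - (s + of_int j / real n)\<bar> \<le> M * \<bar>\<alpha>\<bar>"
        using AB unfolding M_def by (intro mult_left_mono)
      then have "\<bar>a t - a (s + real k / real n)\<bar> + \<bar>b t - b (s + real k / real n)\<bar> \<le> M * \<bar>\<alpha>\<bar>"
        using lip[of t "s + of_int j / real n"] unfolding aj by linarith
      then have "d - M * \<bar>\<alpha>\<bar> \<le> \<bar>a t - a s\<bar> + \<bar>b t - b s\<bar>"
        using d(2)[OF kn, of s] by linarith
      then have "\<rho> * (d - M * \<bar>\<alpha>\<bar>) \<le> \<rho> * (\<bar>a t - a s\<bar> + \<bar>b t - b s\<bar>)"
        using r by (intro mult_left_mono) auto
      also have "\<dots> \<le> 2 * ?N" using rN r by (simp add: abs_mult distrib_left)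
      finally have "\<rho> * d - \<rho> * (M * \<bar>\<alpha>\<bar>) \<le> 2 * ?N" by (simp add: right_diff_distrib)
      moreover have "\<rho> * (M * \<bar>\<alpha>\<bar>) \<le> 1 * (M * (3 * ?N))"
        using r AB \<open>\<bar>\<alpha>\<bar> / 3 \<le> ?N\<close> unfolding M_def by (intro mult_mono) auto
      ultimately have N: "\<rho> * d \<le> (2 + 3 * M) * ?N" by (simp add: algebra_simps)
      have "(2 + 3 * M) * (c * \<rho>) \<le> \<rho> * d"
        using mult_right_mono[OF c(3), of \<rho>] r by (simp add: mult.commute mult.left_commute)
      then have "(2 + 3 * M) * (c * \<rho>) \<le> (2 + 3 * M) * ?N" using N by linarith
      then have "c * \<rho> \<le> ?N" using AB unfolding M_def by (auto simp: mult_le_cancel_left)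
      moreover have "c * min \<rho> (min \<bar>t - s\<bar> (1 - \<bar>t - s\<bar>)) \<le> c * \<rho>"
        using c(1) by (intro mult_left_mono) auto
      ultimately show ?thesis by linarith
    qed
  qed
qed

text \<open>By Lagrange's identity the first factor is the squared norm of the cross product of
  \<open>\<eta>1\<close> and \<open>\<eta>2\<close>. It contributes 4 \<omega> a - 2 a2 / \<omega>
  to the first-order coefficient, the power -5 of the speed contributes -5 \<omega> a, and the
  squared mixed product starts at order 2.\<close>

lemma eta_integrand_expansion:
  "expand1 (\<lambda>\<rho> t. ((\<eta>1 \<rho> t \<bullet> \<eta>1 \<rho> t) * (\<eta>2 \<rho> t \<bullet> \<eta>2 \<rho> t) - (\<eta>1 \<rho> t \<bullet> \<eta>2 \<rho> t)\<^sup>2) * inverse (sp \<rho> t) ^ 5)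
    (\<lambda>t. \<omega>) (\<lambda>t. - \<omega> * a t - 2 * a2 t / \<omega>)"
proof -
  have N: "expand1 (\<lambda>\<rho> t. (\<eta>1 \<rho> t \<bullet> \<eta>1 \<rho> t) * (\<eta>2 \<rho> t \<bullet> \<eta>2 \<rho> t) - (\<eta>1 \<rho> t \<bullet> \<eta>2 \<rho> t) * (\<eta>1 \<rho> t \<bullet> \<eta>2 \<rho> t))
     (\<lambda>t. \<omega>\<^sup>2 * \<omega> ^ 4 - 0 * 0)
     (\<lambda>t. (\<omega>\<^sup>2 * (2 * \<omega>\<^sup>2 * (\<omega>\<^sup>2 * a t - a2 t)) + 2 * \<omega>\<^sup>2 * a t * \<omega> ^ 4) - (0 * (\<omega>\<^sup>2 * a1 t) + \<omega>\<^sup>2 * a1 t * 0))"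
    by (intro expand1_diff expand1_mult expand1_speed_sq expand1_accel_sq expand1_speed_accel)
  have i: "expand1 (\<lambda>\<rho> t. inverse (sp \<rho> t)) (\<lambda>t. inverse \<omega>) (\<lambda>t. - (\<omega> * a t) / \<omega>\<^sup>2)"
    by (rule expand1_inverse[OF expand1_sp omega_pos sp_ge])
  note i2 = expand1_mult[OF i i]
  note i5 = expand1_mult[OF expand1_mult[OF i2 i2] i]
  show ?thesis
    by (rule expand1_cong[OF expand1_mult[OF N i5]])
      (use omega_pos in \<open>simp_all add: field_simps power_numeral_reduce\<close>)
qed

end

section \<open>Arc length parametrization\<close>

text \<open>\<open>S \<rho>\<close> is arc length divided by total length, \<open>T \<rho>\<close>
  its inverse. No condition links different \<rho>, so they can be chosen one parameter at a
  time.\<close>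

locale thin_braid_arclength = thin_braid +
  fixes S T :: "real \<Rightarrow> real \<Rightarrow> real"
  assumes S_deriv: "\<And>\<rho> t. \<rho> \<in> {0..1} \<Longrightarrow> (S \<rho> has_vector_derivative sp \<rho> t / len \<rho>) (at t)"
    and S_0: "\<And>\<rho>. \<rho> \<in> {0..1} \<Longrightarrow> S \<rho> 0 = 0" and S_1: "\<And>\<rho>. \<rho> \<in> {0..1} \<Longrightarrow> S \<rho> 1 = 1"
    and S_per: "\<And>\<rho> t. \<rho> \<in> {0..1} \<Longrightarrow> S \<rho> (t + 1) = S \<rho> t + 1"
    and ST: "\<And>\<rho> t. \<rho> \<in> {0..1} \<Longrightarrow> S \<rho> (T \<rho> t) = t"
    and TS: "\<And>\<rho> t. \<rho> \<in> {0..1} \<Longrightarrow> T \<rho> (S \<rho> t) = t"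
    and T_deriv: "\<And>\<rho> t. \<rho> \<in> {0..1} \<Longrightarrow> (T \<rho> has_vector_derivative len \<rho> * inverse (sp \<rho> (T \<rho> t))) (at t)"

lemma (in thin_braid) exists_arclength: "\<exists>S T. thin_braid_arclength n a b S T"
proof -
  have "\<forall>\<rho>\<in>{0..1}. \<exists>S T. (\<forall>t. (S has_vector_derivative sp \<rho> t / len \<rho>) (at t)) \<and> S 0 = 0 \<and> S 1 = (1::real)
    \<and> (\<forall>t. S (t + 1) = S t + 1) \<and> (\<forall>t. S (T t) = t) \<and> (\<forall>t. T (S t) = t)
    \<and> (\<forall>t. (T has_vector_derivative len \<rho> * inverse (sp \<rho> (T t))) (at t))"
  proof
    fix \<rho> :: real assume r: "\<rho> \<in> {0..1}"
    have l: "0 < len \<rho>" using len_ge[OF r] omega_pos by linarith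
    have "continuous_on UNIV (\<lambda>t. sp \<rho> t / len \<rho>)"
      using l by (intro continuous_intros sp_continuous[OF r]) auto
    moreover have "0 < \<omega> / len \<rho>" using omega_pos l by simp
    moreover have "\<omega> / len \<rho> \<le> sp \<rho> t / len \<rho>" for t using sp_ge[OF r] l by (simp add: divide_right_mono)
    moreover have "periodic1 (\<lambda>t. sp \<rho> t / len \<rho>)" by (simp add: periodic1_def sp_periodic)
    moreover have "(LINT t:{0..1}|lborel. sp \<rho> t / len \<rho>) = 1" using l by (simp flip: len_def)
    ultimately obtain S T where "\<And>t. (S has_vector_derivative sp \<rho> t / len \<rho>) (at t)" "S 0 = 0" "S 1 = (1::real)"
      "\<And>t. S (t + 1) = S t + 1" "\<And>t. S (T t) = t" "\<And>t. T (S t) = t"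
      "\<And>t. (T has_vector_derivative inverse (sp \<rho> (T t) / len \<rho>)) (at t)"
      by (rule periodic_unit_reparametrization) blast
    then show "\<exists>S T. (\<forall>t. (S has_vector_derivative sp \<rho> t / len \<rho>) (at t)) \<and> S 0 = 0 \<and> S 1 = (1::real)
    \<and> (\<forall>t. S (t + 1) = S t + 1) \<and> (\<forall>t. S (T t) = t) \<and> (\<forall>t. T (S t) = t)
    \<and> (\<forall>t. (T has_vector_derivative len \<rho> * inverse (sp \<rho> (T t))) (at t))"
      by (auto simp: divide_inverse mult.commute)
  qed
  then obtain S T where "\<And>\<rho>. \<rho> \<in> {0..1} \<Longrightarrow> (\<forall>t. (S \<rho> has_vector_derivative sp \<rho> t / len \<rho>) (at t)) \<and>
    S \<rho> 0 = 0 \<and> S \<rho> 1 = 1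
    \<and> (\<forall>t. S \<rho> (t + 1) = S \<rho> t + 1) \<and> (\<forall>t. S \<rho> (T \<rho> t) = t) \<and> (\<forall>t. T \<rho> (S \<rho> t) = t)
    \<and> (\<forall>t. (T \<rho> has_vector_derivative len \<rho> * inverse (sp \<rho> (T \<rho> t))) (at t))"
    by metis
  then have "thin_braid_arclength n a b S T" by unfold_locales auto
  then show ?thesis by blast
qed

context thin_braid_arclength
begin

text \<open>\<open>W k \<rho>\<close> is the \<open>k\<close>-th arc length derivative as a function of the old parameter.\<close>

primrec W :: "nat \<Rightarrow> real \<Rightarrow> real \<Rightarrow> real ^ 3" where
  "W 0 = (\<lambda>\<rho> t. inverse (len \<rho>) *\<^sub>R (\<eta> \<rho> t - \<eta> \<rho> 0))"
| "W (Suc k) = (\<lambda>\<rho> t. (len \<rho> * inverse (sp \<rho> t)) *\<^sub>R vector_derivative (W k \<rho>) (at t))"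

declare W.simps(2) [simp del]

definition v :: "real \<Rightarrow> real \<Rightarrow> real ^ 3" where
  "v \<rho> t = W 0 \<rho> (T \<rho> t)"

lemma smooth_family_inverse_sp: "smooth_family (\<lambda>\<rho> t. inverse (sp \<rho> t))"
  by (rule smooth_family_inverse[OF smooth_family_sp omega_pos sp_ge])

lemma smooth_family_inverse_len: "smooth_family (\<lambda>\<rho> t. inverse (len \<rho>))"
  by (rule smooth_family_inverse[OF smooth_family_len omega_pos len_ge])

text \<open>Only sums, products, reciprocals and t-derivatives of known families occur, since
  \<open>T\<close> is kept outside of \<open>W\<close>.\<close>

lemma smooth_family_W: "smooth_family (W k)"
proof (induction k)
  case 0
  have "Lip_family (\<lambda>\<rho> t. \<eta> \<rho> 0)"
    using smooth_family_imp_Lip[OF smooth_family_eta] unfolding Lip_family_def by blast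
  then have "smooth_family (\<lambda>\<rho> t. inverse (len \<rho>) *\<^sub>R (\<eta> \<rho> t - \<eta> \<rho> 0))"
    by (intro smooth_family_scaleR smooth_family_diff smooth_family_inverse_len smooth_family_eta
        smooth_family_of_Lip)
  then show ?case by simp
next
  case (Suc k)
  have "smooth_family (\<lambda>\<rho> t. (len \<rho> * inverse (sp \<rho> t)) *\<^sub>R vector_derivative (W k \<rho>) (at t))"
    by (intro smooth_family_scaleR smooth_family_mult smooth_family_len smooth_family_inverse_sp
        smooth_family_deriv[OF Suc])
  then show ?case by (simp add: W.simps(2))
qed

text \<open>The derivative of \<open>T\<close> is exactly the factor in the recursion for
  \<open>W\<close>.\<close>

lemma W_T_deriv:
  assumes "\<rho> \<in> {0..1}"
  shows "((\<lambda>t. W k \<rho> (T \<rho> t)) has_vector_derivative W (Suc k) \<rho> (T \<rho> t)) (at t)"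
  using vector_diff_chain_at[OF T_deriv[OF assms] smooth_family_has_vderiv[OF smooth_family_W assms]]
  by (simp add: comp_def W.simps(2))

lemma nth_vderiv_v:
  assumes "\<rho> \<in> {0..1}"
  shows "nth_vderiv k (v \<rho>) = (\<lambda>t. W k \<rho> (T \<rho> t))"
proof (induction k)
  case 0
  then show ?case by (simp add: nth_vderiv_0 v_def fun_eq_iff)
next
  case (Suc k)
  then show ?case
    unfolding nth_vderiv_Suc using vector_derivative_at[OF W_T_deriv[OF assms]] by simp
qed

lemma smooth_v: "\<rho> \<in> {0..1} \<Longrightarrow> smooth_fun (v \<rho>)"
  unfolding smooth_fun_def by (simp add: nth_vderiv_v differentiableI_vector[OF W_T_deriv])

lemma v_has_deriv:
  assumes "\<rho> \<in> {0..1}"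
  shows "(v \<rho> has_vector_derivative W 1 \<rho> (T \<rho> t)) (at t)"
    "((\<lambda>t. W 1 \<rho> (T \<rho> t)) has_vector_derivative W 2 \<rho> (T \<rho> t)) (at t)"
  using W_T_deriv[OF assms, of 0 t] W_T_deriv[OF assms, of 1 t]
  unfolding v_def[abs_def] One_nat_def numeral_2_eq_2 by blast+

lemma T_plus_1: "\<rho> \<in> {0..1} \<Longrightarrow> T \<rho> (t + 1) = T \<rho> t + 1"
  using S_per ST TS by metis

lemma T_0: "\<rho> \<in> {0..1} \<Longrightarrow> T \<rho> 0 = 0"
  using S_0 TS by metis

lemma periodic_v: "\<rho> \<in> {0..1} \<Longrightarrow> periodic1 (v \<rho>)"
  by (simp add: periodic1_def v_def T_plus_1 eta_periodic)

lemma v_0: "\<rho> \<in> {0..1} \<Longrightarrow> v \<rho> 0 = 0"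
  by (simp add: v_def T_0)

lemma W_1:
  assumes "\<rho> \<in> {0..1}"
  shows "W 1 \<rho> t = inverse (sp \<rho> t) *\<^sub>R \<eta>1 \<rho> t"
proof -
  have "(W 0 \<rho> has_vector_derivative inverse (len \<rho>) *\<^sub>R \<eta>1 \<rho> t) (at t)"
    using eta_deriv by (auto intro!: derivative_eq_intros)
  from vector_derivative_at[OF this] show ?thesis
    using len_ge[OF assms] omega_pos by (simp add: W.simps(2))
qed

lemma unit_v:
  assumes "\<rho> \<in> {0..1}"
  shows "norm (W 1 \<rho> t) = 1"
  unfolding W_1[OF assms] using sp_ge[OF assms, of t] omega_pos by (simp add: norm_eta1)

lemma range_v:
  assumes "\<rho> \<in> {0..1}"
  shows "range (v \<rho>) = (\<lambda>x. inverse (len \<rho>) *\<^sub>R x + (- inverse (len \<rho>) *\<^sub>R \<eta> \<rho> 0)) ` range (\<eta> \<rho>)"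
proof -
  have "surj (T \<rho>)" using TS[OF assms] by (metis surjI)
  moreover have "range (v \<rho>) = W 0 \<rho> ` range (T \<rho>)" by (simp add: v_def[abs_def] image_image)
  ultimately show ?thesis by (simp add: image_image scaleR_diff_right)
qed

section \<open>Convergence to the covered circle\<close>

text \<open>The derivative of S - id is sp / len - 1, which is O(\<rho>) because at \<rho> = 0 speed
  and length are both \<omega>. The mean value inequality within one period and periodicity of S -
  id make the bound uniform on the line.\<close>

lemma S_near_id:
  obtains B where "0 < B" "\<And>\<rho> t. \<rho> \<in> {0..1} \<Longrightarrow> \<bar>S \<rho> t - t\<bar> \<le> B * \<rho>"
proof -
  have "smooth_family (\<lambda>\<rho> t. sp \<rho> t * inverse (len \<rho>))"
    by (intro smooth_family_mult smooth_family_sp smooth_family_inverse_len)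
  from smooth_family_imp_Lip[OF this] obtain B where B: "0 < B"
    "\<And>\<rho> t. \<rho> \<in> {0..1} \<Longrightarrow> norm (sp \<rho> t * inverse (len \<rho>) - sp 0 t * inverse (len 0)) \<le> B * \<rho>"
    by (rule Lip_familyE) blast
  show ?thesis
  proof (rule that[OF B(1)])
    fix \<rho> t :: real assume r: "\<rho> \<in> {0..1}"
    have d: "((\<lambda>t. S \<rho> t - t) has_vector_derivative sp \<rho> t / len \<rho> - 1) (at t)" for t
      using S_deriv[OF r] unfolding has_real_derivative_iff_has_vector_derivative[symmetric]
      by (auto intro!: derivative_eq_intros)
    have bd: "norm (sp \<rho> t / len \<rho> - 1) \<le> B * \<rho>" for t
      using B(2)[OF r, of t] omega_pos by (simp add: sp_0 len_0 divide_inverse)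
    have "\<bar>S \<rho> (frac t) - frac t\<bar> \<le> B * \<rho> * \<bar>frac t - 0\<bar>"
      using vderiv_bound[OF d bd, of 0 "frac t"] S_0[OF r] by simp
    also have "\<dots> \<le> B * \<rho> * 1" using B(1) r frac_lt_1[of t] by (intro mult_left_mono) auto
    finally have "\<bar>S \<rho> (frac t) - frac t\<bar> \<le> B * \<rho>" by simp
    moreover have "periodic1 (\<lambda>t. S \<rho> t - t)" using S_per[OF r] by (simp add: periodic1_def)
    then have "S \<rho> t - t = S \<rho> (frac t) - frac t" by (rule periodic1_frac)
    ultimately show "\<bar>S \<rho> t - t\<bar> \<le> B * \<rho>" by simp
  qed
qed

text \<open>The bound for \<open>S\<close> at the point \<open>T \<rho> t\<close> is the same bound
  for \<open>T\<close>.\<close>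

lemma T_near_id:
  obtains B where "0 < B" "\<And>\<rho> t. \<rho> \<in> {0..1} \<Longrightarrow> \<bar>T \<rho> t - t\<bar> \<le> B * \<rho>"
proof -
  obtain B where "0 < B" and B: "\<And>\<rho> t. \<rho> \<in> {0..1} \<Longrightarrow> \<bar>S \<rho> t - t\<bar> \<le> B * \<rho>" by (rule S_near_id) blast
  moreover have "\<bar>T \<rho> t - t\<bar> \<le> B * \<rho>" if "\<rho> \<in> {0..1}" for \<rho> t
    using B[OF that, of "T \<rho> t"] ST[OF that, of t] by (simp add: abs_minus_commute)
  ultimately show ?thesis using that by blast
qed

lemma v_at_0: "v 0 = covered_circle n"
proof
  fix t
  obtain B where "\<And>\<rho> t. \<rho> \<in> {0..1} \<Longrightarrow> \<bar>T \<rho> t - t\<bar> \<le> B * \<rho>" by (rule T_near_id) blast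
  from this[of 0 t] have "T 0 t = t" by simp
  moreover have "\<eta> 0 x = e_r (\<omega> * x)" for x
    by (simp add: \<eta>_def vec_eq_iff forall_3 cyl_nth) (simp add: e_r_def vector_3)
  ultimately show "v 0 t = covered_circle n t"
    by (simp add: v_def covered_circle_def len_0 inverse_eq_divide) (simp add: \<omega>_def)
qed

text \<open>The difference is split at \<open>W k 0 (T \<rho> t)\<close>: changing the family
  parameter costs A \<rho>, and changing the point costs D B \<rho> by the mean value
  inequality.\<close>

lemma v_smooth_convergence:
  "uniform_limit UNIV (\<lambda>\<rho>. nth_vderiv k (v \<rho>)) (nth_vderiv k (covered_circle n)) (at_right 0)"
proof -
  obtain A where A: "0 < A" "\<And>\<rho> t. \<rho> \<in> {0..1} \<Longrightarrow> norm (W k \<rho> t - W k 0 t) \<le> A * \<rho>"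
    by (rule Lip_familyE[OF smooth_family_imp_Lip[OF smooth_family_W]]) blast
  obtain D where D: "0 < D" "\<And>\<rho> t. \<rho> \<in> {0..1} \<Longrightarrow> norm (vector_derivative (W k \<rho>) (at t)) \<le> D"
    by (rule Lip_familyE[OF smooth_family_imp_Lip[OF smooth_family_deriv[OF smooth_family_W]]]) blast
  obtain B where B: "0 < B" "\<And>\<rho> t. \<rho> \<in> {0..1} \<Longrightarrow> \<bar>T \<rho> t - t\<bar> \<le> B * \<rho>" by (rule T_near_id) blast
  have z: "(0::real) \<in> {0..1}" by simp
  have T0: "T 0 t = t" for t using B(2)[OF z, of t] by simp
  show ?thesis
  proof (rule family_uniform_limit)
    fix \<rho> t :: real assume "\<rho> \<in> {0<..1}"
    then have r: "\<rho> \<in> {0..1}" by simp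
    have "norm (W k 0 (T \<rho> t) - W k 0 t) \<le> D * \<bar>T \<rho> t - t\<bar>"
      by (rule vderiv_bound[OF smooth_family_has_vderiv[OF smooth_family_W z] D(2)[OF z]])
    also have "\<dots> \<le> D * (B * \<rho>)" using D(1) B(2)[OF r] by (intro mult_left_mono) auto
    finally have "norm (W k \<rho> (T \<rho> t) - W k 0 t) \<le> A * \<rho> + D * (B * \<rho>)"
      using A(2)[OF r, of "T \<rho> t"] norm_triangle_mono[of "W k \<rho> (T \<rho> t) - W k 0 (T \<rho> t)" _ "W k 0 (T \<rho> t) - W k 0 t"]
      by simp
    then show "dist (nth_vderiv k (v \<rho>) t) (nth_vderiv k (covered_circle n) t) \<le> (A + D * B) * \<rho>"
      unfolding v_at_0[symmetric] nth_vderiv_v[OF r] nth_vderiv_v[OF z] T0 dist_norm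
      by (simp add: algebra_simps)
  qed
qed

section \<open>Energy of the unit speed curves\<close>

lemma curve_length_v: "\<rho> \<in> {0..1} \<Longrightarrow> curve_length (v \<rho>) = 1"
  unfolding curve_length_def nth_vderiv_v by (simp add: unit_v[unfolded One_nat_def] LINT_const)

text \<open>Differentiating the reciprocal speed produces a multiple of \<open>\<eta>1\<close>,
  which the cross product with \<open>W 1\<close> removes, so i' never has to be computed.\<close>

lemma cross_W:
  assumes r: "\<rho> \<in> {0..1}"
  shows "(norm (cross3 (W 1 \<rho> t) (W 2 \<rho> t)))\<^sup>2 = (len \<rho>)\<^sup>2 * inverse (sp \<rho> t) ^ 6 *
     ((\<eta>1 \<rho> t \<bullet> \<eta>1 \<rho> t) * (\<eta>2 \<rho> t \<bullet> \<eta>2 \<rho> t) - (\<eta>1 \<rho> t \<bullet> \<eta>2 \<rho> t)\<^sup>2)"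
proof -
  define i where "i = inverse (sp \<rho> t)"
  define i' where "i' = vector_derivative (\<lambda>t. inverse (sp \<rho> t)) (at t)"
  have "((\<lambda>t. inverse (sp \<rho> t)) has_vector_derivative i') (at t)"
    unfolding i'_def by (rule smooth_family_has_vderiv[OF smooth_family_inverse_sp r])
  then have "((\<lambda>t. inverse (sp \<rho> t) *\<^sub>R \<eta>1 \<rho> t) has_vector_derivative i *\<^sub>R \<eta>2 \<rho> t + i' *\<^sub>R \<eta>1 \<rho> t) (at t)"
    unfolding i_def by (intro bounded_bilinear.has_vector_derivative[OF bounded_bilinear_scaleR] eta1_deriv)
  moreover have "W 1 \<rho> = (\<lambda>t. inverse (sp \<rho> t) *\<^sub>R \<eta>1 \<rho> t)" using W_1[OF r] by blast
  ultimately have "vector_derivative (W 1 \<rho>) (at t) = i *\<^sub>R \<eta>2 \<rho> t + i' *\<^sub>R \<eta>1 \<rho> t"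
    by (simp only: vector_derivative_at)
  then have "W 2 \<rho> t = (len \<rho> * i) *\<^sub>R (i *\<^sub>R \<eta>2 \<rho> t + i' *\<^sub>R \<eta>1 \<rho> t)"
    unfolding numeral_2_eq_2 W.simps(2) One_nat_def i_def by simp
  then have "cross3 (W 1 \<rho> t) (W 2 \<rho> t) = (len \<rho> * i ^ 3) *\<^sub>R cross3 (\<eta>1 \<rho> t) (\<eta>2 \<rho> t)"
    unfolding W_1[OF r] i_def[symmetric]
    by (simp add: cross_add_right cross_mult_left cross_mult_right power3_eq_cube algebra_simps)
  then have "(norm (cross3 (W 1 \<rho> t) (W 2 \<rho> t)))\<^sup>2 = (len \<rho>)\<^sup>2 * i ^ 6 * (norm (cross3 (\<eta>1 \<rho> t) (\<eta>2 \<rho> t)))\<^sup>2"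
    by (simp add: power_mult_distrib flip: power_mult)
  moreover have "(norm (cross3 (\<eta>1 \<rho> t) (\<eta>2 \<rho> t)))\<^sup>2 =
      (\<eta>1 \<rho> t \<bullet> \<eta>1 \<rho> t) * (\<eta>2 \<rho> t \<bullet> \<eta>2 \<rho> t) - (\<eta>1 \<rho> t \<bullet> \<eta>2 \<rho> t)\<^sup>2"
    by (subst norm_cross) (simp only: power2_norm_eq_inner)
  ultimately show ?thesis unfolding i_def by (simp only:)
qed

text \<open>Length 1 and unit speed leave only the squared norm of the cross product. Substituting
  with \<open>S \<rho>\<close> returns to the old parameter, where sp / len times len^2 sp^-6 gives
  len sp^-5: by scale invariance this is the energy of the squeezed braid itself.\<close>

lemma E_bar_v:
  assumes r: "\<rho> \<in> {0..1}"
  shows "E_bar (v \<rho>) = len \<rho> * (LINT t:{0..1}|lborel.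
    ((\<eta>1 \<rho> t \<bullet> \<eta>1 \<rho> t) * (\<eta>2 \<rho> t \<bullet> \<eta>2 \<rho> t) - (\<eta>1 \<rho> t \<bullet> \<eta>2 \<rho> t)\<^sup>2) * inverse (sp \<rho> t) ^ 5)"
proof -
  let ?f = "\<lambda>t. (norm (cross3 (W 1 \<rho> t) (W 2 \<rho> t)))\<^sup>2"
  have l: "0 < len \<rho>" using len_ge[OF r] omega_pos by linarith
  have cT: "continuous_on UNIV (T \<rho>)"
    using has_vector_derivative_continuous[OF T_deriv[OF r]] by (simp add: continuous_at_imp_continuous_on)
  have "continuous_on UNIV ?f"
    using smooth_family_continuous[OF smooth_family_W r] by (intro continuous_intros continuous_on_cross)
  then have cf: "continuous_on UNIV (\<lambda>t. ?f (T \<rho> t))" by (rule continuous_on_compose2[OF _ cT]) simp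
  have "E_bar (v \<rho>) = (LINT t:{0..1}|lborel. ?f (T \<rho> t))"
    unfolding E_bar_def curve_length_v[OF r] E_bend_def nth_vderiv_v[OF r] unit_v[OF r] by simp
  also have "\<dots> = (LINT t:{0..1}|lborel. (sp \<rho> t / len \<rho>) * ?f (T \<rho> (S \<rho> t)))"
    using l by (intro integral_substitution_unit cf S_deriv[OF r] S_0[OF r] S_1[OF r] continuous_intros sp_continuous[OF r]) auto
  also have "\<dots> = (LINT t:{0..1}|lborel. len \<rho> * (((\<eta>1 \<rho> t \<bullet> \<eta>1 \<rho> t) * (\<eta>2 \<rho> t \<bullet> \<eta>2 \<rho> t) - (\<eta>1 \<rho> t \<bullet> \<eta>2 \<rho> t)\<^sup>2) * inverse (sp \<rho> t) ^ 5))"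
  proof (rule arg_cong[of _ _ "\<lambda>f. set_lebesgue_integral lborel {0..1} f"], rule ext)
    fix t
    have "0 < sp \<rho> t" using sp_ge[OF r, of t] omega_pos by linarith
    then have "sp \<rho> t / len \<rho> * ((len \<rho>)\<^sup>2 * inverse (sp \<rho> t) ^ 6 * x) = len \<rho> * (x * inverse (sp \<rho> t) ^ 5)" for x
      using l by (simp add: field_simps power_numeral_reduce)
    then show "sp \<rho> t / len \<rho> * ?f (T \<rho> (S \<rho> t)) = len \<rho> * (((\<eta>1 \<rho> t \<bullet> \<eta>1 \<rho> t) * (\<eta>2 \<rho> t \<bullet> \<eta>2 \<rho> t) - (\<eta>1 \<rho> t \<bullet> \<eta>2 \<rho> t)\<^sup>2) * inverse (sp \<rho> t) ^ 5)"
      unfolding TS[OF r] cross_W[OF r] .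
  qed
  finally show ?thesis by simp
qed

lemma E_bar_v_estimate:
  obtains C where "0 < C" "\<And>\<rho>. \<rho> \<in> {0..1} \<Longrightarrow> \<bar>E_bar (v \<rho>) - \<omega>\<^sup>2\<bar> \<le> C * \<rho>\<^sup>2"
proof -
  let ?I = "\<lambda>\<rho> t. ((\<eta>1 \<rho> t \<bullet> \<eta>1 \<rho> t) * (\<eta>2 \<rho> t \<bullet> \<eta>2 \<rho> t) - (\<eta>1 \<rho> t \<bullet> \<eta>2 \<rho> t)\<^sup>2) * inverse (sp \<rho> t) ^ 5"
  let ?a = "LINT t:{0..1}|lborel. a t"
  have c1: "continuous_on UNIV (\<eta>1 \<rho>)" for \<rho>
    using has_vector_derivative_continuous[OF eta1_deriv] by (simp add: continuous_at_imp_continuous_on)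
  have c2: "continuous_on UNIV (\<eta>2 \<rho>)" if "\<rho> \<in> {0..1}" for \<rho>
    using smooth_family_continuous[OF smooth_family_deriv[OF smooth_family_eta1] that] vector_derivative_at[OF eta1_deriv]
    by simp
  have cI: "continuous_on UNIV (?I \<rho>)" if "\<rho> \<in> {0..1}" for \<rho>
    by (intro continuous_intros c1 c2[OF that] smooth_family_continuous[OF smooth_family_inverse_sp that])
  have a2: "(LINT t:{0..1}|lborel. a2 t) = 0"
    using integral_vderiv_Icc[of 0 1 a1 a2] derivs(2) conts(3) pers(2)[of 0]
    by (simp add: has_real_derivative_iff_has_vector_derivative)
  have I1: "(LINT t:{0..1}|lborel. - \<omega> * a t - 2 * a2 t / \<omega>) = - \<omega> * ?a"
  proof -
    have "(LINT t:{0..1}|lborel. (- \<omega>) * a t - (2 / \<omega>) * a2 t)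
        = (LINT t:{0..1}|lborel. (- \<omega>) * a t) - (LINT t:{0..1}|lborel. (2 / \<omega>) * a2 t)"
      by (intro set_integral_diff(2) set_integrable_Icc continuous_on_mult continuous_on_const conts)
    also have "\<dots> = (- \<omega>) * ?a - (2 / \<omega>) * (LINT t:{0..1}|lborel. a2 t)"
      by (simp only: set_integral_mult_right)
    finally have "(LINT t:{0..1}|lborel. (- \<omega>) * a t - (2 / \<omega>) * a2 t) = (- \<omega>) * ?a"
      by (simp add: a2)
    then show ?thesis by (simp add: times_divide_eq_left)
  qed
  have "expand1 (\<lambda>\<rho> _. LINT t:{0..1}|lborel. ?I \<rho> t) (\<lambda>_. LINT t:{0..1::real}|lborel. \<omega>)
      (\<lambda>_. LINT t:{0..1}|lborel. - \<omega> * a t - 2 * a2 t / \<omega>)"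
    using omega_pos
    by (intro expand1_integral[OF eta_integrand_expansion cI] continuous_intros conts) auto
  then have "expand1 (\<lambda>\<rho> _. LINT t:{0..1}|lborel. ?I \<rho> t) (\<lambda>_. \<omega>) (\<lambda>_. - \<omega> * ?a)"
    unfolding I1 LINT_const .
  from expand1_mult[OF expand1_len this]
  have "expand1 (\<lambda>\<rho> _. len \<rho> * (LINT t:{0..1}|lborel. ?I \<rho> t)) (\<lambda>_. \<omega> * \<omega>) (\<lambda>_. 0)"
    by (simp add: algebra_simps)
  then obtain C where "0 < C" "\<And>\<rho>. \<rho> \<in> {0..1} \<Longrightarrow>
      \<bar>len \<rho> * (LINT t:{0..1}|lborel. ?I \<rho> t) - \<omega> * \<omega> - \<rho> * 0\<bar> \<le> C * \<rho>\<^sup>2"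
    by (rule expand1E) blast
  then show ?thesis using that by (simp add: E_bar_v power2_eq_square)
qed

end

section \<open>Thickness and conclusion\<close>

context thin_braid_arclength
begin

text \<open>The speed is bounded uniformly in \<rho>, so \<open>T\<close> has slope at least
  \<omega> / B: points far apart in arc length stay apart in the old parameter.\<close>

lemma T_expansion:
  obtains \<mu> where "0 < \<mu>" "\<And>\<rho> s t. \<rho> \<in> {0..1} \<Longrightarrow> s \<le> t \<Longrightarrow> \<mu> * (t - s) \<le> T \<rho> t - T \<rho> s"
proof -
  obtain B where B: "0 < B" "\<And>\<rho> t. \<rho> \<in> {0..1} \<Longrightarrow> norm (sp \<rho> t) \<le> B"
    by (rule Lip_familyE[OF smooth_family_imp_Lip[OF smooth_family_sp]]) blast
  have "\<omega> / B * (t - s) \<le> T \<rho> t - T \<rho> s" if r: "\<rho> \<in> {0..1}" and st: "s \<le> t" for \<rho> s t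
  proof -
    have "T \<rho> s - \<omega> / B * s \<le> T \<rho> t - \<omega> / B * t"
    proof (rule DERIV_nonneg_imp_nondecreasing[OF st])
      fix x
      have sp: "0 < sp \<rho> (T \<rho> x)" using sp_ge[OF r, of "T \<rho> x"] omega_pos by linarith
      have "((\<lambda>x. T \<rho> x - \<omega> / B * x) has_real_derivative len \<rho> * inverse (sp \<rho> (T \<rho> x)) - \<omega> / B) (at x)"
        using T_deriv[OF r, of x] B(1) unfolding has_real_derivative_iff_has_vector_derivative[symmetric]
        by (auto intro!: derivative_eq_intros)
      moreover have "\<omega> / B \<le> len \<rho> / sp \<rho> (T \<rho> x)"
        using len_ge[OF r] B(2)[OF r, of "T \<rho> x"] sp omega_pos by (intro frac_le) auto
      ultimately show "\<exists>y. ((\<lambda>x. T \<rho> x - \<omega> / B * x) has_real_derivative y) (at x) \<and> 0 \<le> y"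
        by (auto simp: divide_inverse)
    qed
    then show ?thesis by (simp add: right_diff_distrib)
  qed
  then show ?thesis using that[of "\<omega> / B"] B(1) omega_pos by simp
qed

lemma v_far_apart:
  assumes "0 < \<epsilon>"
  obtains c where "0 < c" "\<And>\<rho> s t. \<rho> \<in> {0..1} \<Longrightarrow> \<epsilon> \<le> \<bar>t - s\<bar> \<Longrightarrow> \<bar>t - s\<bar> \<le> 1/2 \<Longrightarrow>
    c * \<rho> \<le> norm (v \<rho> t - v \<rho> s)"
proof -
  obtain c where c: "0 < c" "\<And>\<rho> s t. \<rho> \<in> {0..1} \<Longrightarrow> \<bar>t - s\<bar> \<le> 1 \<Longrightarrow>
    c * min \<rho> (min \<bar>t - s\<bar> (1 - \<bar>t - s\<bar>)) \<le> norm (\<eta> \<rho> t - \<eta> \<rho> s)"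
    by (rule chord_bound) blast
  obtain \<mu> where \<mu>: "0 < \<mu>" "\<And>\<rho> s t. \<rho> \<in> {0..1} \<Longrightarrow> s \<le> t \<Longrightarrow> \<mu> * (t - s) \<le> T \<rho> t - T \<rho> s"
    by (rule T_expansion) blast
  obtain B where B: "0 < B" "\<And>\<rho> t. \<rho> \<in> {0..1} \<Longrightarrow> norm (len \<rho>) \<le> B"
    by (rule Lip_familyE[OF smooth_family_imp_Lip[OF smooth_family_len]]) blast
  \<comment> \<open>The entries bound the two arcs between the points: \<mu> \<epsilon> the arc from
    s to t, and \<mu>/2 the complementary arc, which has arc length at least 1/2.\<close>
  define d where "d = min (\<mu> * \<epsilon>) (\<mu> / 2)"
  have d: "0 < d" using \<mu>(1) assms by (simp add: d_def)
  have ordered: "inverse B * (c * min 1 d) * \<rho> \<le> norm (v \<rho> t - v \<rho> s)"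
    if r: "\<rho> \<in> {0..1}" and st: "s \<le> t" "\<epsilon> \<le> t - s" "t - s \<le> 1/2" for \<rho> s t
  proof -
    have "\<mu> * \<epsilon> \<le> \<mu> * (t - s)" using \<mu>(1) st by simp
    then have lo: "d \<le> T \<rho> t - T \<rho> s" using \<mu>(2)[OF r st(1)] by (simp add: d_def min_def)
    have "\<mu> * (1/2) \<le> \<mu> * ((s + 1) - t)" using \<mu>(1) st(3) by (intro mult_left_mono) auto
    also have "\<dots> \<le> T \<rho> (s + 1) - T \<rho> t" using \<mu>(2)[OF r] st by simp
    finally have hi: "d \<le> 1 - (T \<rho> t - T \<rho> s)" unfolding T_plus_1[OF r] d_def by simp
    have "c * min \<rho> d \<le> c * min \<rho> (min \<bar>T \<rho> t - T \<rho> s\<bar> (1 - \<bar>T \<rho> t - T \<rho> s\<bar>))"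
      using lo hi d c(1) by (intro mult_left_mono) auto
    also have "\<dots> \<le> norm (\<eta> \<rho> (T \<rho> t) - \<eta> \<rho> (T \<rho> s))" using lo hi d by (intro c(2)[OF r]) auto
    finally have "c * min 1 d * \<rho> \<le> norm (\<eta> \<rho> (T \<rho> t) - \<eta> \<rho> (T \<rho> s))"
      using r d c(1) by (intro le_min_scale) auto
    moreover have "inverse B \<le> inverse (len \<rho>)"
      using B(2)[OF r] len_ge[OF r] omega_pos by (intro le_imp_inverse_le) auto
    ultimately have "inverse B * (c * min 1 d * \<rho>) \<le> inverse (len \<rho>) * norm (\<eta> \<rho> (T \<rho> t) - \<eta> \<rho> (T \<rho> s))"
      using B(1) c(1) d r len_ge[OF r] omega_pos by (intro mult_mono) auto
    also have "\<dots> = norm (inverse (len \<rho>) *\<^sub>R (\<eta> \<rho> (T \<rho> t) - \<eta> \<rho> (T \<rho> s)))"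
      using len_ge[OF r] omega_pos by simp
    also have "inverse (len \<rho>) *\<^sub>R (\<eta> \<rho> (T \<rho> t) - \<eta> \<rho> (T \<rho> s)) = v \<rho> t - v \<rho> s"
      by (simp add: v_def flip: scaleR_diff_right)
    finally show ?thesis by (simp add: mult.assoc)
  qed
  show ?thesis
  proof (rule that[of "inverse B * (c * min 1 d)"])
    show "0 < inverse B * (c * min 1 d)" using B(1) c(1) d by simp
    fix \<rho> s t :: real assume r: "\<rho> \<in> {0..1}" and st: "\<epsilon> \<le> \<bar>t - s\<bar>" "\<bar>t - s\<bar> \<le> 1/2"
    show "inverse B * (c * min 1 d) * \<rho> \<le> norm (v \<rho> t - v \<rho> s)"
    proof (cases "s \<le> t")
      case True
      then show ?thesis using ordered[OF r True] st by simp
    next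
      case False
      then have ts: "t \<le> s" by simp
      show ?thesis using ordered[OF r ts] st ts by (simp add: norm_minus_commute)
    qed
  qed
qed

text \<open>\<open>K\<close> bounds the second derivative uniformly in \<rho>, so the near-diagonal
  bound is a constant; since \<rho> \<le> 1, its multiple by \<rho> is still a bound, and both
  regimes merge into one estimate linear in \<rho>.\<close>

lemma v_thickness:
  obtains c where "0 < c"
    "\<And>\<rho>. \<rho> \<in> {0<..1} \<Longrightarrow> inj_on (v \<rho>) {0..<1} \<and> ereal (c * \<rho>) \<le> Thi (v \<rho>)"
proof -
  obtain K where K: "0 < K" "\<And>\<rho> t. \<rho> \<in> {0..1} \<Longrightarrow> norm (W 2 \<rho> t) \<le> K"
    by (rule Lip_familyE[OF smooth_family_imp_Lip[OF smooth_family_W]]) blast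
  have "0 < 1 / (2 * K)" using K(1) by simp
  then obtain c where c: "0 < c" "\<And>\<rho> s t. \<rho> \<in> {0..1} \<Longrightarrow> 1 / (2 * K) \<le> \<bar>t - s\<bar> \<Longrightarrow> \<bar>t - s\<bar> \<le> 1/2 \<Longrightarrow>
    c * \<rho> \<le> norm (v \<rho> t - v \<rho> s)"
    by (rule v_far_apart) blast
  show ?thesis
  proof (rule that[of "min (1 / (8 * K)) (c / 2)"])
    show "0 < min (1 / (8 * K)) (c / 2)" using K(1) c(1) by simp
    fix \<rho> :: real assume \<rho>: "\<rho> \<in> {0<..1}"
    then have r: "\<rho> \<in> {0..1}" and cr: "0 < c * \<rho>" using c(1) by auto
    note th = thickness_unit_speed[OF periodic_v[OF r] v_has_deriv[OF r] unit_v[OF r] K(2)[OF r] K(1) cr c(2)[OF r]]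
    have "min (1 / (8 * K)) (c / 2) * \<rho> \<le> 1 / (8 * K) * 1" "min (1 / (8 * K)) (c / 2) * \<rho> \<le> c / 2 * \<rho>"
      using \<rho> K(1) c(1) by (intro mult_mono; auto)+
    then have "ereal (min (1 / (8 * K)) (c / 2) * \<rho>) \<le> ereal (min (1 / (8 * K)) (c * \<rho> / 2))" by simp
    also have "\<dots> \<le> Thi (v \<rho>)" by (rule th(2))
    finally show "inj_on (v \<rho>) {0..<1} \<and> ereal (min (1 / (8 * K)) (c / 2) * \<rho>) \<le> Thi (v \<rho>)"
      using th(1) by blast
  qed
qed

end

theorem proposition4p2:
  fixes K :: "(real ^ 3) set set" and n :: nat
  assumes "tame_knot_class K"
    and "has_braid_index K n"
  shows "\<exists>(\<rho>0::real) (c::real) (C::real) (v :: real \<Rightarrow> real \<Rightarrow> real ^ 3).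
    0 < \<rho>0 \<and> 0 < c \<and> 0 < C \<and>
    (\<forall>\<rho>\<in>{0<..\<rho>0}. smooth_fun (v \<rho>) \<and> v \<rho> \<in> curves_of_class K) \<and>
    (\<forall>k. uniform_limit UNIV (\<lambda>\<rho>. nth_vderiv k (v \<rho>)) (nth_vderiv k (covered_circle n)) (at_right 0)) \<and>
    (\<forall>\<rho>\<in>{0<..\<rho>0}.
       \<bar>E_bar (v \<rho>) - (2 * pi * real n)\<^sup>2\<bar> \<le> C * \<rho>\<^sup>2 \<and>
       ereal (c * \<rho>) \<le> Thi (v \<rho>) \<and>
       Rop (v \<rho>) \<le> ereal (C * inverse \<rho>))"
proof -
  obtain L where L: "L \<in> K" "closed_braid n L" using assms(2) unfolding has_braid_index_def by blast
  have "connected L" using tame_knot_class_connected[OF assms(1) L(1)] .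
  then obtain r h where n: "1 \<le> n" and rh: "smooth_fun r" "smooth_fun h" "\<And>\<theta>. 0 < r \<theta>"
    "\<And>\<theta>. r (\<theta> + 2 * pi * real n) = r \<theta>" "\<And>\<theta>. h (\<theta> + 2 * pi * real n) = h \<theta>"
    and sep: "\<And>\<theta> k. 0 < k \<Longrightarrow> k < n \<Longrightarrow>
      (r (\<theta> + 2 * pi * real k), h (\<theta> + 2 * pi * real k)) \<noteq> (r \<theta>, h \<theta>)"
    and range: "L = range (\<lambda>\<theta>. cyl (r \<theta>) \<theta> (h \<theta>))"
    by (rule connected_braid_single_strand[OF L(2)]) blast
  define w where "w = 2 * pi * real n"
  have w: "0 < w" using n by (simp add: w_def)
  \<comment> \<open>One unit of the new parameter is n turns, so a shift by k/n is a shift by k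
    turns.\<close>
  define a where "a = (\<lambda>t. r (w * t))"
  define b where "b = (\<lambda>t. h (w * t))"
  interpret thin_braid n a b
  proof
    show "smooth_fun a" "smooth_fun b" unfolding a_def b_def using rh by (auto intro: smooth_fun_scale_arg)
    show "periodic1 a" "periodic1 b"
      using rh(4,5)[of "w * _"] by (simp_all add: periodic1_def a_def b_def distrib_left w_def)
    fix t k assume k: "0 < k" "k < n"
    have "w * (t + real k / real n) = w * t + 2 * pi * real k" using n by (simp add: w_def field_simps)
    then show "(a (t + real k / real n), b (t + real k / real n)) \<noteq> (a t, b t)"
      using sep[OF k, of "w * t"] by (simp add: a_def b_def)
  qed (use n rh in \<open>auto simp: a_def\<close>)
  have \<omega>: "\<omega> = w" by (simp add: \<omega>_def w_def)
  obtain S T where "thin_braid_arclength n a b S T" using exists_arclength by blast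
  then interpret thin_braid_arclength n a b S T .
  \<comment> \<open>With \<open>m\<close> below all radii, the braid lies where the squeeze is
    affine in the radius.\<close>
  obtain m where m: "0 < m" "\<And>t. m \<le> a t"
    using periodic1_pos_lower_bound[OF per(1) conts(1) pos] by blast
  have range_a: "L = range (\<lambda>t. cyl (a t) (\<omega> * t) (b t))"
  proof -
    have "surj (\<lambda>t. w * t)" using w by (intro surjI[where f = "\<lambda>\<theta>. \<theta> / w"]) simp
    then have "L = (\<lambda>\<theta>. cyl (r \<theta>) \<theta> (h \<theta>)) ` range (\<lambda>t. w * t)" by (simp only: range)
    then show ?thesis by (simp only: image_image a_def b_def \<omega>)
  qed
  have in_class: "range (v \<rho>) \<in> K" if \<rho>: "\<rho> \<in> {0<..1}" for \<rho>
  proof -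
    have r: "\<rho> \<in> {0..1}" "0 < \<rho>" using \<rho> by auto
    have "ambient_isotopic L (squeeze m 1 \<rho> ` L)" using m(1) r(2) by (rule ambient_isotopic_squeeze)
    also have "squeeze m 1 \<rho> ` L = range (\<eta> \<rho>)"
      unfolding range_a image_image \<eta>_def cyl_def using squeeze_cylindrical[OF m] by simp
    finally have 1: "ambient_isotopic L (range (\<eta> \<rho>))" .
    have "0 < inverse (len \<rho>)" using len_ge[OF r(1)] omega_pos by simp
    then have "ambient_isotopic (range (\<eta> \<rho>)) (range (v \<rho>))"
      unfolding range_v[OF r(1)] by (rule ambient_isotopic_scale_translate)
    with 1 have "ambient_isotopic L (range (v \<rho>))" by (rule ambient_isotopic_trans)
    \<comment> \<open>\<open>K\<close> consists of all sets isotopic to one fixed knot, so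
      transitivity carries membership from \<open>L\<close> to the curve.\<close>
    then show ?thesis using assms(1) L(1) ambient_isotopic_trans unfolding tame_knot_class_def by blast
  qed
  obtain C where C: "0 < C" "\<And>\<rho>. \<rho> \<in> {0..1} \<Longrightarrow> \<bar>E_bar (v \<rho>) - \<omega>\<^sup>2\<bar> \<le> C * \<rho>\<^sup>2"
    by (rule E_bar_v_estimate) blast
  obtain c where c: "0 < c"
    "\<And>\<rho>. \<rho> \<in> {0<..1} \<Longrightarrow> inj_on (v \<rho>) {0..<1} \<and> ereal (c * \<rho>) \<le> Thi (v \<rho>)"
    by (rule v_thickness) blast
  have curves: "smooth_fun (v \<rho>) \<and> v \<rho> \<in> curves_of_class K" if \<rho>: "\<rho> \<in> {0<..1}" for \<rho>
  proof -
    have r: "\<rho> \<in> {0..1}" using \<rho> by auto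
    show ?thesis
      unfolding curves_of_class_def
      using smooth_v[OF r] H2_curve_smooth[OF smooth_v[OF r] periodic_v[OF r]] v_0[OF r]
        c(2)[OF \<rho>] in_class[OF \<rho>] unit_v[OF r] nth_vderiv_v[OF r, of 1] by simp
  qed
  \<comment> \<open>At length 1 the ropelength is at most 1/(c \<rho>), so the common constant must
    dominate 1/c as well as the energy constant.\<close>
  have bounds: "\<bar>E_bar (v \<rho>) - (2 * pi * real n)\<^sup>2\<bar> \<le> max C (inverse c) * \<rho>\<^sup>2 \<and>
       ereal (c * \<rho>) \<le> Thi (v \<rho>) \<and> Rop (v \<rho>) \<le> ereal (max C (inverse c) * inverse \<rho>)"
    if \<rho>: "\<rho> \<in> {0<..1}" for \<rho>
  proof (intro conjI)
    have r: "\<rho> \<in> {0..1}" "0 < \<rho>" using \<rho> by auto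
    have "C * \<rho>\<^sup>2 \<le> max C (inverse c) * \<rho>\<^sup>2" by (intro mult_right_mono) auto
    then show "\<bar>E_bar (v \<rho>) - (2 * pi * real n)\<^sup>2\<bar> \<le> max C (inverse c) * \<rho>\<^sup>2"
      using C(2)[OF r(1)] unfolding \<omega> w_def by linarith
    show th: "ereal (c * \<rho>) \<le> Thi (v \<rho>)" using c(2)[OF \<rho>] by blast
    have "Rop (v \<rho>) \<le> ereal (inverse (c * \<rho>))"
      using c(1) r th curve_length_v by (intro Rop_le) auto
    also have "\<dots> \<le> ereal (max C (inverse c) * inverse \<rho>)"
      using r(2) by (simp add: mult_right_mono)
    finally show "Rop (v \<rho>) \<le> ereal (max C (inverse c) * inverse \<rho>)" .
  qed
  show ?thesis
    using C(1) c(1) curves v_smooth_convergence bounds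
    by (intro exI[of _ 1] exI[of _ c] exI[of _ "max C (inverse c)"] exI[of _ v]) auto
qed

end
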